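(* There exist infinitely many compact homogeneous spaces admitting an invariant non-flat BRF pair $(g,H)$.
   Context: Given a Riemannian manifold $(M,g)$ with Levi-Civita connection $\nabla^g$ and a $3$-form $H\in\Omega^3(M)$, the Bismut connection induced by $(g,H)$ is the metric connection $\nabla$ defined by $g(\nabla_XY,Z)=g(\nabla^g_XY,Z)+\frac12 H(X,Y,Z)$. Its curvature is $R^\nabla_{X,Y}Z=\nabla_X\nabla_YZ-\nabla_Y\nabla_XZ-\nabla_{[X,Y]}Z$ and its Ricci tensor is $\mathrm{Ric}^\nabla(Y,Z)=\sum_j g(R^\nabla_{e_j,Y}Z,e_j)$ for a $g$-orthonormal basis $(e_j)$. The pair $(g,H)$ is a Bismut Ricci flat pair (BRF pair) if $dH=0$ and $\mathrm{Ric}^\nabla=0$; it is non-flat if $R^\nabla$ is not identically zero. A pair $(g,H)$ on a homogeneous space of a Lie group is invariant if both $g$ and $H$ are invariant under the (transitive) action of the group. *)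

theory Defs
  imports "HOL-Analysis.Analysis" "HOL-Algebra.Group_Action"
begin

section \<open>Smooth manifolds\<close>

text \<open>The dimension varies along the family of manifolds that is claimed to exist, so the model
  spaces are the subspaces \<^term>\<open>Euclidean_space n\<close> of the single type of real sequences. Smoothness
  on an open subset means that all iterated partial derivatives exist and are continuous.\<close>

definition coord_deriv :: "nat \<Rightarrow> ((nat \<Rightarrow> real) \<Rightarrow> real) \<Rightarrow> (nat \<Rightarrow> real) \<Rightarrow> real" where
  "coord_deriv i f x = deriv (\<lambda>t. f (x(i := t))) (x i)"

definition smooth_real_on :: "nat \<Rightarrow> (nat \<Rightarrow> real) set \<Rightarrow> ((nat \<Rightarrow> real) \<Rightarrow> real) \<Rightarrow> bool" where
  "smooth_real_on n W f \<longleftrightarrow>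
     (\<forall>js. set js \<subseteq> {..<n} \<longrightarrow>
        continuous_map (subtopology (Euclidean_space n) W) euclideanreal (foldr coord_deriv js f) \<and>
        (\<forall>x\<in>W. \<forall>i<n. (\<lambda>t. foldr coord_deriv js f (x(i := t))) field_differentiable at (x i)))"

text \<open>A chart is a pair of its domain and its coordinate map. The atlas need not be maximal.\<close>

record 'a smooth_mfd =
  mtop :: "'a topology"
  mdim :: nat
  matlas :: "('a set \<times> ('a \<Rightarrow> nat \<Rightarrow> real)) set"

abbreviation mpoints :: "'a smooth_mfd \<Rightarrow> 'a set" where
  "mpoints M \<equiv> topspace (mtop M)"

definition is_smooth_mfd :: "'a smooth_mfd \<Rightarrow> bool" where
  "is_smooth_mfd M \<longleftrightarrow>
     Hausdorff_space (mtop M) \<and> second_countable (mtop M) \<and>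
     mpoints M = \<Union> (fst ` matlas M) \<and>
     (\<forall>(U, \<phi>) \<in> matlas M.
        openin (mtop M) U \<and> openin (Euclidean_space (mdim M)) (\<phi> ` U) \<and>
        homeomorphic_map (subtopology (mtop M) U)
          (subtopology (Euclidean_space (mdim M)) (\<phi> ` U)) \<phi>) \<and>
     (\<forall>(U, \<phi>) \<in> matlas M. \<forall>(V, \<psi>) \<in> matlas M. \<forall>i<mdim M.
        smooth_real_on (mdim M) (\<phi> ` (U \<inter> V)) (\<lambda>x. \<psi> (inv_into U \<phi> x) i))"

definition smooth_map :: "'a smooth_mfd \<Rightarrow> 'b smooth_mfd \<Rightarrow> ('a \<Rightarrow> 'b) \<Rightarrow> bool" where
  "smooth_map M N F \<longleftrightarrow>
     continuous_map (mtop M) (mtop N) F \<and>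
     (\<forall>(U, \<phi>) \<in> matlas M. \<forall>(V, \<psi>) \<in> matlas N. \<forall>i<mdim N.
        smooth_real_on (mdim M) (\<phi> ` {p \<in> U. F p \<in> V}) (\<lambda>x. \<psi> (F (inv_into U \<phi> x)) i))"

definition diffeomorphic :: "'a smooth_mfd \<Rightarrow> 'b smooth_mfd \<Rightarrow> bool" where
  "diffeomorphic M N \<longleftrightarrow>
     (\<exists>F F'. smooth_map M N F \<and> smooth_map N M F' \<and>
        (\<forall>p\<in>mpoints M. F' (F p) = p) \<and> (\<forall>q\<in>mpoints N. F (F' q) = q))"

definition prod_mfd :: "'a smooth_mfd \<Rightarrow> 'b smooth_mfd \<Rightarrow> ('a \<times> 'b) smooth_mfd" where
  "prod_mfd M N =
     \<lparr>mtop = prod_topology (mtop M) (mtop N),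
      mdim = mdim M + mdim N,
      matlas = {(U \<times> V, \<lambda>(p, q) i. if i < mdim M then \<phi> p i else \<psi> q (i - mdim M)) |U \<phi> V \<psi>.
                (U, \<phi>) \<in> matlas M \<and> (V, \<psi>) \<in> matlas N}\<rparr>"

definition smooth_funs :: "'a smooth_mfd \<Rightarrow> ('a \<Rightarrow> real) set" where
  "smooth_funs M =
     {f. \<forall>(U, \<phi>) \<in> matlas M. smooth_real_on (mdim M) (\<phi> ` U) (\<lambda>x. f (inv_into U \<phi> x))}"

section \<open>Lie groups and homogeneous spaces\<close>

definition lie_group :: "('g, 'm) monoid_scheme \<Rightarrow> 'g smooth_mfd \<Rightarrow> bool" where
  "lie_group G L \<longleftrightarrow>
     group G \<and> is_smooth_mfd L \<and> carrier G = mpoints L \<and>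
     smooth_map (prod_mfd L L) L (\<lambda>(a, b). a \<otimes>\<^bsub>G\<^esub> b) \<and>
     smooth_map L L (\<lambda>a. inv\<^bsub>G\<^esub> a)"

definition homogeneous_space ::
  "('g, 'm) monoid_scheme \<Rightarrow> 'g smooth_mfd \<Rightarrow> ('g \<Rightarrow> 'a \<Rightarrow> 'a) \<Rightarrow> 'a smooth_mfd \<Rightarrow> bool" where
  "homogeneous_space G L act M \<longleftrightarrow>
     lie_group G L \<and> is_smooth_mfd M \<and>
     transitive_action G (mpoints M) act \<and>
     smooth_map (prod_mfd L M) M (\<lambda>(a, p). act a p)"

section \<open>Tangent vectors and vector fields\<close>

text \<open>Tangent vectors at \<open>p\<close> are derivations at \<open>p\<close> of the algebra of smooth functions; they are
  zero outside that algebra, so that they are determined by their values on it. A derivation at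
  a point of \<open>M\<close> does not see the values of a function outside \<open>M\<close>.\<close>

type_synonym 'a tvec = "('a \<Rightarrow> real) \<Rightarrow> real"
type_synonym 'a vfield = "'a \<Rightarrow> 'a tvec"
type_synonym 'a metric = "'a \<Rightarrow> 'a tvec \<Rightarrow> 'a tvec \<Rightarrow> real"
type_synonym 'a threeform = "'a \<Rightarrow> 'a tvec \<Rightarrow> 'a tvec \<Rightarrow> 'a tvec \<Rightarrow> real"
type_synonym 'a conn = "'a vfield \<Rightarrow> 'a vfield \<Rightarrow> 'a vfield"

definition tspace :: "'a smooth_mfd \<Rightarrow> 'a \<Rightarrow> 'a tvec set" where
  "tspace M p =
     {v. (\<forall>f. f \<notin> smooth_funs M \<longrightarrow> v f = 0) \<and>
         (\<forall>f\<in>smooth_funs M. \<forall>h\<in>smooth_funs M. \<forall>a b.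
            v (\<lambda>x. a * f x + b * h x) = a * v f + b * v h) \<and>
         (\<forall>f\<in>smooth_funs M. \<forall>h\<in>smooth_funs M.
            v (\<lambda>x. f x * h x) = v f * h p + f p * v h)}"

definition vfields :: "'a smooth_mfd \<Rightarrow> 'a vfield set" where
  "vfields M =
     {X. (\<forall>p\<in>mpoints M. X p \<in> tspace M p) \<and> (\<forall>p. p \<notin> mpoints M \<longrightarrow> X p = (\<lambda>f. 0)) \<and>
         (\<forall>f\<in>smooth_funs M. (\<lambda>p. X p f) \<in> smooth_funs M)}"

definition vf_add :: "'a vfield \<Rightarrow> 'a vfield \<Rightarrow> 'a vfield" where
  "vf_add X Y = (\<lambda>p f. X p f + Y p f)"

definition vf_diff :: "'a vfield \<Rightarrow> 'a vfield \<Rightarrow> 'a vfield" where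
  "vf_diff X Y = (\<lambda>p f. X p f - Y p f)"

definition vf_scale :: "('a \<Rightarrow> real) \<Rightarrow> 'a vfield \<Rightarrow> 'a vfield" where
  "vf_scale u X = (\<lambda>p f. u p * X p f)"

definition lie_bracket :: "'a vfield \<Rightarrow> 'a vfield \<Rightarrow> 'a vfield" where
  "lie_bracket X Y = (\<lambda>p f. X p (\<lambda>q. Y q f) - Y p (\<lambda>q. X q f))"

definition pushforward :: "'a smooth_mfd \<Rightarrow> 'b smooth_mfd \<Rightarrow> ('a \<Rightarrow> 'b) \<Rightarrow> 'a tvec \<Rightarrow> 'b tvec" where
  "pushforward M N F v = (\<lambda>f. if f \<in> smooth_funs N then v (f \<circ> F) else 0)"

section \<open>Metrics, three-forms and connections\<close>

definition tlinear :: "'a smooth_mfd \<Rightarrow> 'a \<Rightarrow> ('a tvec \<Rightarrow> real) \<Rightarrow> bool" where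
  "tlinear M p \<alpha> \<longleftrightarrow>
     (\<forall>v\<in>tspace M p. \<forall>w\<in>tspace M p. \<forall>a b.
        \<alpha> (\<lambda>f. a * v f + b * w f) = a * \<alpha> v + b * \<alpha> w)"

definition riemannian_metric :: "'a smooth_mfd \<Rightarrow> 'a metric \<Rightarrow> bool" where
  "riemannian_metric M g \<longleftrightarrow>
     (\<forall>p\<in>mpoints M. \<forall>v\<in>tspace M p. \<forall>w\<in>tspace M p.
        tlinear M p (\<lambda>u. g p u w) \<and> g p v w = g p w v \<and> (v \<noteq> (\<lambda>f. 0) \<longrightarrow> g p v v > 0)) \<and>
     (\<forall>X\<in>vfields M. \<forall>Y\<in>vfields M. (\<lambda>p. g p (X p) (Y p)) \<in> smooth_funs M)"

text \<open>Linearity is only demanded in the first argument; antisymmetry gives it in the others.\<close>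

definition three_form :: "'a smooth_mfd \<Rightarrow> 'a threeform \<Rightarrow> bool" where
  "three_form M H \<longleftrightarrow>
     (\<forall>p\<in>mpoints M. \<forall>u\<in>tspace M p. \<forall>v\<in>tspace M p. \<forall>w\<in>tspace M p.
        tlinear M p (\<lambda>z. H p z v w) \<and> H p u v w = - H p v u w \<and> H p u v w = - H p u w v) \<and>
     (\<forall>X\<in>vfields M. \<forall>Y\<in>vfields M. \<forall>Z\<in>vfields M.
        (\<lambda>p. H p (X p) (Y p) (Z p)) \<in> smooth_funs M)"

definition ext_deriv3 ::
  "'a threeform \<Rightarrow> 'a vfield \<Rightarrow> 'a vfield \<Rightarrow> 'a vfield \<Rightarrow> 'a vfield \<Rightarrow> 'a \<Rightarrow> real" where
  "ext_deriv3 H W X Y Z p =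
     (let h = (\<lambda>A B C q. H q (A q) (B q) (C q)) in
        W p (h X Y Z) - X p (h W Y Z) + Y p (h W X Z) - Z p (h W X Y)
        - h (lie_bracket W X) Y Z p + h (lie_bracket W Y) X Z p - h (lie_bracket W Z) X Y p
        - h (lie_bracket X Y) W Z p + h (lie_bracket X Z) W Y p - h (lie_bracket Y Z) W X p)"

definition closed_three_form :: "'a smooth_mfd \<Rightarrow> 'a threeform \<Rightarrow> bool" where
  "closed_three_form M H \<longleftrightarrow>
     three_form M H \<and>
     (\<forall>W\<in>vfields M. \<forall>X\<in>vfields M. \<forall>Y\<in>vfields M. \<forall>Z\<in>vfields M. \<forall>p\<in>mpoints M.
        ext_deriv3 H W X Y Z p = 0)"

definition connection :: "'a smooth_mfd \<Rightarrow> 'a conn \<Rightarrow> bool" where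
  "connection M D \<longleftrightarrow>
     (\<forall>X\<in>vfields M. \<forall>Y\<in>vfields M. \<forall>Z\<in>vfields M. \<forall>u\<in>smooth_funs M.
        D X Y \<in> vfields M \<and>
        D (vf_add X Y) Z = vf_add (D X Z) (D Y Z) \<and>
        D (vf_scale u X) Y = vf_scale u (D X Y) \<and>
        D X (vf_add Y Z) = vf_add (D X Y) (D X Z) \<and>
        D X (vf_scale u Y) = vf_add (vf_scale (\<lambda>p. X p u) Y) (vf_scale u (D X Y)))"

definition metric_connection :: "'a smooth_mfd \<Rightarrow> 'a metric \<Rightarrow> 'a conn \<Rightarrow> bool" where
  "metric_connection M g D \<longleftrightarrow>
     connection M D \<and>
     (\<forall>X\<in>vfields M. \<forall>Y\<in>vfields M. \<forall>Z\<in>vfields M. \<forall>p\<in>mpoints M.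
        X p (\<lambda>q. g q (Y q) (Z q)) = g p (D X Y p) (Z p) + g p (Y p) (D X Z p))"

definition levi_civita :: "'a smooth_mfd \<Rightarrow> 'a metric \<Rightarrow> 'a conn \<Rightarrow> bool" where
  "levi_civita M g D \<longleftrightarrow>
     metric_connection M g D \<and>
     (\<forall>X\<in>vfields M. \<forall>Y\<in>vfields M. vf_diff (D X Y) (D Y X) = lie_bracket X Y)"

text \<open>On vector fields the Levi-Civita connection, hence the Bismut connection, is uniquely
  determined by the metric and the three-form.\<close>

definition bismut_connection ::
  "'a smooth_mfd \<Rightarrow> 'a metric \<Rightarrow> 'a threeform \<Rightarrow> 'a conn \<Rightarrow> bool" where
  "bismut_connection M g H D \<longleftrightarrow>
     metric_connection M g D \<and>
     (\<exists>D0. levi_civita M g D0 \<and>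
        (\<forall>X\<in>vfields M. \<forall>Y\<in>vfields M. \<forall>Z\<in>vfields M. \<forall>p\<in>mpoints M.
           g p (D X Y p) (Z p) = g p (D0 X Y p) (Z p) + 1 / 2 * H p (X p) (Y p) (Z p)))"

definition curvature :: "'a conn \<Rightarrow> 'a vfield \<Rightarrow> 'a vfield \<Rightarrow> 'a vfield \<Rightarrow> 'a vfield" where
  "curvature D X Y Z =
     vf_diff (vf_diff (D X (D Y Z)) (D Y (D X Z))) (D (lie_bracket X Y) Z)"

definition flat_connection :: "'a smooth_mfd \<Rightarrow> 'a conn \<Rightarrow> bool" where
  "flat_connection M D \<longleftrightarrow>
     (\<forall>X\<in>vfields M. \<forall>Y\<in>vfields M. \<forall>Z\<in>vfields M. curvature D X Y Z = (\<lambda>p f. 0))"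

text \<open>The curvature is tensorial, so the Ricci tensor at \<open>p\<close> can be computed from vector fields
  \<open>E 0, \<dots>, E (n - 1)\<close> that are orthonormal at \<open>p\<close>, where \<open>n\<close> is the dimension; the value does not
  depend on their choice.\<close>

definition orthonormal_at :: "'a smooth_mfd \<Rightarrow> 'a metric \<Rightarrow> 'a \<Rightarrow> (nat \<Rightarrow> 'a vfield) \<Rightarrow> bool" where
  "orthonormal_at M g p E \<longleftrightarrow>
     (\<forall>i<mdim M. E i \<in> vfields M) \<and>
     (\<forall>i<mdim M. \<forall>j<mdim M. g p (E i p) (E j p) = (if i = j then 1 else 0))"

definition ricci ::
  "'a smooth_mfd \<Rightarrow> 'a metric \<Rightarrow> 'a conn \<Rightarrow> (nat \<Rightarrow> 'a vfield) \<Rightarrow> 'a vfield \<Rightarrow> 'a vfield \<Rightarrow> 'a \<Rightarrow> real"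
  where
  "ricci M g D E Y Z p = (\<Sum>j<mdim M. g p (curvature D (E j) Y Z p) (E j p))"

definition ricci_flat :: "'a smooth_mfd \<Rightarrow> 'a metric \<Rightarrow> 'a conn \<Rightarrow> bool" where
  "ricci_flat M g D \<longleftrightarrow>
     (\<forall>p\<in>mpoints M. \<forall>E. orthonormal_at M g p E \<longrightarrow>
        (\<forall>Y\<in>vfields M. \<forall>Z\<in>vfields M. ricci M g D E Y Z p = 0))"

section \<open>Bismut Ricci flat pairs\<close>

definition brf_pair :: "'a smooth_mfd \<Rightarrow> 'a metric \<Rightarrow> 'a threeform \<Rightarrow> bool" where
  "brf_pair M g H \<longleftrightarrow>
     riemannian_metric M g \<and> closed_three_form M H \<and>
     (\<exists>D. bismut_connection M g H D \<and> ricci_flat M g D)"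

definition non_flat_pair :: "'a smooth_mfd \<Rightarrow> 'a metric \<Rightarrow> 'a threeform \<Rightarrow> bool" where
  "non_flat_pair M g H \<longleftrightarrow> (\<exists>D. bismut_connection M g H D \<and> \<not> flat_connection M D)"

definition invariant_pair ::
  "('g, 'm) monoid_scheme \<Rightarrow> ('g \<Rightarrow> 'a \<Rightarrow> 'a) \<Rightarrow> 'a smooth_mfd \<Rightarrow> 'a metric \<Rightarrow> 'a threeform \<Rightarrow> bool"
  where
  "invariant_pair G act M g H \<longleftrightarrow>
     (\<forall>a\<in>carrier G. \<forall>p\<in>mpoints M. \<forall>u\<in>tspace M p. \<forall>v\<in>tspace M p. \<forall>w\<in>tspace M p.
        g (act a p) (pushforward M M (act a) u) (pushforward M M (act a) v) = g p u v \<and>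
        H (act a p) (pushforward M M (act a) u) (pushforward M M (act a) v)
          (pushforward M M (act a) w) = H p u v w)"

end

(* The manifolds are the groups M = S^3 x ... x S^3 with m >= 3 factors, acting on themselves by
   left translations. For a left-invariant orthonormal frame with structure constants c and an
   invariant three-form h, the Bismut connection has the constant coefficients
   Gamma_ijk = (c_ijk - c_jki + c_kij + h_ijk) / 2, so every condition is algebraic. The Lie algebra
   is so(3) tensor R^m with the componentwise product on R^m, and metrics and forms invariant under
   the diagonal adjoint action reduce to arrays on R^m. On the first three factors,
   G^3 = (G^2 x G^2) / Delta G carries the metric for which
   s = (e_0 - e_1) / 2, t = (e_0 + e_1) / 2 + e_2, r = (e_0 + e_1) / 2
   are orthonormal, and the form h with h_ssr = h_ttr = h_rrr = 1. There Gamma_t and Gamma_r are the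
   identity and Gamma_s exchanges s and r; hence the only curvature components are
   R(s, s) acting on the t directions, which is nonzero and has vanishing Ricci trace. Each further
   factor carries its flat Bismut connection. The dimension 3 m distinguishes the manifolds. *)

theory Submission
  imports Defs "HOL-Homology.Invariance_of_Domain"
begin

section \<open>Smooth functions on open subsets of Euclidean space\<close>

text \<open>A bi-invariant metric whose three-form is plus or minus g([X,Y],Z) has a flat Bismut
  connection. The metric used here is only left-invariant: e_2 = t - r is not orthogonal to e_0 = r
  + s. Let x*y be twice the componentwise product on R^m, the factor coming from [i,j] = 2k for
  quaternion units. Then s*s = r, s*r = s*t = s, r*r = t*r = r, t*t = 2t - r. The connection sends
  the pair (a tensor x, b tensor y) to [a,b] tensor Gamma_x y, so by the Jacobi identity the
  curvature in block directions x, y vanishes if Gamma_x Gamma_y = Gamma_y Gamma_x = Gamma_{x*y}.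
  This fails only for x = y = s, because Gamma_s kills t and Gamma_{s*s} = Gamma_r fixes it. The
  trace misses this defect, whose first slot is in block s and whose value is in block t. On the
  analytic side, tangent vectors are derivations of the algebra of global smooth functions. That
  left-invariant fields span them is therefore a theorem, resting on Hadamard's lemma and bump
  functions.\<close>

lemma Euclidean_space_top_of_set:
  "Euclidean_space n = top_of_set (topspace (Euclidean_space n))"
  by (metis Euclidean_space_def euclidean_product_topology topspace_Euclidean_space)

lemma fun_upd_in_Euclidean_space:
  "x \<in> topspace (Euclidean_space n) \<Longrightarrow> i < n \<Longrightarrow> x(i := t) \<in> topspace (Euclidean_space n)"
  by (auto simp: topspace_Euclidean_space)

lemma continuous_map_Euclidean_subspace_iff:
  assumes "W \<subseteq> topspace (Euclidean_space n)"
  shows "continuous_map (subtopology (Euclidean_space n) W) euclideanreal f \<longleftrightarrow> continuous_on W f"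
proof -
  have "subtopology (Euclidean_space n) W = top_of_set W"
    by (metis Euclidean_space_top_of_set assms inf.absorb_iff2 subtopology_subtopology)
  then show ?thesis by simp
qed

text \<open>A basic open set of the product topology contains an interval around each coordinate of
  \<open>x\<close>; only the first \<open>n\<close> coordinates can vary, so the minimum of finitely
  many radii works.\<close>

lemma openin_Euclidean_space_box:
  assumes "openin (Euclidean_space n) W" "x \<in> W"
  obtains e where "e > 0"
    "\<And>y. y \<in> topspace (Euclidean_space n) \<Longrightarrow> (\<And>i. i < n \<Longrightarrow> \<bar>y i - x i\<bar> < e) \<Longrightarrow> y \<in> W"
proof -
  obtain T where T: "openin (powertop_real UNIV) T" "W = T \<inter> {x. \<forall>i\<ge>n. x i = 0}"
    using assms(1) unfolding Euclidean_space_def openin_subtopology by auto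
  then obtain X where X: "x \<in> Pi\<^sub>E UNIV X" "\<And>i. openin euclideanreal (X i)" "Pi\<^sub>E UNIV X \<subseteq> T"
    using product_topology_open_contains_basis[OF T(1)] assms(2) by (metis IntD1)
  have "\<exists>e>0. \<forall>y. \<bar>y - x i\<bar> < e \<longrightarrow> y \<in> X i" for i
  proof -
    have "open (X i)" "x i \<in> X i" using X by (auto simp: PiE_def)
    then show ?thesis by (metis open_dist dist_real_def)
  qed
  then obtain e where e: "\<And>i. e i > 0" "\<And>i y. \<bar>y - x i\<bar> < e i \<Longrightarrow> y \<in> X i" by metis
  \<comment> \<open>The element 1 keeps the set nonempty when \<open>n = 0\<close>.\<close>
  define d where "d = Min (insert 1 (e ` {..<n}))"
  have d: "d > 0" "\<And>i. i < n \<Longrightarrow> d \<le> e i"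
    unfolding d_def using e(1) by (auto simp: Min_gr_iff intro: Min_le)
  show thesis
  proof (rule that[OF d(1)])
    fix y assume y: "y \<in> topspace (Euclidean_space n)" "\<And>i. i < n \<Longrightarrow> \<bar>y i - x i\<bar> < d"
    have "y i \<in> X i" for i
    proof (cases "i < n")
      case True
      then show ?thesis using y(2) d(2) e(2) by (meson less_le_trans)
    next
      case False
      then have "y i = 0" "x i = 0" using y(1) T(2) assms(2) by (auto simp: topspace_Euclidean_space)
      then show ?thesis using e(1)[of i] e(2)[of 0 i] by simp
    qed
    then show "y \<in> W" using X(3) T(2) y(1) by (auto simp: topspace_Euclidean_space PiE_def)
  qed
qed

text \<open>This is what makes partial derivatives at a point of \<open>W\<close> depend only on the
  values on \<open>W\<close>.\<close>

lemma eventually_fun_upd_in: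
  assumes "openin (Euclidean_space n) W" "x \<in> W" "i < n"
  shows "\<forall>\<^sub>F t in nhds (x i). x(i := t) \<in> W"
proof -
  obtain e where e: "e > 0"
    "\<And>y. y \<in> topspace (Euclidean_space n) \<Longrightarrow> (\<And>i. i < n \<Longrightarrow> \<bar>y i - x i\<bar> < e) \<Longrightarrow> y \<in> W"
    using openin_Euclidean_space_box[OF assms(1,2)] by metis
  have "x \<in> topspace (Euclidean_space n)" using assms openin_subset by blast
  then have "x(i := t) \<in> W" if "\<bar>t - x i\<bar> < e" for t
    using that e assms(3) by (intro e(2) fun_upd_in_Euclidean_space) auto
  then show ?thesis using e(1) by (auto simp: eventually_nhds_metric dist_real_def)
qed

section \<open>Differentiability of finite order\<close>

lemma coord_derivI:
  "((\<lambda>t. f (x(i := t))) has_field_derivative d) (at (x i)) \<Longrightarrow> coord_deriv i f x = d"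
  unfolding coord_deriv_def by (rule DERIV_imp_deriv)

text \<open>The partial derivative is an existentially quantified function that need only be right
  on \<open>W\<close>. Closure under sums, products and composition then becomes an induction on
  \<open>k\<close> with an explicit witness at each level, which the list formulation of
  \<open>smooth_real_on\<close> does not offer.\<close>

primrec Ck_on :: "nat \<Rightarrow> nat \<Rightarrow> (nat \<Rightarrow> real) set \<Rightarrow> ((nat \<Rightarrow> real) \<Rightarrow> real) \<Rightarrow> bool" where
  "Ck_on 0 n W f \<longleftrightarrow> continuous_on W f"
| "Ck_on (Suc k) n W f \<longleftrightarrow> continuous_on W f \<and>
     (\<forall>i<n. \<exists>f'. (\<forall>x\<in>W. ((\<lambda>t. f (x(i := t))) has_field_derivative f' x) (at (x i))) \<and> Ck_on k n W f')"

lemma Ck_on_continuous: "Ck_on k n W f \<Longrightarrow> continuous_on W f"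
  by (cases k) auto

lemma Ck_on_Suc: "Ck_on (Suc k) n W f \<Longrightarrow> Ck_on k n W f"
proof (induction k arbitrary: f)
  case 0 then show ?case by (simp only: Ck_on.simps)
next
  case (Suc k)
  have "\<exists>f'. (\<forall>x\<in>W. ((\<lambda>t. f (x(i := t))) has_field_derivative f' x) (at (x i))) \<and> Ck_on k n W f'"
    if "i < n" for i
    using Suc that by (subst (asm) Ck_on.simps(2)) blast
  moreover have "continuous_on W f" using Suc.prems by (rule Ck_on_continuous)
  ultimately show ?case by simp
qed

lemma Ck_on_mono: "Ck_on k n W f \<Longrightarrow> j \<le> k \<Longrightarrow> Ck_on j n W f"
  by (induction k) (auto simp: le_Suc_eq simp del: Ck_on.simps dest: Ck_on_Suc)

lemma has_field_derivative_upd_cong: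
  assumes "openin (Euclidean_space n) W" "\<And>y. y \<in> W \<Longrightarrow> f y = g y" "x \<in> W" "i < n"
  shows "((\<lambda>t. f (x(i := t))) has_field_derivative d) (at (x i)) \<longleftrightarrow>
         ((\<lambda>t. g (x(i := t))) has_field_derivative d) (at (x i))"
  by (rule DERIV_cong_ev) (use eventually_fun_upd_in[OF assms(1,3,4)] assms(2) in \<open>auto elim: eventually_mono\<close>)

lemma Ck_on_cong:
  assumes "openin (Euclidean_space n) W" "\<And>y. y \<in> W \<Longrightarrow> f y = g y" "Ck_on k n W f"
  shows "Ck_on k n W g"
proof (cases k)
  case 0
  then show ?thesis using assms by (simp cong: continuous_on_cong)
next
  case (Suc j)
  have "continuous_on W g" using assms Ck_on_continuous by (metis continuous_on_cong)
  moreover have "\<exists>f'. (\<forall>x\<in>W. ((\<lambda>t. g (x(i := t))) has_field_derivative f' x) (at (x i))) \<and> Ck_on j n W f'"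
    if i: "i < n" for i
  proof -
    obtain f' where "\<forall>x\<in>W. ((\<lambda>t. f (x(i := t))) has_field_derivative f' x) (at (x i))" "Ck_on j n W f'"
      using assms(3) i Suc by auto
    then show ?thesis
      using has_field_derivative_upd_cong[OF assms(1), of f g _ i] assms(2) i by blast
  qed
  ultimately show ?thesis using Suc by simp
qed

lemma Ck_on_coord_deriv:
  assumes "openin (Euclidean_space n) W" "Ck_on (Suc k) n W f" "i < n"
  shows "Ck_on k n W (coord_deriv i f)"
    and "x \<in> W \<Longrightarrow> ((\<lambda>t. f (x(i := t))) has_field_derivative coord_deriv i f x) (at (x i))"
proof -
  obtain f' where f': "\<forall>x\<in>W. ((\<lambda>t. f (x(i := t))) has_field_derivative f' x) (at (x i))" "Ck_on k n W f'"
    using assms(2,3) by auto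
  then have eq: "f' x = coord_deriv i f x" if "x \<in> W" for x
    using that coord_derivI by metis
  show "Ck_on k n W (coord_deriv i f)"
    by (rule Ck_on_cong[OF assms(1) eq f'(2)])
  show "((\<lambda>t. f (x(i := t))) has_field_derivative coord_deriv i f x) (at (x i))" if "x \<in> W"
    using f'(1) eq that by metis
qed

lemma Ck_on_foldr:
  assumes W: "openin (Euclidean_space n) W"
  shows "set js \<subseteq> {..<n} \<Longrightarrow> Ck_on (length js + k) n W f \<Longrightarrow> Ck_on k n W (foldr coord_deriv js f)"
proof (induction js arbitrary: k)
  case (Cons j js)
  then have "Ck_on (Suc k) n W (foldr coord_deriv js f)"
    by (intro Cons.IH) auto
  then show ?case using Ck_on_coord_deriv(1)[OF W] Cons.prems by simp
qed simp

lemma smooth_real_on_iff_Ck: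
  assumes W: "openin (Euclidean_space n) W"
  shows "smooth_real_on n W f \<longleftrightarrow> (\<forall>k. Ck_on k n W f)"
proof
  assume f: "smooth_real_on n W f"
  \<comment> \<open>Generalised over \<open>js\<close>: a partial derivative of
    \<open>foldr coord_deriv js f\<close> is the same expression for a longer list, with one level
    fewer to go.\<close>
  have "Ck_on k n W (foldr coord_deriv js f)" if "set js \<subseteq> {..<n}" for k js
    using that
  proof (induction k arbitrary: js)
    case 0
    then show ?case using f openin_subset[OF W]
      by (simp add: smooth_real_on_def continuous_map_Euclidean_subspace_iff)
  next
    case (Suc k)
    have "\<exists>f'. (\<forall>x\<in>W. ((\<lambda>t. foldr coord_deriv js f (x(i := t))) has_field_derivative f' x) (at (x i))) \<and> Ck_on k n W f'"
      if i: "i < n" for i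
    proof (intro exI conjI ballI)
      show "Ck_on k n W (foldr coord_deriv (i # js) f)"
        by (rule Suc.IH) (use i Suc.prems in auto)
      show "((\<lambda>t. foldr coord_deriv js f (x(i := t))) has_field_derivative foldr coord_deriv (i # js) f x) (at (x i))"
        if "x \<in> W" for x
        using f i that Suc.prems unfolding smooth_real_on_def
        by (auto simp: coord_deriv_def field_differentiable_derivI)
    qed
    moreover have "continuous_on W (foldr coord_deriv js f)"
      using f openin_subset[OF W] Suc.prems
      by (simp add: smooth_real_on_def continuous_map_Euclidean_subspace_iff)
    ultimately show ?case by simp
  qed
  from this[of "[]"] show "\<forall>k. Ck_on k n W f" by simp
next
  assume f: "\<forall>k. Ck_on k n W f"
  show "smooth_real_on n W f"
    unfolding smooth_real_on_def
  proof (intro allI impI conjI ballI)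
    fix js assume js: "set js \<subseteq> {..<n}"
    have *: "Ck_on k n W (foldr coord_deriv js f)" for k
      by (rule Ck_on_foldr[OF W js]) (use f in blast)
    show "continuous_map (subtopology (Euclidean_space n) W) euclideanreal (foldr coord_deriv js f)"
      using Ck_on_continuous[OF *] openin_subset[OF W] by (simp add: continuous_map_Euclidean_subspace_iff)
    show "(\<lambda>t. foldr coord_deriv js f (x(i := t))) field_differentiable at (x i)" if "x \<in> W" "i < n" for x i
      using Ck_on_coord_deriv(2)[OF W * that(2,1)] field_differentiable_def by blast
  qed
qed

lemma smooth_real_onD:
  assumes "openin (Euclidean_space n) W" "smooth_real_on n W f"
  shows "continuous_on W f"
    and "i < n \<Longrightarrow> x \<in> W \<Longrightarrow> ((\<lambda>t. f (x(i := t))) has_field_derivative coord_deriv i f x) (at (x i))"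
    and "i < n \<Longrightarrow> smooth_real_on n W (coord_deriv i f)"
  using assms Ck_on_coord_deriv[OF assms(1)] Ck_on_continuous unfolding smooth_real_on_iff_Ck[OF assms(1)]
  by blast+

lemma smooth_real_on_cong:
  assumes "openin (Euclidean_space n) W" "\<And>y. y \<in> W \<Longrightarrow> f y = g y" "smooth_real_on n W f"
  shows "smooth_real_on n W g"
  using assms(3) Ck_on_cong[of n W f g, OF assms(1,2)] unfolding smooth_real_on_iff_Ck[OF assms(1)] by blast

lemma smooth_real_on_subset:
  assumes "V \<subseteq> W" "W \<subseteq> topspace (Euclidean_space n)" "smooth_real_on n W f"
  shows "smooth_real_on n V f"
proof -
  have "V \<subseteq> topspace (Euclidean_space n)" using assms by blast
  then show ?thesis
    using assms continuous_on_subset[OF _ assms(1)]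
    unfolding smooth_real_on_def by (simp add: continuous_map_Euclidean_subspace_iff) blast
qed

text \<open>\<open>coord_deriv\<close> does not mention a domain, so the iterated partial
  derivatives on \<open>V\<close> and on \<open>W\<close> are the same functions, and only their
  continuity has to be localised.\<close>

lemma smooth_real_on_local:
  assumes "\<And>x. x \<in> W \<Longrightarrow> \<exists>V. openin (Euclidean_space n) V \<and> x \<in> V \<and> smooth_real_on n V f"
    and W: "openin (Euclidean_space n) W"
  shows "smooth_real_on n W f"
proof -
  have sub: "W \<subseteq> topspace (Euclidean_space n)" by (rule openin_subset[OF W])
  obtain V where V: "\<And>x. x \<in> W \<Longrightarrow> openin (Euclidean_space n) (V x)" "\<And>x. x \<in> W \<Longrightarrow> x \<in> V x"
    "\<And>x. x \<in> W \<Longrightarrow> smooth_real_on n (V x) f"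
    using assms(1) by metis
  show ?thesis
    unfolding smooth_real_on_def
  proof (intro allI impI conjI ballI)
    fix js assume js: "set js \<subseteq> {..<n}"
    have "continuous (at x within W) (foldr coord_deriv js f)" if x: "x \<in> W" for x
    proof -
      obtain T where T: "open T" "V x = topspace (Euclidean_space n) \<inter> T"
        using V(1)[OF x] by (metis Euclidean_space_top_of_set openin_open)
      have "continuous_on (V x) (foldr coord_deriv js f)"
        using V(3)[OF x] js openin_subset[OF V(1)[OF x]]
        by (simp add: smooth_real_on_def continuous_map_Euclidean_subspace_iff)
      moreover have "W \<inter> T \<subseteq> V x" using T(2) sub by auto
      moreover have "x \<in> W \<inter> T" using V(2)[OF x] x T(2) by auto
      ultimately have "continuous (at x within (W \<inter> T)) (foldr coord_deriv js f)"
        using continuous_on_subset continuous_on_eq_continuous_within by metis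
      moreover have "at x within (W \<inter> T) = at x within W"
        by (rule at_within_nhd[of _ T]) (use V(2)[OF x] T in auto)
      ultimately show ?thesis by simp
    qed
    then show "continuous_map (subtopology (Euclidean_space n) W) euclideanreal (foldr coord_deriv js f)"
      using sub by (simp add: continuous_map_Euclidean_subspace_iff continuous_on_eq_continuous_within)
    show "(\<lambda>t. foldr coord_deriv js f (x(i := t))) field_differentiable at (x i)"
      if "x \<in> W" "i < n" for x i
      using V(2,3) that js unfolding smooth_real_on_def by blast
  qed
qed

section \<open>Closure properties of the classes C^k\<close>

lemma Ck_on_const: "Ck_on k n W (\<lambda>x. c)"
proof (induction k arbitrary: c)
  case (Suc k)
  then show ?case by (auto intro!: exI[of _ "\<lambda>x. 0"] derivative_eq_intros)
qed simp

lemma continuous_on_coord: "continuous_on W (\<lambda>x. x (j :: nat) :: real)"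
  by (rule continuous_on_product_then_coordinatewise[OF continuous_on_id])

lemma Ck_on_coord: "Ck_on k n W (\<lambda>x. x j)"
proof (cases k)
  case (Suc l)
  have "\<exists>f'. (\<forall>x\<in>W. ((\<lambda>t. (x(i := t)) j) has_field_derivative f' x) (at (x i))) \<and> Ck_on l n W f'" for i
    by (rule exI[of _ "\<lambda>x. if i = j then 1 else 0"]) (auto simp: Ck_on_const intro!: derivative_eq_intros)
  then show ?thesis using Suc by (simp add: continuous_on_coord)
qed (simp add: continuous_on_coord)

lemma Ck_on_add: "Ck_on k n W f \<Longrightarrow> Ck_on k n W g \<Longrightarrow> Ck_on k n W (\<lambda>x. f x + g x)"
proof (induction k arbitrary: f g)
  case (Suc k)
  have "\<exists>h. (\<forall>x\<in>W. ((\<lambda>t. f (x(i := t)) + g (x(i := t))) has_field_derivative h x) (at (x i))) \<and> Ck_on k n W h"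
    if i: "i < n" for i
  proof -
    obtain f' where "\<forall>x\<in>W. ((\<lambda>t. f (x(i := t))) has_field_derivative f' x) (at (x i))" "Ck_on k n W f'"
      using Suc.prems(1) i unfolding Ck_on.simps by blast
    moreover obtain g' where "\<forall>x\<in>W. ((\<lambda>t. g (x(i := t))) has_field_derivative g' x) (at (x i))" "Ck_on k n W g'"
      using Suc.prems(2) i unfolding Ck_on.simps by blast
    ultimately show ?thesis
      by (intro exI[of _ "\<lambda>x. f' x + g' x"]) (simp add: Suc.IH DERIV_add)
  qed
  moreover have "continuous_on W (\<lambda>x. f x + g x)"
    using Suc.prems[THEN Ck_on_continuous] by (rule continuous_on_add)
  ultimately show ?case by simp
qed (auto intro: continuous_on_add)

lemma Ck_on_mult: "Ck_on k n W f \<Longrightarrow> Ck_on k n W g \<Longrightarrow> Ck_on k n W (\<lambda>x. f x * g x)"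
proof (induction k arbitrary: f g)
  case (Suc k)
  have "\<exists>h. (\<forall>x\<in>W. ((\<lambda>t. f (x(i := t)) * g (x(i := t))) has_field_derivative h x) (at (x i))) \<and> Ck_on k n W h"
    if i: "i < n" for i
  proof -
    obtain f' where 1: "\<forall>x\<in>W. ((\<lambda>t. f (x(i := t))) has_field_derivative f' x) (at (x i))" "Ck_on k n W f'"
      using Suc.prems(1) i unfolding Ck_on.simps by blast
    obtain g' where 2: "\<forall>x\<in>W. ((\<lambda>t. g (x(i := t))) has_field_derivative g' x) (at (x i))" "Ck_on k n W g'"
      using Suc.prems(2) i unfolding Ck_on.simps by blast
    have "((\<lambda>t. f (x(i := t)) * g (x(i := t))) has_field_derivative f' x * g x + g' x * f x) (at (x i))"
      if "x \<in> W" for x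
      using DERIV_mult[of "\<lambda>t. f (x(i := t))" "f' x" "x i" UNIV "\<lambda>t. g (x(i := t))" "g' x"] 1(1) 2(1) that
      by simp
    moreover have "Ck_on k n W (\<lambda>x. f' x * g x + g' x * f x)"
      using 1(2) 2(2) Suc.prems[THEN Ck_on_Suc] by (intro Ck_on_add Suc.IH)
    ultimately show ?thesis by (intro exI[of _ "\<lambda>x. f' x * g x + g' x * f x"]) simp
  qed
  moreover have "continuous_on W (\<lambda>x. f x * g x)"
    using Suc.prems[THEN Ck_on_continuous] by (rule continuous_on_mult)
  ultimately show ?case by simp
qed (auto intro: continuous_on_mult)

lemma Ck_on_sum: "(\<And>a. a \<in> A \<Longrightarrow> Ck_on k n W (f a)) \<Longrightarrow> Ck_on k n W (\<lambda>x. \<Sum>a\<in>A. f a x)"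
  by (induction A rule: infinite_finite_induct) (auto intro: Ck_on_const Ck_on_add)

text \<open>The outer function ranges over a family \<open>S\<close> that is closed under
  differentiation on \<open>U\<close>; the chain rule then reproduces the induction hypothesis for
  another member of \<open>S\<close>.\<close>

lemma Ck_on_compose_real:
  assumes fam: "\<And>h. h \<in> S \<Longrightarrow> \<exists>h'\<in>S. \<forall>x\<in>U. (h has_field_derivative h' x) (at (x::real))"
  shows "Ck_on k n W f \<Longrightarrow> (\<And>x. x \<in> W \<Longrightarrow> f x \<in> U) \<Longrightarrow> h \<in> S \<Longrightarrow> Ck_on k n W (\<lambda>x. h (f x))"
proof (induction k arbitrary: h)
  case 0
  have "continuous_on U h" using fam[OF 0(3)] by (meson DERIV_continuous_on has_field_derivative_at_within)
  then show ?case using continuous_on_compose2[of U h W f] 0(1,2) by (simp add: image_subset_iff)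
next
  case (Suc k)
  obtain h' where h': "h' \<in> S" "\<forall>x\<in>U. (h has_field_derivative h' x) (at x)" using fam[OF Suc.prems(3)] by blast
  have f: "Ck_on k n W f" using Suc.prems(1) by (rule Ck_on_Suc)
  have "\<exists>g. (\<forall>x\<in>W. ((\<lambda>t. h (f (x(i := t)))) has_field_derivative g x) (at (x i))) \<and> Ck_on k n W g"
    if i: "i < n" for i
  proof -
    obtain f' where 1: "\<forall>x\<in>W. ((\<lambda>t. f (x(i := t))) has_field_derivative f' x) (at (x i))" "Ck_on k n W f'"
      using Suc.prems(1) i unfolding Ck_on.simps by blast
    have "((\<lambda>t. h (f (x(i := t)))) has_field_derivative h' (f x) * f' x) (at (x i))" if "x \<in> W" for x
      using DERIV_chain2[of h "h' (f x)" "\<lambda>t. f (x(i := t))" "x i" "f' x" UNIV] 1(1) h'(2) Suc.prems(2) that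
      by simp
    moreover have "Ck_on k n W (\<lambda>x. h' (f x) * f' x)"
      using Suc.IH[OF f Suc.prems(2) h'(1)] 1(2) by (rule Ck_on_mult)
    ultimately show ?thesis by (intro exI[of _ "\<lambda>x. h' (f x) * f' x"]) simp
  qed
  moreover have "continuous_on W (\<lambda>x. h (f x))"
  proof (rule continuous_on_compose2[of U h])
    show "continuous_on U h" using h'(2) by (meson DERIV_continuous_on has_field_derivative_at_within)
    show "continuous_on W f" by (rule Ck_on_continuous[OF f])
  qed (use Suc.prems(2) in blast)
  ultimately show ?case by simp
qed

section \<open>Mean values and the chain rule\<close>

lemma mvt_between:
  fixes g g' :: "real \<Rightarrow> real"
  assumes "\<And>s. \<bar>s - a\<bar> \<le> \<bar>b - a\<bar> \<Longrightarrow> (g has_field_derivative g' s) (at s)"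
  shows "\<exists>\<xi>. \<bar>\<xi> - a\<bar> \<le> \<bar>b - a\<bar> \<and> g b - g a = (b - a) * g' \<xi>"
proof (cases a b rule: linorder_cases)
  case less
  then have "\<exists>\<xi>. a < \<xi> \<and> \<xi> < b \<and> g b - g a = (b - a) * g' \<xi>"
    by (intro MVT2) (use assms in auto)
  then obtain \<xi> where "a < \<xi>" "\<xi> < b" "g b - g a = (b - a) * g' \<xi>" by blast
  then show ?thesis by (intro exI[of _ \<xi>]) auto
next
  case greater
  then have "\<exists>\<xi>. b < \<xi> \<and> \<xi> < a \<and> g a - g b = (a - b) * g' \<xi>"
    by (intro MVT2) (use assms in auto)
  then obtain \<xi> where "b < \<xi>" "\<xi> < a" "g a - g b = (a - b) * g' \<xi>" by blast
  then show ?thesis by (intro exI[of _ \<xi>]) (auto simp: algebra_simps)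
qed auto

text \<open>Going from \<open>x\<close> to \<open>y\<close> one coordinate at a time, the mean value
  theorem applies on each segment. All points met lie in the box spanned by \<open>x\<close> and
  \<open>y\<close>, which \<open>box\<close> places inside \<open>V\<close>.\<close>

lemma coordinatewise_increment:
  assumes V: "openin (Euclidean_space m) V" and f: "Ck_on 1 m V f"
    and x: "x \<in> topspace (Euclidean_space m)" and y: "y \<in> topspace (Euclidean_space m)"
    and box: "\<And>u. u \<in> topspace (Euclidean_space m) \<Longrightarrow> (\<And>i. i < m \<Longrightarrow> \<bar>u i - x i\<bar> \<le> \<bar>y i - x i\<bar>) \<Longrightarrow> u \<in> V"
  shows "\<exists>\<eta>. (\<forall>k<m. \<eta> k \<in> topspace (Euclidean_space m) \<and> (\<forall>i<m. \<bar>\<eta> k i - x i\<bar> \<le> \<bar>y i - x i\<bar>)) \<and>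
             f y - f x = (\<Sum>k<m. (y k - x k) * coord_deriv k f (\<eta> k))"
proof -
  \<comment> \<open>\<open>w k\<close> is the corner at which the first \<open>k\<close> coordinates
    have already been moved.\<close>
  define w where "w k = (\<lambda>i. if i < k then y i else x i)" for k
  have wE: "w k \<in> topspace (Euclidean_space m)" for k
    using x y by (auto simp: w_def topspace_Euclidean_space)
  have w_upd: "w k = (w k)(k := x k)" "w (Suc k) = (w k)(k := y k)" for k
    by (auto simp: w_def fun_eq_iff less_Suc_eq)
  have "\<exists>\<xi>. \<bar>\<xi> - x k\<bar> \<le> \<bar>y k - x k\<bar> \<and>
      f (w (Suc k)) - f (w k) = (y k - x k) * coord_deriv k f ((w k)(k := \<xi>))" if k: "k < m" for k
  proof -
    have "((\<lambda>t. f ((w k)(k := t))) has_field_derivative coord_deriv k f ((w k)(k := s))) (at s)"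
      if s: "\<bar>s - x k\<bar> \<le> \<bar>y k - x k\<bar>" for s
    proof -
      have "(w k)(k := s) \<in> V"
        by (rule box[OF fun_upd_in_Euclidean_space[OF wE k]]) (use s in \<open>auto simp: w_def\<close>)
      from Ck_on_coord_deriv(2)[OF V f[unfolded One_nat_def] k this] show ?thesis by simp
    qed
    from mvt_between[of "x k" "y k", OF this] show ?thesis
      using w_upd[of k] by simp
  qed
  then obtain \<xi> where \<xi>: "\<And>k. k < m \<Longrightarrow> \<bar>\<xi> k - x k\<bar> \<le> \<bar>y k - x k\<bar>"
    "\<And>k. k < m \<Longrightarrow> f (w (Suc k)) - f (w k) = (y k - x k) * coord_deriv k f ((w k)(k := \<xi> k))"
    by metis
  have "w m = y" "w 0 = x" using x y by (auto simp: w_def fun_eq_iff topspace_Euclidean_space)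
  then have "f y - f x = (\<Sum>k<m. f (w (Suc k)) - f (w k))"
    using sum_lessThan_telescope[of "\<lambda>k. f (w k)" m] by simp
  also have "\<dots> = (\<Sum>k<m. (y k - x k) * coord_deriv k f ((w k)(k := \<xi> k)))"
    by (rule sum.cong) (use \<xi>(2) in auto)
  finally show ?thesis
    by (intro exI[of _ "\<lambda>k. (w k)(k := \<xi> k)"])
      (use \<xi>(1) wE in \<open>auto simp: fun_upd_in_Euclidean_space w_def\<close>)
qed

lemma continuous_on_Euclidean_box:
  assumes V: "openin (Euclidean_space m) V" and g: "continuous_on V g" and x: "x \<in> V" and "e > (0::real)"
  obtains d where "d > 0" "\<And>u. u \<in> topspace (Euclidean_space m) \<Longrightarrow> (\<And>i. i < m \<Longrightarrow> \<bar>u i - x i\<bar> < d)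
    \<Longrightarrow> u \<in> V \<and> \<bar>g u - g x\<bar> < e"
proof -
  have "openin (top_of_set V) (V \<inter> g -` ball (g x) e)"
    using g by (intro continuous_openin_preimage_gen) auto
  then have "openin (Euclidean_space m) (V \<inter> g -` ball (g x) e)"
    using V by (metis Euclidean_space_top_of_set openin_trans)
  moreover have "x \<in> V \<inter> g -` ball (g x) e" using x \<open>e > 0\<close> by auto
  ultimately obtain d where "d > 0" "\<And>u. u \<in> topspace (Euclidean_space m) \<Longrightarrow> (\<And>i. i < m \<Longrightarrow> \<bar>u i - x i\<bar> < d)
    \<Longrightarrow> u \<in> V \<inter> g -` ball (g x) e"
    using openin_Euclidean_space_box by metis
  then show thesis by (intro that[of d]) (auto simp: dist_real_def abs_minus_commute)
qed

text \<open>The increment along the curve is a sum over coordinates with partial derivatives at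
  intermediate points. These points are squeezed to \<open>z t0\<close>, so continuity of the
  partial derivatives lets the difference quotient converge term by term.\<close>

lemma has_field_derivative_along_curve:
  assumes V: "openin (Euclidean_space m) V" and f: "Ck_on 1 m V f"
    and z: "\<And>k. k < m \<Longrightarrow> ((\<lambda>t. z t k) has_field_derivative z' k) (at t0)"
    and zV: "\<forall>\<^sub>F t in nhds t0. z t \<in> V"
  shows "((\<lambda>t. f (z t)) has_field_derivative (\<Sum>k<m. coord_deriv k f (z t0) * z' k)) (at t0)"
proof -
  let ?E = "topspace (Euclidean_space m)"
  define x where "x = z t0"
  have xV: "x \<in> V" using eventually_nhds_x_imp_x[OF zV] by (simp add: x_def)
  then have xE: "x \<in> ?E" using openin_subset[OF V] by blast
  have near: "\<forall>\<^sub>F t in at t0. \<forall>k\<in>{..<m}. \<bar>z t k - x k\<bar> < d" if "d > 0" for d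
  proof (rule eventually_ball_finite)
    show "\<forall>k\<in>{..<m}. \<forall>\<^sub>F t in at t0. \<bar>z t k - x k\<bar> < d"
    proof
      fix k assume "k \<in> {..<m}"
      then have "((\<lambda>t. z t k) \<longlongrightarrow> x k) (at t0)"
        using z[of k] DERIV_isCont isCont_def unfolding x_def by blast
      from tendstoD[OF this \<open>d > 0\<close>] show "\<forall>\<^sub>F t in at t0. \<bar>z t k - x k\<bar> < d"
        by (simp add: dist_real_def)
    qed
  qed simp
  obtain e where e: "e > 0" "\<And>u. u \<in> ?E \<Longrightarrow> (\<And>i. i < m \<Longrightarrow> \<bar>u i - x i\<bar> < e) \<Longrightarrow> u \<in> V"
    using openin_Euclidean_space_box[OF V xV] by metis
  \<comment> \<open>\<open>P t\<close> guarantees that the whole box between \<open>x\<close> and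
    \<open>z t\<close> lies in \<open>V\<close>, as the increment formula requires.\<close>
  define P where "P t \<longleftrightarrow> z t \<in> V \<and> (\<forall>k\<in>{..<m}. \<bar>z t k - x k\<bar> < e)" for t
  have evP: "\<forall>\<^sub>F t in at t0. P t"
    unfolding P_def using near[OF e(1)] zV by (auto simp: eventually_at_filter elim: eventually_elim2)
  define Q where "Q t \<eta> \<longleftrightarrow> (\<forall>k<m. \<eta> k \<in> ?E \<and> (\<forall>i<m. \<bar>\<eta> k i - x i\<bar> \<le> \<bar>z t i - x i\<bar>)) \<and>
             f (z t) - f x = (\<Sum>k<m. (z t k - x k) * coord_deriv k f (\<eta> k))" for t \<eta>
  have "\<exists>\<eta>. Q t \<eta>" if "P t" for t
    unfolding Q_def
  proof (rule coordinatewise_increment[OF V f xE])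
    show "z t \<in> ?E" using that openin_subset[OF V] by (auto simp: P_def)
    show "u \<in> V" if "u \<in> ?E" "\<And>i. i < m \<Longrightarrow> \<bar>u i - x i\<bar> \<le> \<bar>z t i - x i\<bar>" for u
    proof (rule e(2)[OF that(1)])
      fix i assume i: "i < m"
      have "\<bar>z t i - x i\<bar> < e" using \<open>P t\<close> i by (auto simp: P_def)
      with that(2)[OF i] show "\<bar>u i - x i\<bar> < e" by linarith
    qed
  qed
  then obtain \<eta> where "\<And>t. P t \<Longrightarrow> Q t (\<eta> t)" by metis
  then have \<eta>: "\<And>t k. P t \<Longrightarrow> k < m \<Longrightarrow> \<eta> t k \<in> ?E"
    "\<And>t k i. P t \<Longrightarrow> k < m \<Longrightarrow> i < m \<Longrightarrow> \<bar>\<eta> t k i - x i\<bar> \<le> \<bar>z t i - x i\<bar>"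
    "\<And>t. P t \<Longrightarrow> f (z t) - f x = (\<Sum>k<m. (z t k - x k) * coord_deriv k f (\<eta> t k))"
    unfolding Q_def by blast+
  have lim: "((\<lambda>t. coord_deriv k f (\<eta> t k)) \<longlongrightarrow> coord_deriv k f x) (at t0)" if k: "k < m" for k
  proof (rule tendstoI)
    fix e' :: real assume "e' > 0"
    have "continuous_on V (coord_deriv k f)"
      using Ck_on_coord_deriv(1)[OF V f[unfolded One_nat_def] k] by simp
    then obtain d where d: "d > 0" "\<And>u. u \<in> ?E \<Longrightarrow> (\<And>i. i < m \<Longrightarrow> \<bar>u i - x i\<bar> < d)
        \<Longrightarrow> u \<in> V \<and> \<bar>coord_deriv k f u - coord_deriv k f x\<bar> < e'"
      using continuous_on_Euclidean_box[OF V _ xV \<open>e' > 0\<close>] by metis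
    from near[OF d(1)] evP show "\<forall>\<^sub>F t in at t0. dist (coord_deriv k f (\<eta> t k)) (coord_deriv k f x) < e'"
    proof eventually_elim
      case (elim t)
      have "\<bar>\<eta> t k i - x i\<bar> < d" if "i < m" for i
        using le_less_trans[OF \<eta>(2)[OF elim(2) k that]] elim(1) that by blast
      then show ?case using d(2)[OF \<eta>(1)[OF elim(2) k]] by (simp add: dist_real_def)
    qed
  qed
  have "((\<lambda>t. \<Sum>k<m. coord_deriv k f (\<eta> t k) * ((z t k - x k) / (t - t0))) \<longlongrightarrow>
      (\<Sum>k<m. coord_deriv k f x * z' k)) (at t0)"
    using z by (intro tendsto_sum tendsto_mult lim) (auto simp: has_field_derivative_iff x_def)
  moreover have "\<forall>\<^sub>F t in at t0. (\<Sum>k<m. coord_deriv k f (\<eta> t k) * ((z t k - x k) / (t - t0)))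
      = (f (z t) - f (z t0)) / (t - t0)"
    using evP
  proof eventually_elim
    case (elim t)
    show ?case unfolding x_def[symmetric] \<eta>(3)[OF elim] by (simp add: sum_divide_distrib mult.commute)
  qed
  ultimately show ?thesis
    unfolding has_field_derivative_iff x_def by (rule Lim_transform_eventually)
qed

text \<open>Induction on \<open>k\<close>: by the chain rule a partial derivative of the composite
  is a sum of products, in each of which the outer derivative is again a composite, one level
  lower.\<close>

lemma Ck_on_compose:
  assumes W: "openin (Euclidean_space n) W" and V: "openin (Euclidean_space m) V"
    and ZV: "\<And>x. x \<in> W \<Longrightarrow> Z x \<in> V"
  shows "Ck_on k m V f \<Longrightarrow> (\<And>j. j < m \<Longrightarrow> Ck_on k n W (\<lambda>x. Z x j)) \<Longrightarrow> Ck_on k n W (\<lambda>x. f (Z x))"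
proof (induction k arbitrary: f)
  case 0
  have "continuous_on W Z"
  proof (rule continuous_on_coordinatewise_then_product)
    show "continuous_on W (\<lambda>x. Z x j)" for j
    proof (cases "j < m")
      \<comment> \<open>Coordinates from \<open>m\<close> on vanish, because \<open>Z x\<close> lies
        in the coordinate space of dimension \<open>m\<close>.\<close>
      case False
      then have "Z x j = 0" if "x \<in> W" for x
        using ZV[OF that] openin_subset[OF V] by (auto simp: topspace_Euclidean_space)
      then have "continuous_on W (\<lambda>x. Z x j) = continuous_on W (\<lambda>x. 0 :: real)"
        by (intro continuous_on_cong) auto
      then show ?thesis by simp
    qed (use 0 in simp)
  qed
  then show ?case using continuous_on_compose2[of V f W Z] 0(1) ZV by (simp add: image_subset_iff)
next
  case (Suc k)
  have Z: "Ck_on k n W (\<lambda>x. Z x j)" if "j < m" for j using Suc.prems(2)[OF that] by (rule Ck_on_Suc)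
  have f: "Ck_on k m V f" using Suc.prems(1) by (rule Ck_on_Suc)
  have f1: "Ck_on 1 m V f" using Suc.prems(1)
    by (rule Ck_on_mono) simp
  have "\<exists>g. (\<forall>x\<in>W. ((\<lambda>t. f (Z (x(i := t)))) has_field_derivative g x) (at (x i))) \<and> Ck_on k n W g"
    if i: "i < n" for i
  proof (intro exI conjI ballI)
    show "Ck_on k n W (\<lambda>x. \<Sum>j<m. coord_deriv j f (Z x) * coord_deriv i (\<lambda>x. Z x j) x)"
    proof (rule Ck_on_sum)
      fix j assume "j \<in> {..<m}"
      then have j: "j < m" by simp
      have "Ck_on k n W (\<lambda>x. coord_deriv j f (Z x))"
        by (rule Suc.IH[OF Ck_on_coord_deriv(1)[OF V Suc.prems(1) j] Z])
      moreover have "Ck_on k n W (coord_deriv i (\<lambda>x. Z x j))"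
        by (rule Ck_on_coord_deriv(1)[OF W Suc.prems(2)[OF j] i])
      ultimately show "Ck_on k n W (\<lambda>x. coord_deriv j f (Z x) * coord_deriv i (\<lambda>x. Z x j) x)"
        by (rule Ck_on_mult)
    qed
    fix x assume x: "x \<in> W"
    have "((\<lambda>t. f (Z (x(i := t)))) has_field_derivative
      (\<Sum>j<m. coord_deriv j f (Z (x(i := x i))) * coord_deriv i (\<lambda>x. Z x j) x)) (at (x i))"
    proof (rule has_field_derivative_along_curve[OF V f1])
      show "((\<lambda>t. Z (x(i := t)) j) has_field_derivative coord_deriv i (\<lambda>x. Z x j) x) (at (x i))"
        if "j < m" for j
        by (rule Ck_on_coord_deriv(2)[OF W Suc.prems(2)[OF that] i x])
      show "\<forall>\<^sub>F t in nhds (x i). Z (x(i := t)) \<in> V"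
        using eventually_fun_upd_in[OF W x i] ZV by (rule eventually_mono)
    qed
    then show "((\<lambda>t. f (Z (x(i := t)))) has_field_derivative
      (\<Sum>j<m. coord_deriv j f (Z x) * coord_deriv i (\<lambda>x. Z x j) x)) (at (x i))" by simp
  qed
  moreover have "continuous_on W (\<lambda>x. f (Z x))"
    using Ck_on_continuous[OF Suc.IH[OF f Z]] .
  ultimately show ?case by simp
qed

section \<open>Closure properties of smooth functions\<close>

lemma smooth_const: "openin (Euclidean_space n) W \<Longrightarrow> smooth_real_on n W (\<lambda>x. c)"
  by (simp add: smooth_real_on_iff_Ck Ck_on_const)

lemma smooth_coord: "openin (Euclidean_space n) W \<Longrightarrow> smooth_real_on n W (\<lambda>x. x j)"
  by (simp add: smooth_real_on_iff_Ck Ck_on_coord)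

lemma smooth_add:
  "openin (Euclidean_space n) W \<Longrightarrow> smooth_real_on n W f \<Longrightarrow> smooth_real_on n W g
   \<Longrightarrow> smooth_real_on n W (\<lambda>x. f x + g x)"
  by (simp add: smooth_real_on_iff_Ck Ck_on_add)

lemma smooth_mult:
  "openin (Euclidean_space n) W \<Longrightarrow> smooth_real_on n W f \<Longrightarrow> smooth_real_on n W g
   \<Longrightarrow> smooth_real_on n W (\<lambda>x. f x * g x)"
  by (simp add: smooth_real_on_iff_Ck Ck_on_mult)

lemma smooth_minus:
  "openin (Euclidean_space n) W \<Longrightarrow> smooth_real_on n W f \<Longrightarrow> smooth_real_on n W (\<lambda>x. - f x)"
  using smooth_mult[OF _ smooth_const[of n W "-1"], of f] by simp

lemma smooth_diff:
  "openin (Euclidean_space n) W \<Longrightarrow> smooth_real_on n W f \<Longrightarrow> smooth_real_on n W g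
   \<Longrightarrow> smooth_real_on n W (\<lambda>x. f x - g x)"
  using smooth_add[OF _ _ smooth_minus, of n W f g] by simp

lemma smooth_sum:
  "openin (Euclidean_space n) W \<Longrightarrow> (\<And>a. a \<in> A \<Longrightarrow> smooth_real_on n W (f a))
   \<Longrightarrow> smooth_real_on n W (\<lambda>x. \<Sum>a\<in>A. f a x)"
  by (simp add: smooth_real_on_iff_Ck Ck_on_sum)

lemma smooth_prod:
  "openin (Euclidean_space n) W \<Longrightarrow> (\<And>a. a \<in> A \<Longrightarrow> smooth_real_on n W (f a))
   \<Longrightarrow> smooth_real_on n W (\<lambda>x. \<Prod>a\<in>A. f a x)"
  by (induction A rule: infinite_finite_induct) (auto intro: smooth_const smooth_mult)

lemma smooth_compose_real:
  assumes W: "openin (Euclidean_space n) W"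
    and fam: "\<And>h. h \<in> S \<Longrightarrow> \<exists>h'\<in>S. \<forall>x\<in>U. (h has_field_derivative h' x) (at (x::real))"
    and "smooth_real_on n W f" "\<And>x. x \<in> W \<Longrightarrow> f x \<in> U" "h \<in> S"
  shows "smooth_real_on n W (\<lambda>x. h (f x))"
  using assms(3) Ck_on_compose_real[of S U _ n W f h, OF fam _ assms(4,5)]
  by (simp add: smooth_real_on_iff_Ck[OF W])

lemma smooth_compose:
  assumes W: "openin (Euclidean_space n) W" and V: "openin (Euclidean_space m) V"
    and "\<And>x. x \<in> W \<Longrightarrow> Z x \<in> V" "smooth_real_on m V f" "\<And>j. j < m \<Longrightarrow> smooth_real_on n W (\<lambda>x. Z x j)"
  shows "smooth_real_on n W (\<lambda>x. f (Z x))"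
  using assms(4,5) Ck_on_compose[of n W m V Z _ f, OF W V assms(3)]
  unfolding smooth_real_on_iff_Ck[OF W] smooth_real_on_iff_Ck[OF V] by blast

text \<open>Multiples of real powers form a family closed under differentiation on the positive half
  line. The exponent -1/2 later normalises quaternions, the exponent -1 gives quotients.\<close>

lemma smooth_powr:
  assumes W: "openin (Euclidean_space n) W" and f: "smooth_real_on n W f" "\<And>x. x \<in> W \<Longrightarrow> f x > 0"
  shows "smooth_real_on n W (\<lambda>x. f x powr a)"
proof -
  let ?S = "{\<lambda>x::real. c * x powr a |c a. True}"
  have fam: "\<exists>h'\<in>?S. \<forall>x\<in>{0<..}. (h has_field_derivative h' x) (at x)" if hS: "h \<in> ?S" for h
  proof -
    obtain c a where h: "h = (\<lambda>x. c * x powr a)" using hS by blast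
    have "((\<lambda>x. c * x powr a) has_field_derivative (c * a) * x powr (a - 1)) (at x)" if "x > 0" for x
      using that by (auto intro!: derivative_eq_intros)
    moreover have "(\<lambda>x. (c * a) * x powr (a - 1)) \<in> ?S" by blast
    ultimately show ?thesis unfolding h by (intro bexI[of _ "\<lambda>x. (c * a) * x powr (a - 1)"]) auto
  qed
  have "(\<lambda>x. 1 * x powr a) \<in> ?S" by blast
  from smooth_compose_real[OF W fam f(1) _ this]
  have "smooth_real_on n W (\<lambda>x. 1 * f x powr a)"
    using f(2) by (simp only: greaterThan_iff)
  then show ?thesis by simp
qed

text \<open>\<open>1 / f\<close> is written as \<open>f * (f * f) powr (-1)\<close>, so that the
  base is positive whatever the sign of \<open>f\<close>.\<close>

lemma smooth_inverse:
  assumes W: "openin (Euclidean_space n) W" and f: "smooth_real_on n W f" "\<And>x. x \<in> W \<Longrightarrow> f x \<noteq> 0"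
  shows "smooth_real_on n W (\<lambda>x. inverse (f x))"
proof -
  have "smooth_real_on n W (\<lambda>x. (f x * f x) powr (-1))"
    by (rule smooth_powr[OF W smooth_mult[OF W f(1) f(1)]]) (use f(2) not_real_square_gt_zero in blast)
  then have "smooth_real_on n W (\<lambda>x. f x * (f x * f x) powr (-1))"
    by (rule smooth_mult[OF W f(1)])
  then show ?thesis
    by (rule smooth_real_on_cong[OF W, rotated])
      (use f(2) in \<open>auto simp: powr_minus powr_one' field_simps\<close>)
qed

lemma smooth_divide:
  assumes W: "openin (Euclidean_space n) W" and "smooth_real_on n W f" "smooth_real_on n W g"
    "\<And>x. x \<in> W \<Longrightarrow> g x \<noteq> 0"
  shows "smooth_real_on n W (\<lambda>x. f x / g x)"
  using smooth_mult[OF W assms(2) smooth_inverse[OF W assms(3,4)]] by (simp add: divide_inverse)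

section \<open>Flat functions and cutoffs\<close>

text \<open>A flat function: all derivatives of \<open>exp (- 1 / s)\<close> are polynomials in \<open>1 / s\<close> times itself.\<close>

definition flat_exp :: "real poly \<Rightarrow> real \<Rightarrow> real" where
  "flat_exp P s = (if s > 0 then poly P (1 / s) * exp (- (1 / s)) else 0)"

lemma poly_times_exp_tendsto_0: "((\<lambda>u. poly P u * exp (- u)) \<longlongrightarrow> (0::real)) at_top"
proof -
  have "((\<lambda>u. \<Sum>i\<le>Polynomial.degree P. Polynomial.coeff P i * (u ^ i / exp u)) \<longlongrightarrow> (\<Sum>i\<le>Polynomial.degree P. Polynomial.coeff P i * 0)) at_top"
    by (intro tendsto_sum tendsto_mult tendsto_const tendsto_power_div_exp_0)
  moreover have "(\<Sum>i\<le>Polynomial.degree P. Polynomial.coeff P i * (u ^ i / exp u)) = poly P u * exp (- u)" for u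
    by (simp add: poly_altdef sum_distrib_right exp_minus divide_inverse mult.assoc)
  ultimately show ?thesis by simp
qed

text \<open>For positive \<open>s\<close>, differentiating P(1/s) exp(-1/s) gives (P - P')(1/s)
  exp(-1/s) / s^2; the last factor is the polynomial \<open>[:0, 0, 1:]\<close> in 1/s.\<close>

lemma flat_exp_has_derivative:
  "(flat_exp P has_field_derivative flat_exp ([:0, 0, 1:] * (P - pderiv P)) s) (at s)"
proof (cases s "0 :: real" rule: linorder_cases)
  case less
  have "((\<lambda>s. 0) has_field_derivative 0) (at s)" by simp
  moreover have "\<forall>\<^sub>F t in nhds s. 0 = flat_exp P t"
    using eventually_nhds_in_open[of "{..<0}" s] less by (auto elim!: eventually_mono simp: flat_exp_def)
  ultimately show ?thesis
    using less DERIV_cong_ev[of s s "\<lambda>s. 0" "flat_exp P" 0 0] by (simp add: flat_exp_def)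
next
  case greater
  have "((\<lambda>s. poly P (1 / s) * exp (- (1 / s))) has_field_derivative
      poly (pderiv P) (1 / s) * (- 1 / s\<^sup>2) * exp (- (1 / s)) + (exp (- (1 / s)) * (1 / s\<^sup>2)) * poly P (1 / s)) (at s)"
  proof (rule DERIV_mult)
    have 1: "((\<lambda>s. 1 / s) has_field_derivative - 1 / s\<^sup>2) (at s)"
      using greater by (auto intro!: derivative_eq_intros simp: power2_eq_square)
    show "((\<lambda>s. poly P (1 / s)) has_field_derivative poly (pderiv P) (1 / s) * (- 1 / s\<^sup>2)) (at s)"
      by (rule DERIV_chain2[OF poly_DERIV 1])
    show "((\<lambda>s. exp (- (1 / s))) has_field_derivative exp (- (1 / s)) * (1 / s\<^sup>2)) (at s)"
      using DERIV_chain2[OF DERIV_exp DERIV_minus[OF 1]] by simp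
  qed
  moreover have "poly (pderiv P) (1 / s) * (- 1 / s\<^sup>2) * exp (- (1 / s)) + (exp (- (1 / s)) * (1 / s\<^sup>2)) * poly P (1 / s)
      = flat_exp ([:0, 0, 1:] * (P - pderiv P)) s"
    using greater by (simp add: flat_exp_def power2_eq_square algebra_simps)
  moreover have "\<forall>\<^sub>F t in nhds s. poly P (1 / t) * exp (- (1 / t)) = flat_exp P t"
    using eventually_nhds_in_open[of "{0<..}" s] greater by (auto elim!: eventually_mono simp: flat_exp_def)
  ultimately show ?thesis
    using DERIV_cong_ev[of s s _ "flat_exp P"] by metis
next
  case equal
  have "((\<lambda>t. flat_exp P t / t) \<longlongrightarrow> 0) (at_right 0)"
  proof -
    \<comment> \<open>The right difference quotient at 0 is u P(u) exp(-u) with u = 1/t, which tends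
      to 0 as u grows.\<close>
    have "((\<lambda>t. poly ([:0, 1:] * P) (inverse t) * exp (- inverse t)) \<longlongrightarrow> 0) (at_right (0::real))"
      by (rule filterlim_compose[OF poly_times_exp_tendsto_0 filterlim_inverse_at_top_right])
    moreover have "\<forall>\<^sub>F t in at_right (0::real). poly ([:0, 1:] * P) (inverse t) * exp (- inverse t) = flat_exp P t / t"
      by (auto simp: eventually_at_filter flat_exp_def field_simps)
    ultimately show ?thesis by (rule Lim_transform_eventually)
  qed
  moreover have "((\<lambda>t. flat_exp P t / t) \<longlongrightarrow> 0) (at_left 0)"
    by (rule tendsto_eventually) (auto simp: eventually_at_filter flat_exp_def)
  ultimately have "((\<lambda>t. flat_exp P t / t) \<longlongrightarrow> 0) (at 0)"
    by (simp add: filterlim_split_at)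
  then show ?thesis using equal by (simp add: has_field_derivative_iff flat_exp_def)
qed

definition cutoff :: "real \<Rightarrow> real" where
  "cutoff = flat_exp 1"

lemma cutoff_eq_0: "s \<le> 0 \<Longrightarrow> cutoff s = 0" and cutoff_pos: "s > 0 \<Longrightarrow> cutoff s > 0"
  by (auto simp: cutoff_def flat_exp_def)

lemma smooth_cutoff:
  assumes "openin (Euclidean_space n) W" "smooth_real_on n W f"
  shows "smooth_real_on n W (\<lambda>x. cutoff (f x))"
  by (rule smooth_compose_real[of n W "range flat_exp" UNIV])
    (use assms flat_exp_has_derivative in \<open>auto simp: cutoff_def\<close>)

section \<open>Radial integrals and Hadamard's lemma\<close>

definition radial_integral :: "nat \<Rightarrow> ((nat \<Rightarrow> real) \<Rightarrow> real) \<Rightarrow> (nat \<Rightarrow> real) \<Rightarrow> real" where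
  "radial_integral k F x = integral {0..1} (\<lambda>t. t ^ k * F (\<lambda>i. t * x i))"

lemma continuous_on_radial:
  assumes F: "continuous_on (topspace (Euclidean_space n)) F"
    and c: "continuous_on T (\<lambda>p. c p :: nat \<Rightarrow> real)" "c ` T \<subseteq> topspace (Euclidean_space n)"
    and h: "continuous_on T h"
  shows "continuous_on T (\<lambda>p. h p ^ k * F (\<lambda>i. h p * c p i))"
proof (intro continuous_on_mult continuous_on_power h)
  have "continuous_on T (\<lambda>p i. h p * c p i)"
    by (intro continuous_on_coordinatewise_then_product continuous_on_mult h
        continuous_on_product_then_coordinatewise[OF c(1)])
  then show "continuous_on T (\<lambda>p. F (\<lambda>i. h p * c p i))"
    by (rule continuous_on_compose2[OF F]) (use c(2) in \<open>auto simp: topspace_Euclidean_space image_subset_iff\<close>)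
qed

text \<open>Differentiating under the integral sign in direction \<open>i\<close> brings out one
  factor \<open>t\<close>. The weight \<open>t ^ k\<close> exists for this reason: it makes the
  family of radial integrals closed under partial derivatives.\<close>

lemma Ck_on_radial_integral:
  "Ck_on p n (topspace (Euclidean_space n)) F \<Longrightarrow> Ck_on p n (topspace (Euclidean_space n)) (radial_integral k F)"
proof (induction p arbitrary: k F)
  let ?E = "topspace (Euclidean_space n)"
  have cont: "continuous_on ?E (radial_integral k F)" if F: "continuous_on ?E F" for k F
  proof -
    have "continuous_on (?E \<times> cbox 0 1) (\<lambda>p. snd p ^ k * F (\<lambda>i. snd p * fst p i))"
      by (rule continuous_on_radial[OF F]) (auto intro: continuous_intros)
    then have "continuous_on ?E (\<lambda>x. integral (cbox 0 1) (\<lambda>t. t ^ k * F (\<lambda>i. t * x i)))"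
      by (intro integral_continuous_on_param) (simp add: case_prod_unfold)
    then show ?thesis by (simp add: radial_integral_def[abs_def])
  qed
  {
    case 0
    then show ?case using cont by simp
  next
    case (Suc p)
    have EO: "openin (Euclidean_space n) ?E" by simp
    have F: "continuous_on ?E F" using Suc.prems by (rule Ck_on_continuous)
    have "((\<lambda>s. radial_integral k F (x(i := s))) has_field_derivative
          radial_integral (Suc k) (coord_deriv i F) x) (at (x i))" if i: "i < n" and x: "x \<in> ?E" for i x
    proof -
      have F': "continuous_on ?E (coord_deriv i F)"
        using Ck_on_coord_deriv(1)[OF EO Suc.prems i] by (rule Ck_on_continuous)
      have upd: "x(i := s) \<in> ?E" for s using fun_upd_in_Euclidean_space[OF x i] .
      have tE: "(\<lambda>j. t * y j) \<in> ?E" if "y \<in> ?E" for t y using that by (auto simp: topspace_Euclidean_space)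
      have upd_eq: "(\<lambda>j. t * (x(i := s)) j) = (\<lambda>j. t * x j)(i := t * s)" for t s by auto
      have "((\<lambda>s. integral (cbox 0 1) (\<lambda>t. t ^ k * F (\<lambda>j. t * (x(i := s)) j))) has_field_derivative
          integral (cbox 0 1) (\<lambda>t. t ^ Suc k * coord_deriv i F (\<lambda>j. t * (x(i := x i)) j))) (at (x i) within UNIV)"
      proof (rule leibniz_rule_field_derivative)
        fix s t :: real
        let ?y = "(\<lambda>j. t * x j)(i := t * s)"
        have "?y \<in> ?E" using tE[OF x] fun_upd_in_Euclidean_space i by blast
        from Ck_on_coord_deriv(2)[OF EO Suc.prems i this]
        have D: "((\<lambda>u. F ((\<lambda>j. t * x j)(i := u))) has_field_derivative coord_deriv i F ?y) (at (t * s))"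
          by (simp only: fun_upd_upd fun_upd_same)
        have "((\<lambda>s. F ((\<lambda>j. t * x j)(i := t * s))) has_field_derivative coord_deriv i F ?y * t) (at s)"
          by (rule DERIV_chain2[where f="\<lambda>u. F ((\<lambda>j. t * x j)(i := u))" and g="\<lambda>s. t * s", OF D])
            (auto intro!: derivative_eq_intros)
        then have "((\<lambda>s. t ^ k * F ((\<lambda>j. t * x j)(i := t * s))) has_field_derivative t ^ k * (coord_deriv i F ?y * t)) (at s)"
          by (rule DERIV_cmult)
        then show "((\<lambda>s. t ^ k * F (\<lambda>j. t * (x(i := s)) j)) has_field_derivative
            t ^ Suc k * coord_deriv i F (\<lambda>j. t * (x(i := s)) j)) (at s within UNIV)"
          unfolding upd_eq by (simp add: mult_ac)
      next
        fix s :: real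
        have "continuous_on (cbox 0 1) (\<lambda>t. t ^ k * F (\<lambda>j. t * (x(i := s)) j))"
          by (rule continuous_on_radial[OF F, where c="\<lambda>_. x(i := s)" and h="\<lambda>t. t"]) (use upd in auto)
        then show "(\<lambda>t. t ^ k * F (\<lambda>j. t * (x(i := s)) j)) integrable_on cbox 0 1"
          by (rule integrable_continuous)
      next
        have "continuous_on (UNIV \<times> cbox 0 1)
            (\<lambda>p. snd p ^ Suc k * coord_deriv i F (\<lambda>j. snd p * (x(i := fst p)) j))"
        proof (rule continuous_on_radial[OF F', where c="\<lambda>p. x(i := fst p)"])
          show "continuous_on (UNIV \<times> cbox 0 (1::real)) (\<lambda>p. x(i := fst p))"
          proof (rule continuous_on_coordinatewise_then_product)
            show "continuous_on (UNIV \<times> cbox 0 (1::real)) (\<lambda>p. (x(i := fst p)) j)" for j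
              by (cases "j = i") (auto intro: continuous_on_fst continuous_on_id)
          qed
        qed (use upd in \<open>auto intro: continuous_intros\<close>)
        then show "continuous_on (UNIV \<times> cbox 0 1) (\<lambda>(s, t). t ^ Suc k * coord_deriv i F (\<lambda>j. t * (x(i := s)) j))"
          by (simp add: case_prod_unfold)
      qed auto
      then show ?thesis by (simp add: radial_integral_def[abs_def])
    qed
    moreover have "Ck_on p n ?E (radial_integral (Suc k) (coord_deriv i F))" if "i < n" for i
      by (rule Suc.IH[OF Ck_on_coord_deriv(1)[OF EO Suc.prems that]])
    ultimately show ?case using cont[OF F] by auto
  }
qed

lemma smooth_radial_integral:
  "smooth_real_on n (topspace (Euclidean_space n)) F
   \<Longrightarrow> smooth_real_on n (topspace (Euclidean_space n)) (radial_integral k F)"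
  by (simp add: smooth_real_on_iff_Ck Ck_on_radial_integral)

text \<open>The fundamental theorem of calculus on the segment from the origin to \<open>x\<close>;
  by the chain rule the integrand is linear in the entries of \<open>x\<close>, which leave the
  integral.\<close>

lemma hadamard_expansion:
  assumes F: "smooth_real_on n (topspace (Euclidean_space n)) F" and x: "x \<in> topspace (Euclidean_space n)"
  shows "F x = F (\<lambda>_. 0) + (\<Sum>i<n. x i * radial_integral 0 (coord_deriv i F) x)"
proof -
  let ?E = "topspace (Euclidean_space n)"
  have EO: "openin (Euclidean_space n) ?E" by simp
  have tE: "(\<lambda>j. t * x j) \<in> ?E" for t using x by (auto simp: topspace_Euclidean_space)
  have F1: "Ck_on 1 n ?E F" using F smooth_real_on_iff_Ck[OF EO] by blast
  have "((\<lambda>t. F (\<lambda>j. t * x j)) has_field_derivative (\<Sum>k<n. coord_deriv k F (\<lambda>j. t * x j) * x k)) (at t)" for t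
    by (rule has_field_derivative_along_curve[OF EO F1, where z="\<lambda>t j. t * x j"])
      (use tE in \<open>auto intro!: derivative_eq_intros\<close>)
  then have "((\<lambda>t. \<Sum>k<n. coord_deriv k F (\<lambda>j. t * x j) * x k) has_integral
      F (\<lambda>j. 1 * x j) - F (\<lambda>j. 0 * x j)) {0..1}"
    by (intro fundamental_theorem_of_calculus)
      (auto simp: has_real_derivative_iff_has_vector_derivative[symmetric] intro: has_field_derivative_at_within)
  then have "F x - F (\<lambda>_. 0) = integral {0..1} (\<lambda>t. \<Sum>k<n. coord_deriv k F (\<lambda>j. t * x j) * x k)"
    by (simp add: integral_unique)
  also have "\<dots> = (\<Sum>k<n. integral {0..1} (\<lambda>t. coord_deriv k F (\<lambda>j. t * x j) * x k))"
  proof (rule integral_sum)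
    fix k assume "k \<in> {..<n}"
    then have "continuous_on ?E (coord_deriv k F)" using smooth_real_onD[OF EO smooth_real_onD(3)[OF EO F]] by auto
    from continuous_on_radial[OF this, where h="\<lambda>t. t" and c="\<lambda>_. x" and k=0 and T="{0..1}"]
    have "continuous_on {0..1} (\<lambda>t. coord_deriv k F (\<lambda>j. t * x j))" using x by (simp add: image_subset_iff)
    then show "(\<lambda>t. coord_deriv k F (\<lambda>j. t * x j) * x k) integrable_on {0..1}"
      by (intro integrable_continuous_real continuous_intros)
  qed simp
  also have "\<dots> = (\<Sum>i<n. x i * radial_integral 0 (coord_deriv i F) x)"
    by (simp add: radial_integral_def mult.commute)
  finally show ?thesis by simp
qed

lemma radial_integral_0: "radial_integral 0 F (\<lambda>_. 0) = F (\<lambda>_. 0)"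
  by (simp add: radial_integral_def)

section \<open>Vector fields on manifolds\<close>

locale smooth_manifold =
  fixes M :: "'a smooth_mfd"
  assumes mfd: "is_smooth_mfd M"
begin

lemma chart_image_open: "(U, \<phi>) \<in> matlas M \<Longrightarrow> openin (Euclidean_space (mdim M)) (\<phi> ` U)"
  using mfd unfolding is_smooth_mfd_def by blast

lemma chart_domain_subset: "(U, \<phi>) \<in> matlas M \<Longrightarrow> U \<subseteq> mpoints M"
  using mfd unfolding is_smooth_mfd_def by fastforce

lemma smooth_funsI:
  "(\<And>U \<phi>. (U, \<phi>) \<in> matlas M \<Longrightarrow> smooth_real_on (mdim M) (\<phi> ` U) (\<lambda>x. f (inv_into U \<phi> x)))
   \<Longrightarrow> f \<in> smooth_funs M"
  unfolding smooth_funs_def by blast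

lemma smooth_funsD:
  "f \<in> smooth_funs M \<Longrightarrow> (U, \<phi>) \<in> matlas M
   \<Longrightarrow> smooth_real_on (mdim M) (\<phi> ` U) (\<lambda>x. f (inv_into U \<phi> x))"
  unfolding smooth_funs_def by blast

lemma smooth_funs_const: "(\<lambda>_. a) \<in> smooth_funs M"
  by (rule smooth_funsI, rule smooth_const[OF chart_image_open])

lemma smooth_funs_add:
  assumes "f \<in> smooth_funs M" "h \<in> smooth_funs M"
  shows "(\<lambda>p. f p + h p) \<in> smooth_funs M"
proof (rule smooth_funsI)
  fix U \<phi> assume U: "(U, \<phi>) \<in> matlas M"
  show "smooth_real_on (mdim M) (\<phi> ` U) (\<lambda>x. f (inv_into U \<phi> x) + h (inv_into U \<phi> x))"
    by (rule smooth_add[OF chart_image_open[OF U] smooth_funsD[OF assms(1) U] smooth_funsD[OF assms(2) U]])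
qed

lemma smooth_funs_mult:
  assumes "f \<in> smooth_funs M" "h \<in> smooth_funs M"
  shows "(\<lambda>p. f p * h p) \<in> smooth_funs M"
proof (rule smooth_funsI)
  fix U \<phi> assume U: "(U, \<phi>) \<in> matlas M"
  show "smooth_real_on (mdim M) (\<phi> ` U) (\<lambda>x. f (inv_into U \<phi> x) * h (inv_into U \<phi> x))"
    by (rule smooth_mult[OF chart_image_open[OF U] smooth_funsD[OF assms(1) U] smooth_funsD[OF assms(2) U]])
qed

lemma smooth_funs_diff:
  assumes "f \<in> smooth_funs M" "h \<in> smooth_funs M"
  shows "(\<lambda>p. f p - h p) \<in> smooth_funs M"
proof (rule smooth_funsI)
  fix U \<phi> assume U: "(U, \<phi>) \<in> matlas M"
  show "smooth_real_on (mdim M) (\<phi> ` U) (\<lambda>x. f (inv_into U \<phi> x) - h (inv_into U \<phi> x))"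
    by (rule smooth_diff[OF chart_image_open[OF U] smooth_funsD[OF assms(1) U] smooth_funsD[OF assms(2) U]])
qed

lemma smooth_funs_sum:
  "(\<And>i. i \<in> A \<Longrightarrow> f i \<in> smooth_funs M) \<Longrightarrow> (\<lambda>p. \<Sum>i\<in>A. f i p) \<in> smooth_funs M"
proof (induction A rule: infinite_finite_induct)
  case (insert a A)
  then show ?case using smooth_funs_add[of "f a" "\<lambda>p. \<Sum>i\<in>A. f i p"] by simp
qed (simp_all add: smooth_funs_const)

lemma smooth_funs_cong:
  assumes "f \<in> smooth_funs M" "\<And>p. p \<in> mpoints M \<Longrightarrow> f p = h p"
  shows "h \<in> smooth_funs M"
proof (rule smooth_funsI)
  fix U \<phi> assume U: "(U, \<phi>) \<in> matlas M"
  have "f (inv_into U \<phi> x) = h (inv_into U \<phi> x)" if "x \<in> \<phi> ` U" for x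
    using assms(2) chart_domain_subset[OF U] inv_into_into[OF that] by (simp add: subset_iff)
  from smooth_real_on_cong[OF chart_image_open[OF U] this smooth_funsD[OF assms(1) U]]
  show "smooth_real_on (mdim M) (\<phi> ` U) (\<lambda>x. h (inv_into U \<phi> x))" .
qed

lemma tspace_nonsmooth: "v \<in> tspace M p \<Longrightarrow> f \<notin> smooth_funs M \<Longrightarrow> v f = 0"
  by (simp add: tspace_def)

lemma tspace_lin:
  assumes "v \<in> tspace M p" "f \<in> smooth_funs M" "h \<in> smooth_funs M"
  shows "v (\<lambda>x. a * f x + b * h x) = a * v f + b * v h"
proof -
  have "\<forall>f\<in>smooth_funs M. \<forall>h\<in>smooth_funs M. \<forall>a b. v (\<lambda>x. a * f x + b * h x) = a * v f + b * v h"
    using assms(1) unfolding tspace_def by blast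
  from this[rule_format, OF assms(2,3)] show ?thesis .
qed

lemma tspace_mult:
  assumes "v \<in> tspace M p" "f \<in> smooth_funs M" "h \<in> smooth_funs M"
  shows "v (\<lambda>x. f x * h x) = v f * h p + f p * v h"
proof -
  have "\<forall>f\<in>smooth_funs M. \<forall>h\<in>smooth_funs M. v (\<lambda>x. f x * h x) = v f * h p + f p * v h"
    using assms(1) unfolding tspace_def by blast
  from this[rule_format, OF assms(2,3)] show ?thesis .
qed

lemma tspaceI:
  assumes "\<And>f. f \<notin> smooth_funs M \<Longrightarrow> v f = 0"
    "\<And>f h a b. f \<in> smooth_funs M \<Longrightarrow> h \<in> smooth_funs M \<Longrightarrow> v (\<lambda>x. a * f x + b * h x) = a * v f + b * v h"
    "\<And>f h. f \<in> smooth_funs M \<Longrightarrow> h \<in> smooth_funs M \<Longrightarrow> v (\<lambda>x. f x * h x) = v f * h p + f p * v h"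
  shows "v \<in> tspace M p"
  unfolding tspace_def mem_Collect_eq using assms by (intro conjI allI impI ballI)

lemma tlinearD:
  assumes "tlinear M p \<alpha>" "v \<in> tspace M p" "w \<in> tspace M p"
  shows "\<alpha> (\<lambda>f. a * v f + b * w f) = a * \<alpha> v + b * \<alpha> w"
  using assms(1)[unfolded tlinear_def, rule_format, OF assms(2,3)] .

lemma tspace_add:
  "v \<in> tspace M p \<Longrightarrow> f \<in> smooth_funs M \<Longrightarrow> h \<in> smooth_funs M \<Longrightarrow> v (\<lambda>x. f x + h x) = v f + v h"
  using tspace_lin[of v p f h 1 1] by simp

lemma tspace_diff:
  "v \<in> tspace M p \<Longrightarrow> f \<in> smooth_funs M \<Longrightarrow> h \<in> smooth_funs M \<Longrightarrow> v (\<lambda>x. f x - h x) = v f - v h"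
  using tspace_lin[of v p f h 1 "-1"] by simp

lemma tspace_const:
  assumes v: "v \<in> tspace M p"
  shows "v (\<lambda>_. a) = 0"
proof -
  have "v (\<lambda>_. 1) = 0"
    using tspace_mult[OF v smooth_funs_const smooth_funs_const, of 1 1] by simp
  then show ?thesis
    using tspace_lin[OF v smooth_funs_const smooth_funs_const, of a 1 0 1] by simp
qed

lemma tspace_cmult:
  "v \<in> tspace M p \<Longrightarrow> f \<in> smooth_funs M \<Longrightarrow> v (\<lambda>x. a * f x) = a * v f"
  using tspace_lin[of v p f f a 0] by simp

lemma tspace_sum:
  assumes v: "v \<in> tspace M p"
  shows "(\<And>i. i \<in> A \<Longrightarrow> f i \<in> smooth_funs M) \<Longrightarrow> v (\<lambda>x. \<Sum>i\<in>A. f i x) = (\<Sum>i\<in>A. v (f i))"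
proof (induction A rule: infinite_finite_induct)
  case (insert a A)
  then show ?case
    using tspace_add[OF v, of "f a" "\<lambda>x. \<Sum>i\<in>A. f i x"] smooth_funs_sum[of A f] by simp
qed (simp_all add: tspace_const[OF v])

text \<open>The indicator \<open>ch\<close> of the complement of the manifold is smooth, being zero
  on it. Since \<open>f - h\<close> equals \<open>(f - h) * ch\<close> and both factors vanish at
  \<open>p\<close>, the product rule gives zero.\<close>

lemma tspace_cong:
  assumes v: "v \<in> tspace M p" and p: "p \<in> mpoints M"
    and f: "f \<in> smooth_funs M" and eq: "\<And>q. q \<in> mpoints M \<Longrightarrow> f q = h q"
  shows "v f = v h"
proof -
  have h: "h \<in> smooth_funs M" by (rule smooth_funs_cong[OF f eq])
  define ch :: "'a \<Rightarrow> real" where "ch q = (if q \<in> mpoints M then 0 else 1)" for q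
  have ch: "ch \<in> smooth_funs M"
    by (rule smooth_funs_cong[OF smooth_funs_const[of 0]]) (simp add: ch_def)
  have "(\<lambda>q. f q - h q) = (\<lambda>q. (f q - h q) * ch q)"
    using eq by (auto simp: ch_def fun_eq_iff)
  then have "v (\<lambda>q. f q - h q) = v (\<lambda>q. f q - h q) * ch p + (f p - h p) * v ch"
    using tspace_mult[OF v smooth_funs_diff[OF f h] ch] by simp
  then have "v (\<lambda>q. f q - h q) = 0" using p eq by (simp add: ch_def)
  then show ?thesis using tspace_diff[OF v f h] by simp
qed

lemma zero_in_tspace: "(\<lambda>f. 0) \<in> tspace M p"
  by (simp add: tspace_def)

lemma tspace_lincomb:
  assumes v: "v \<in> tspace M p" and w: "w \<in> tspace M p"
  shows "(\<lambda>f. a * v f + b * w f) \<in> tspace M p"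
proof (rule tspaceI)
  fix f h :: "'a \<Rightarrow> real" and a' b'
  show "a * v f + b * w f = 0" if "f \<notin> smooth_funs M"
    using tspace_nonsmooth[OF v that] tspace_nonsmooth[OF w that] by simp
  assume f: "f \<in> smooth_funs M" and h: "h \<in> smooth_funs M"
  show "a * v (\<lambda>x. a' * f x + b' * h x) + b * w (\<lambda>x. a' * f x + b' * h x)
      = a' * (a * v f + b * w f) + b' * (a * v h + b * w h)"
    unfolding tspace_lin[OF v f h] tspace_lin[OF w f h] by (simp add: algebra_simps)
  show "a * v (\<lambda>x. f x * h x) + b * w (\<lambda>x. f x * h x) = (a * v f + b * w f) * h p + f p * (a * v h + b * w h)"
    unfolding tspace_mult[OF v f h] tspace_mult[OF w f h] by (simp add: algebra_simps)
qed

lemma tspace_sum_closed: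
  assumes "\<And>i. i \<in> A \<Longrightarrow> v i \<in> tspace M p"
  shows "(\<lambda>f. \<Sum>i\<in>A. a i * v i f) \<in> tspace M p"
  using assms
proof (induction A rule: infinite_finite_induct)
  case (insert i A)
  then have "(\<lambda>f. a i * v i f + 1 * (\<Sum>i\<in>A. a i * v i f)) \<in> tspace M p"
    by (intro tspace_lincomb) auto
  then show ?case using insert by simp
qed (simp_all add: zero_in_tspace)

lemma tlinear_sum:
  assumes \<alpha>: "tlinear M p \<alpha>"
  shows "(\<And>i. i \<in> A \<Longrightarrow> v i \<in> tspace M p) \<Longrightarrow> \<alpha> (\<lambda>f. \<Sum>i\<in>A. a i * v i f) = (\<Sum>i\<in>A. a i * \<alpha> (v i))"
proof (induction A rule: infinite_finite_induct)
  case (insert i A)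
  have "\<alpha> (\<lambda>f. a i * v i f + 1 * (\<Sum>i\<in>A. a i * v i f)) = a i * \<alpha> (v i) + 1 * \<alpha> (\<lambda>f. \<Sum>i\<in>A. a i * v i f)"
    by (rule tlinearD[OF \<alpha>]) (use insert tspace_sum_closed[of A v p a] in auto)
  then show ?case using insert by simp
next
  have 0: "\<alpha> (\<lambda>f. 0) = 0"
  proof -
    have "\<alpha> (\<lambda>f. 0 * (\<lambda>f. 0) f + 0 * (\<lambda>f. 0) f) = 0 * \<alpha> (\<lambda>f. 0) + 0 * \<alpha> (\<lambda>f. 0)"
      by (rule tlinearD[OF \<alpha> zero_in_tspace zero_in_tspace])
    then show ?thesis by simp
  qed
  { case (infinite A) then show ?case using 0 by simp }
  { case empty then show ?case using 0 by simp }
qed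

lemma vfieldsD:
  assumes "X \<in> vfields M"
  shows "p \<in> mpoints M \<Longrightarrow> X p \<in> tspace M p" "p \<notin> mpoints M \<Longrightarrow> X p = (\<lambda>f. 0)"
    "f \<in> smooth_funs M \<Longrightarrow> (\<lambda>p. X p f) \<in> smooth_funs M"
  using assms by (simp_all add: vfields_def)

lemma vfieldsI:
  assumes "\<And>p. p \<in> mpoints M \<Longrightarrow> X p \<in> tspace M p" "\<And>p. p \<notin> mpoints M \<Longrightarrow> X p = (\<lambda>f. 0)"
    "\<And>f. f \<in> smooth_funs M \<Longrightarrow> (\<lambda>p. X p f) \<in> smooth_funs M"
  shows "X \<in> vfields M"
  using assms by (simp add: vfields_def)

lemma vfield_nonsmooth:
  assumes "X \<in> vfields M" "f \<notin> smooth_funs M"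
  shows "X p f = 0"
proof (cases "p \<in> mpoints M")
  case True
  then show ?thesis using tspace_nonsmooth[OF vfieldsD(1)[OF assms(1)] assms(2)] by blast
next
  case False
  then show ?thesis using vfieldsD(2)[OF assms(1)] by simp
qed

lemma vf_add_closed:
  assumes X: "X \<in> vfields M" and Y: "Y \<in> vfields M"
  shows "vf_add X Y \<in> vfields M"
proof (rule vfieldsI)
  fix p f
  show "vf_add X Y p \<in> tspace M p" if "p \<in> mpoints M"
    using tspace_lincomb[OF vfieldsD(1)[OF X that] vfieldsD(1)[OF Y that], of 1 1] by (simp add: vf_add_def)
  show "vf_add X Y p = (\<lambda>f. 0)" if "p \<notin> mpoints M"
    using vfieldsD(2)[OF X that] vfieldsD(2)[OF Y that] by (simp add: vf_add_def)
  show "(\<lambda>p. vf_add X Y p f) \<in> smooth_funs M" if "f \<in> smooth_funs M"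
    unfolding vf_add_def by (rule smooth_funs_add[OF vfieldsD(3)[OF X that] vfieldsD(3)[OF Y that]])
qed

lemma vf_diff_closed:
  assumes X: "X \<in> vfields M" and Y: "Y \<in> vfields M"
  shows "vf_diff X Y \<in> vfields M"
proof (rule vfieldsI)
  fix p f
  show "vf_diff X Y p \<in> tspace M p" if "p \<in> mpoints M"
    using tspace_lincomb[OF vfieldsD(1)[OF X that] vfieldsD(1)[OF Y that], of 1 "-1"] by (simp add: vf_diff_def)
  show "vf_diff X Y p = (\<lambda>f. 0)" if "p \<notin> mpoints M"
    using vfieldsD(2)[OF X that] vfieldsD(2)[OF Y that] by (simp add: vf_diff_def)
  show "(\<lambda>p. vf_diff X Y p f) \<in> smooth_funs M" if "f \<in> smooth_funs M"
    unfolding vf_diff_def by (rule smooth_funs_diff[OF vfieldsD(3)[OF X that] vfieldsD(3)[OF Y that]])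
qed

lemma vf_scale_closed:
  assumes X: "X \<in> vfields M" and u: "u \<in> smooth_funs M"
  shows "vf_scale u X \<in> vfields M"
proof (rule vfieldsI)
  fix p f
  show "vf_scale u X p \<in> tspace M p" if "p \<in> mpoints M"
    using tspace_lincomb[OF vfieldsD(1)[OF X that] vfieldsD(1)[OF X that], of "u p" 0] by (simp add: vf_scale_def)
  show "vf_scale u X p = (\<lambda>f. 0)" if "p \<notin> mpoints M"
    using vfieldsD(2)[OF X that] by (simp add: vf_scale_def)
  show "(\<lambda>p. vf_scale u X p f) \<in> smooth_funs M" if "f \<in> smooth_funs M"
    unfolding vf_scale_def by (rule smooth_funs_mult[OF u vfieldsD(3)[OF X that]])
qed

lemma lie_bracket_closed:
  assumes X: "X \<in> vfields M" and Y: "Y \<in> vfields M"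
  shows "lie_bracket X Y \<in> vfields M"
proof (rule vfieldsI)
  note XD = vfieldsD[OF X] and YD = vfieldsD[OF Y]
  show "lie_bracket X Y p = (\<lambda>f. 0)" if "p \<notin> mpoints M" for p
    using that by (simp add: lie_bracket_def XD YD)
  show "(\<lambda>p. lie_bracket X Y p f) \<in> smooth_funs M" if "f \<in> smooth_funs M" for f
    unfolding lie_bracket_def by (rule smooth_funs_diff[OF XD(3)[OF YD(3)[OF that]] YD(3)[OF XD(3)[OF that]]])
  fix p assume p: "p \<in> mpoints M"
  note Xp = XD(1)[OF p] and Yp = YD(1)[OF p]
  show "lie_bracket X Y p \<in> tspace M p"
  proof (rule tspaceI)
    fix f assume "f \<notin> smooth_funs M"
    \<comment> \<open>Both fields vanish on a nonsmooth \<open>f\<close> at every point, so the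
      inner functions are constantly zero, and derivations kill constants.\<close>
    then show "lie_bracket X Y p f = 0"
      using tspace_const[OF Xp] tspace_const[OF Yp]
      by (simp add: lie_bracket_def vfield_nonsmooth[OF X] vfield_nonsmooth[OF Y])
  next
    fix f h :: "'a \<Rightarrow> real" and a b :: real
    assume f: "f \<in> smooth_funs M" and h: "h \<in> smooth_funs M"
    have lin: "Z p (\<lambda>q. Z' q (\<lambda>x. a * f x + b * h x)) = a * Z p (\<lambda>q. Z' q f) + b * Z p (\<lambda>q. Z' q h)"
      if Z: "Z \<in> vfields M" and Z': "Z' \<in> vfields M" for Z Z'
    proof -
      \<comment> \<open>Linearity of \<open>Z' q\<close> is available only for \<open>q\<close> on
        the manifold, hence the passage through \<open>tspace_cong\<close>.\<close>
      have "Z p (\<lambda>q. Z' q (\<lambda>x. a * f x + b * h x)) = Z p (\<lambda>q. a * Z' q f + b * Z' q h)"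
      proof (rule tspace_cong[OF vfieldsD(1)[OF Z p] p])
        show "(\<lambda>q. Z' q (\<lambda>x. a * f x + b * h x)) \<in> smooth_funs M"
          by (rule vfieldsD(3)[OF Z' smooth_funs_add[OF smooth_funs_mult[OF smooth_funs_const f] smooth_funs_mult[OF smooth_funs_const h]]])
      qed (rule tspace_lin[OF vfieldsD(1)[OF Z'] f h])
      also have "\<dots> = a * Z p (\<lambda>q. Z' q f) + b * Z p (\<lambda>q. Z' q h)"
        by (rule tspace_lin[OF vfieldsD(1)[OF Z p] vfieldsD(3)[OF Z' f] vfieldsD(3)[OF Z' h]])
      finally show ?thesis .
    qed
    show "lie_bracket X Y p (\<lambda>x. a * f x + b * h x) = a * lie_bracket X Y p f + b * lie_bracket X Y p h"
      unfolding lie_bracket_def lin[OF X Y] lin[OF Y X] by (simp add: algebra_simps)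
    \<comment> \<open>The two mixed products are exchanged by swapping \<open>Z\<close> and
      \<open>Z'\<close>; they cancel in the commutator.\<close>
    have prod: "Z p (\<lambda>q. Z' q (\<lambda>x. f x * h x)) =
        Z p (\<lambda>q. Z' q f) * h p + Z' p f * Z p h + (Z p f * Z' p h + f p * Z p (\<lambda>q. Z' q h))"
      if Z: "Z \<in> vfields M" and Z': "Z' \<in> vfields M" for Z Z'
    proof -
      note Zp = vfieldsD(1)[OF Z p] and Z'f = vfieldsD(3)[OF Z' f] and Z'h = vfieldsD(3)[OF Z' h]
      have "Z p (\<lambda>q. Z' q (\<lambda>x. f x * h x)) = Z p (\<lambda>q. Z' q f * h q + f q * Z' q h)"
      proof (rule tspace_cong[OF Zp p])
        show "(\<lambda>q. Z' q (\<lambda>x. f x * h x)) \<in> smooth_funs M"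
          by (rule vfieldsD(3)[OF Z' smooth_funs_mult[OF f h]])
      qed (rule tspace_mult[OF vfieldsD(1)[OF Z'] f h])
      also have "\<dots> = Z p (\<lambda>q. Z' q f * h q) + Z p (\<lambda>q. f q * Z' q h)"
        by (rule tspace_add[OF Zp smooth_funs_mult[OF Z'f h] smooth_funs_mult[OF f Z'h]])
      also have "\<dots> = Z p (\<lambda>q. Z' q f) * h p + Z' p f * Z p h + (Z p f * Z' p h + f p * Z p (\<lambda>q. Z' q h))"
        by (simp only: tspace_mult[OF Zp Z'f h] tspace_mult[OF Zp f Z'h])
      finally show ?thesis .
    qed
    show "lie_bracket X Y p (\<lambda>x. f x * h x) = lie_bracket X Y p f * h p + f p * lie_bracket X Y p h"
      unfolding lie_bracket_def prod[OF X Y] prod[OF Y X] by (simp add: algebra_simps)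
  qed
qed

end

section \<open>Contractions of coefficient arrays with vectors\<close>

definition bil :: "nat \<Rightarrow> (nat \<Rightarrow> nat \<Rightarrow> nat \<Rightarrow> real) \<Rightarrow> (nat \<Rightarrow> real) \<Rightarrow> (nat \<Rightarrow> real) \<Rightarrow> nat \<Rightarrow> real" where
  "bil n T x y k = (\<Sum>i<n. \<Sum>j<n. T i j k * x i * y j)"

definition tri :: "nat \<Rightarrow> (nat \<Rightarrow> nat \<Rightarrow> nat \<Rightarrow> real) \<Rightarrow> (nat \<Rightarrow> real) \<Rightarrow> (nat \<Rightarrow> real) \<Rightarrow> (nat \<Rightarrow> real) \<Rightarrow> real" where
  "tri n T x y z = (\<Sum>i<n. \<Sum>j<n. \<Sum>k<n. T i j k * x i * y j * z k)"

definition quad :: "nat \<Rightarrow> (nat \<Rightarrow> nat \<Rightarrow> nat \<Rightarrow> nat \<Rightarrow> real) \<Rightarrow>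
    (nat \<Rightarrow> real) \<Rightarrow> (nat \<Rightarrow> real) \<Rightarrow> (nat \<Rightarrow> real) \<Rightarrow> (nat \<Rightarrow> real) \<Rightarrow> real" where
  "quad n T w x y z = (\<Sum>i<n. \<Sum>j<n. \<Sum>k<n. \<Sum>l<n. T i j k l * w i * x j * y k * z l)"

lemma bil_cong: "(\<And>i. i < n \<Longrightarrow> x i = x' i) \<Longrightarrow> (\<And>i. i < n \<Longrightarrow> y i = y' i) \<Longrightarrow> bil n T x y k = bil n T x' y' k"
  by (simp add: bil_def)

lemma tri_cong: "(\<And>i. i < n \<Longrightarrow> x i = x' i) \<Longrightarrow> (\<And>i. i < n \<Longrightarrow> y i = y' i) \<Longrightarrow> (\<And>i. i < n \<Longrightarrow> z i = z' i)
   \<Longrightarrow> tri n T x y z = tri n T x' y' z'"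
  by (simp add: tri_def)

lemma bil_add:
  "bil n T (\<lambda>i. x i + x' i) y k = bil n T x y k + bil n T x' y k"
  "bil n T x (\<lambda>i. y i + y' i) k = bil n T x y k + bil n T x y' k"
  by (simp_all add: bil_def algebra_simps sum.distrib)

lemma bil_diff:
  "bil n T (\<lambda>i. x i - x' i) y k = bil n T x y k - bil n T x' y k"
  by (simp_all add: bil_def algebra_simps sum_subtractf)

lemma bil_scale:
  "bil n T (\<lambda>i. a * x i) y k = a * bil n T x y k"
  "bil n T x (\<lambda>i. a * y i) k = a * bil n T x y k"
  by (simp_all add: bil_def sum_distrib_left mult_ac)

lemma tri_lin1: "tri n T (\<lambda>i. a * x i + b * x' i) y z = a * tri n T x y z + b * tri n T x' y z"
  by (simp add: tri_def algebra_simps sum.distrib sum_distrib_left)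

lemma tri_add_diff: "tri n T (\<lambda>i. x i - x' i + x'' i) y z = tri n T x y z - tri n T x' y z + tri n T x'' y z"
  by (simp add: tri_def algebra_simps sum.distrib sum_subtractf)

lemma tri_swap12: "tri n T x y z = tri n (\<lambda>i j k. T j i k) y x z"
  unfolding tri_def by (subst sum.swap) (simp add: mult_ac)

lemma tri_swap23: "tri n T x y z = tri n (\<lambda>i j k. T i k j) x z y"
  unfolding tri_def by (rule sum.cong[OF refl], subst sum.swap) (simp add: mult_ac)

lemma tri_minus: "tri n (\<lambda>i j k. - T i j k) x y z = - tri n T x y z"
  by (simp add: tri_def sum_negf)

lemma tri_coeff_cong:
  "(\<And>i j k. i < n \<Longrightarrow> j < n \<Longrightarrow> k < n \<Longrightarrow> T i j k = T' i j k) \<Longrightarrow> tri n T x y z = tri n T' x y z"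
  by (simp add: tri_def)

lemma tri_antisym12:
  assumes "\<And>i j k. i < n \<Longrightarrow> j < n \<Longrightarrow> k < n \<Longrightarrow> T i j k = - T j i k"
  shows "tri n T x y z = - tri n T y x z"
proof -
  have "tri n T x y z = tri n (\<lambda>i j k. - T j i k) x y z" by (rule tri_coeff_cong[OF assms])
  also have "\<dots> = - tri n T y x z" unfolding tri_minus by (simp add: tri_swap12[of n T y])
  finally show ?thesis .
qed

lemma tri_antisym23:
  assumes "\<And>i j k. i < n \<Longrightarrow> j < n \<Longrightarrow> k < n \<Longrightarrow> T i j k = - T i k j"
  shows "tri n T x y z = - tri n T x z y"
proof -
  have "tri n T x y z = tri n (\<lambda>i j k. - T i k j) x y z" by (rule tri_coeff_cong[OF assms])
  also have "\<dots> = - tri n T x z y" unfolding tri_minus by (simp add: tri_swap23[of n T x z])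
  finally show ?thesis .
qed

lemma tri_eq_bil: "tri n T x y z = (\<Sum>k<n. bil n T x y k * z k)"
proof -
  have "tri n T x y z = (\<Sum>i<n. \<Sum>k<n. \<Sum>j<n. T i j k * x i * y j * z k)"
    unfolding tri_def by (intro sum.cong refl sum.swap)
  also have "\<dots> = (\<Sum>k<n. \<Sum>i<n. \<Sum>j<n. T i j k * x i * y j * z k)" by (rule sum.swap)
  finally show ?thesis by (simp add: bil_def sum_distrib_right)
qed

lemma quad_swap12: "quad n T w x y z = quad n (\<lambda>i j k l. T j i k l) x w y z"
  unfolding quad_def by (subst sum.swap) (simp add: mult_ac)

lemma quad_swap23: "quad n T w x y z = quad n (\<lambda>i j k l. T i k j l) w y x z"
  unfolding quad_def by (rule sum.cong[OF refl], subst sum.swap) (simp add: mult_ac)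

lemma quad_swap34: "quad n T w x y z = quad n (\<lambda>i j k l. T i j l k) w x z y"
  unfolding quad_def by (rule sum.cong[OF refl], rule sum.cong[OF refl], subst sum.swap) (simp add: mult_ac)

lemma quad_add: "quad n T w x y z + quad n T' w x y z = quad n (\<lambda>i j k l. T i j k l + T' i j k l) w x y z"
  by (simp add: quad_def algebra_simps sum.distrib)

lemma quad_diff: "quad n T w x y z - quad n T' w x y z = quad n (\<lambda>i j k l. T i j k l - T' i j k l) w x y z"
  by (simp add: quad_def algebra_simps sum_subtractf)

lemma quad_eq_0:
  "(\<And>i j k l. i < n \<Longrightarrow> j < n \<Longrightarrow> k < n \<Longrightarrow> l < n \<Longrightarrow> T i j k l = 0) \<Longrightarrow> quad n T w x y z = 0"
  by (simp add: quad_def)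

lemma tri_bil: "tri n h (bil n c w x) y z = quad n (\<lambda>i j k l. \<Sum>m<n. c i j m * h m k l) w x y z"
proof -
  have "quad n (\<lambda>i j k l. \<Sum>m<n. c i j m * h m k l) w x y z =
      (\<Sum>i<n. \<Sum>j<n. \<Sum>k<n. \<Sum>l<n. \<Sum>m<n. c i j m * h m k l * w i * x j * y k * z l)"
    by (simp add: quad_def sum_distrib_right)
  also have "\<dots> = (\<Sum>i<n. \<Sum>j<n. \<Sum>k<n. \<Sum>m<n. \<Sum>l<n. c i j m * h m k l * w i * x j * y k * z l)"
    by (intro sum.cong refl sum.swap)
  also have "\<dots> = (\<Sum>i<n. \<Sum>j<n. \<Sum>m<n. \<Sum>k<n. \<Sum>l<n. c i j m * h m k l * w i * x j * y k * z l)"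
    by (intro sum.cong refl sum.swap)
  also have "\<dots> = (\<Sum>i<n. \<Sum>m<n. \<Sum>j<n. \<Sum>k<n. \<Sum>l<n. c i j m * h m k l * w i * x j * y k * z l)"
    by (intro sum.cong refl sum.swap)
  also have "\<dots> = (\<Sum>m<n. \<Sum>i<n. \<Sum>j<n. \<Sum>k<n. \<Sum>l<n. c i j m * h m k l * w i * x j * y k * z l)"
    by (rule sum.swap)
  also have "\<dots> = (\<Sum>m<n. \<Sum>k<n. \<Sum>l<n. h m k l * bil n c w x m * y k * z l)"
  proof (rule sum.cong[OF refl])
    fix m
    have "(\<Sum>i<n. \<Sum>j<n. \<Sum>k<n. \<Sum>l<n. c i j m * h m k l * w i * x j * y k * z l)
        = (\<Sum>i<n. \<Sum>j<n. c i j m * w i * x j * (\<Sum>k<n. \<Sum>l<n. h m k l * y k * z l))"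
      by (simp add: sum_distrib_left mult_ac)
    also have "\<dots> = bil n c w x m * (\<Sum>k<n. \<Sum>l<n. h m k l * y k * z l)"
      by (simp add: bil_def sum_distrib_right)
    also have "\<dots> = (\<Sum>k<n. \<Sum>l<n. h m k l * bil n c w x m * y k * z l)"
      by (simp add: sum_distrib_left mult_ac)
    finally show "(\<Sum>i<n. \<Sum>j<n. \<Sum>k<n. \<Sum>l<n. c i j m * h m k l * w i * x j * y k * z l) =
      (\<Sum>k<n. \<Sum>l<n. h m k l * bil n c w x m * y k * z l)" .
  qed
  finally show ?thesis by (simp add: tri_def)
qed

lemma bil_swap: "bil n T x y l = bil n (\<lambda>i j. T j i) y x l"
  unfolding bil_def by (subst sum.swap) (simp add: mult_ac)

lemma bil_bil_left:
  "bil n A (bil n B x y) z l = tri n (\<lambda>i j k. \<Sum>m<n. B i j m * A m k l) x y z"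
proof -
  have "tri n (\<lambda>i j k. \<Sum>m<n. B i j m * A m k l) x y z =
     (\<Sum>i<n. \<Sum>j<n. \<Sum>k<n. \<Sum>m<n. B i j m * A m k l * x i * y j * z k)"
    by (simp add: tri_def sum_distrib_right)
  also have "\<dots> = (\<Sum>i<n. \<Sum>j<n. \<Sum>m<n. \<Sum>k<n. B i j m * A m k l * x i * y j * z k)"
    by (intro sum.cong refl sum.swap)
  also have "\<dots> = (\<Sum>i<n. \<Sum>m<n. \<Sum>j<n. \<Sum>k<n. B i j m * A m k l * x i * y j * z k)"
    by (intro sum.cong refl sum.swap)
  also have "\<dots> = (\<Sum>m<n. \<Sum>i<n. \<Sum>j<n. \<Sum>k<n. B i j m * A m k l * x i * y j * z k)"
    by (rule sum.swap)
  also have "\<dots> = (\<Sum>m<n. bil n B x y m * (\<Sum>k<n. A m k l * z k))"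
    by (simp add: bil_def sum_distrib_right sum_distrib_left mult_ac)
  also have "\<dots> = bil n A (bil n B x y) z l"
    by (simp add: bil_def[of n A] sum_distrib_left mult_ac)
  finally show ?thesis by simp
qed

lemma bil_bil_right:
  "bil n A x (bil n B y z) l = tri n (\<lambda>i j k. \<Sum>m<n. B j k m * A i m l) x y z"
proof -
  have "bil n A x (bil n B y z) l = tri n (\<lambda>j k i. \<Sum>m<n. B j k m * A i m l) y z x"
    unfolding bil_swap[of n A x] bil_bil_left ..
  also have "\<dots> = tri n (\<lambda>i j k. \<Sum>m<n. B j k m * A i m l) x y z"
    unfolding tri_swap23[of n _ y z x] tri_swap12[of n _ y x z] ..
  finally show ?thesis .
qed

lemma tri_diff: "tri n T x y z - tri n T' x y z = tri n (\<lambda>i j k. T i j k - T' i j k) x y z"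
  by (simp add: tri_def algebra_simps sum_subtractf)

text \<open>An orthonormal family of \<open>n\<close> rows of length \<open>n\<close> has orthonormal columns: the Gram
  defect \<open>I - P\<close> of the columns is a projection of trace zero.\<close>

lemma orthonormal_rows_imp_columns:
  fixes a :: "nat \<Rightarrow> nat \<Rightarrow> real"
  assumes rows: "\<And>j k. j < n \<Longrightarrow> k < n \<Longrightarrow> (\<Sum>i<n. a j i * a k i) = (if j = k then 1 else 0)"
    and "i < n" "l < n"
  shows "(\<Sum>j<n. a j i * a j l) = (if i = l then 1 else 0)"
proof -
  define P where "P i l = (\<Sum>j<n. a j i * a j l)" for i l
  define d :: "nat \<Rightarrow> nat \<Rightarrow> real" where "d i l = (if i = l then 1 else 0)" for i l
  have PP: "(\<Sum>m<n. P i m * P m l) = P i l" for i l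
  proof -
    have "(\<Sum>m<n. P i m * P m l) = (\<Sum>m<n. \<Sum>j<n. \<Sum>k<n. a j i * a k l * (a j m * a k m))"
      by (simp add: P_def sum_product mult_ac)
    also have "\<dots> = (\<Sum>j<n. \<Sum>m<n. \<Sum>k<n. a j i * a k l * (a j m * a k m))" by (rule sum.swap)
    also have "\<dots> = (\<Sum>j<n. \<Sum>k<n. \<Sum>m<n. a j i * a k l * (a j m * a k m))"
      by (intro sum.cong refl sum.swap)
    also have "\<dots> = (\<Sum>j<n. \<Sum>k<n. a j i * a k l * (if j = k then 1 else 0))"
      by (simp add: rows flip: sum_distrib_left)
    also have "\<dots> = P i l" by (simp add: P_def if_distrib cong: if_cong)
    finally show ?thesis .
  qed
  have sym: "P i l = P l i" for i l by (simp add: P_def mult.commute)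
  \<comment> \<open>\<open>I - P\<close> is again symmetric and idempotent, so the squared length of
    a row is its diagonal entry.\<close>
  have sq: "(\<Sum>m<n. (d i m - P i m)\<^sup>2) = 1 - P i i" if "i < n" for i
  proof -
    have "(\<Sum>m<n. (d i m - P i m)\<^sup>2) = (\<Sum>m<n. (d i m)\<^sup>2) - 2 * (\<Sum>m<n. d i m * P i m) + (\<Sum>m<n. P i m * P m i)"
    proof -
      have "(d i m - P i m)\<^sup>2 = (d i m)\<^sup>2 - 2 * (d i m * P i m) + P i m * P m i" for m
        using sym[of m i] by (simp add: power2_eq_square algebra_simps)
      then show ?thesis by (simp add: sum.distrib sum_subtractf sum_distrib_left)
    qed
    also have "\<dots> = 1 - P i i" using that PP
      by (simp add: d_def if_distrib if_distribR power2_eq_square cong: if_cong)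
    finally show ?thesis .
  qed
  have "(\<Sum>i<n. P i i) = (\<Sum>j<n. \<Sum>i<n. a j i * a j i)" unfolding P_def by (rule sum.swap)
  also have "\<dots> = n" by (simp add: rows)
  finally have "(\<Sum>i<n. \<Sum>m<n. (d i m - P i m)\<^sup>2) = 0" by (simp add: sq sum_subtractf)
  then have "\<forall>i<n. \<forall>m<n. (d i m - P i m)\<^sup>2 = 0"
    by (subst (asm) sum_nonneg_eq_0_iff; auto intro: sum_nonneg simp: sum_nonneg_eq_0_iff)
  then show ?thesis using assms(2,3) by (auto simp: P_def d_def)
qed

section \<open>Manifolds with a global frame that has constant structure functions\<close>

lemma sum_mult_unit: "(c :: nat) < n \<Longrightarrow> (\<Sum>k<n. f k * (if k = c then 1 else (0 :: real))) = f c"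
proof -
  assume "c < n"
  have "(\<Sum>k<n. f k * (if k = c then 1 else (0 :: real))) = (\<Sum>k<n. if k = c then f k else 0)"
    by (rule sum.cong) auto
  then show ?thesis using \<open>c < n\<close> by simp
qed

lemma tri_unit:
  assumes "i < n" "j < n" "k < n"
  shows "tri n T (\<lambda>m. if m = i then 1 else 0) (\<lambda>m. if m = j then 1 else 0) (\<lambda>m. if m = k then 1 else 0) = T i j k"
proof -
  have "tri n T (\<lambda>m. if m = i then 1 else 0) (\<lambda>m. if m = j then 1 else 0) (\<lambda>m. if m = k then 1 else 0) =
      (\<Sum>a<n. \<Sum>b<n. T a b k * (if a = i then 1 else 0) * (if b = j then 1 else 0))"
    unfolding tri_def sum_mult_unit[OF assms(3)] ..
  also have "\<dots> = T i j k"
    unfolding sum_mult_unit[OF assms(2)] sum_mult_unit[OF assms(1)] ..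
  finally show ?thesis .
qed

text \<open>Abstracts what is used of left-invariant fields on a Lie group. As \<open>c\<close>
  consists of numbers, connections and forms with constant components turn every geometric condition
  into an identity between arrays.\<close>

locale global_frame = smooth_manifold M for M :: "'a smooth_mfd" +
  fixes F :: "nat \<Rightarrow> 'a vfield" and \<theta> :: "nat \<Rightarrow> 'a \<Rightarrow> 'a tvec \<Rightarrow> real"
    and c :: "nat \<Rightarrow> nat \<Rightarrow> nat \<Rightarrow> real"
  assumes frame_vfields: "\<And>i. i < mdim M \<Longrightarrow> F i \<in> vfields M"
    and coframe_linear: "\<And>i p. i < mdim M \<Longrightarrow> p \<in> mpoints M \<Longrightarrow> tlinear M p (\<theta> i p)"
    and coframe_frame: "\<And>i j p. i < mdim M \<Longrightarrow> j < mdim M \<Longrightarrow> p \<in> mpoints M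
          \<Longrightarrow> \<theta> i p (F j p) = (if i = j then 1 else 0)"
    and frame_expansion: "\<And>p v. p \<in> mpoints M \<Longrightarrow> v \<in> tspace M p \<Longrightarrow> v = (\<lambda>f. \<Sum>i<mdim M. \<theta> i p v * F i p f)"
    and coframe_smooth: "\<And>i X. i < mdim M \<Longrightarrow> X \<in> vfields M \<Longrightarrow> (\<lambda>p. \<theta> i p (X p)) \<in> smooth_funs M"
    and frame_bracket: "\<And>i j p. i < mdim M \<Longrightarrow> j < mdim M \<Longrightarrow> p \<in> mpoints M
          \<Longrightarrow> lie_bracket (F i) (F j) p = (\<lambda>f. \<Sum>k<mdim M. c i j k * F k p f)"
begin

abbreviation "n \<equiv> mdim M"

definition co :: "'a vfield \<Rightarrow> 'a \<Rightarrow> nat \<Rightarrow> real" where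
  "co X p i = \<theta> i p (X p)"

definition vf :: "('a \<Rightarrow> nat \<Rightarrow> real) \<Rightarrow> 'a vfield" where
  "vf a = (\<lambda>p f. \<Sum>i<n. a p i * F i p f)"

definition der :: "'a vfield \<Rightarrow> 'a \<Rightarrow> ('a \<Rightarrow> nat \<Rightarrow> real) \<Rightarrow> nat \<Rightarrow> real" where
  "der X p a i = X p (\<lambda>q. a q i)"

lemma coframe_lin:
  "i < n \<Longrightarrow> p \<in> mpoints M \<Longrightarrow> v \<in> tspace M p \<Longrightarrow> w \<in> tspace M p
   \<Longrightarrow> \<theta> i p (\<lambda>f. a * v f + b * w f) = a * \<theta> i p v + b * \<theta> i p w"
  by (rule tlinearD[OF coframe_linear])

lemma coframe_comb:
  assumes "i < n" "p \<in> mpoints M"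
  shows "\<theta> i p (\<lambda>f. \<Sum>j<n. a j * F j p f) = a i"
proof -
  have "\<theta> i p (\<lambda>f. \<Sum>j<n. a j * F j p f) = (\<Sum>j<n. a j * \<theta> i p (F j p))"
    by (rule tlinear_sum[OF coframe_linear[OF assms]]) (use frame_vfields vfieldsD(1) assms in auto)
  also have "\<dots> = (\<Sum>j<n. if i = j then a i else 0)"
    by (rule sum.cong) (use assms coframe_frame in auto)
  finally show ?thesis using assms by simp
qed

lemma co_smooth: "X \<in> vfields M \<Longrightarrow> i < n \<Longrightarrow> (\<lambda>p. co X p i) \<in> smooth_funs M"
  unfolding co_def by (rule coframe_smooth)

lemma vf_closed:
  assumes "\<And>i. i < n \<Longrightarrow> (\<lambda>p. a p i) \<in> smooth_funs M"
  shows "vf a \<in> vfields M"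
proof (rule vfieldsI)
  show "vf a p \<in> tspace M p" if "p \<in> mpoints M" for p
    unfolding vf_def by (rule tspace_sum_closed) (use that frame_vfields vfieldsD(1) in auto)
  show "vf a p = (\<lambda>f. 0)" if "p \<notin> mpoints M" for p
    unfolding vf_def using that frame_vfields vfieldsD(2) by (auto intro!: ext sum.neutral)
  show "(\<lambda>p. vf a p f) \<in> smooth_funs M" if "f \<in> smooth_funs M" for f
    unfolding vf_def by (intro smooth_funs_sum smooth_funs_mult) (use assms that frame_vfields vfieldsD(3) in auto)
qed

lemma co_vf: "p \<in> mpoints M \<Longrightarrow> i < n \<Longrightarrow> co (vf a) p i = a p i"
  unfolding co_def vf_def by (rule coframe_comb)

lemma vfield_apply:
  assumes "X \<in> vfields M" "p \<in> mpoints M"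
  shows "X p f = (\<Sum>i<n. co X p i * F i p f)"
  unfolding co_def using fun_cong[OF frame_expansion[OF assms(2) vfieldsD(1)[OF assms]], of f] .

lemma vfields_eqI:
  assumes "X \<in> vfields M" "Y \<in> vfields M" "\<And>p i. p \<in> mpoints M \<Longrightarrow> i < n \<Longrightarrow> co X p i = co Y p i"
  shows "X = Y"
proof (intro ext)
  fix p f
  show "X p f = Y p f"
  proof (cases "p \<in> mpoints M")
    case True
    then show ?thesis using assms(3) by (simp add: vfield_apply[OF assms(1)] vfield_apply[OF assms(2)])
  qed (use vfieldsD(2) assms(1,2) in simp)
qed

lemma co_lincomb:
  assumes "X \<in> vfields M" "Y \<in> vfields M" "p \<in> mpoints M" "i < n"
  shows "co (vf_add X Y) p i = co X p i + co Y p i" "co (vf_diff X Y) p i = co X p i - co Y p i"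
    "co (vf_scale u X) p i = u p * co X p i"
  using coframe_lin[OF assms(4,3) vfieldsD(1)[OF assms(1,3)] vfieldsD(1)[OF assms(2,3)], of 1 1]
    coframe_lin[OF assms(4,3) vfieldsD(1)[OF assms(1,3)] vfieldsD(1)[OF assms(2,3)], of 1 "-1"]
    coframe_lin[OF assms(4,3) vfieldsD(1)[OF assms(1,3)] vfieldsD(1)[OF assms(1,3)], of "u p" 0]
  by (simp_all add: co_def vf_add_def vf_diff_def vf_scale_def)

lemma der_add:
  assumes "X \<in> vfields M" "p \<in> mpoints M" "(\<lambda>q. a q i) \<in> smooth_funs M" "(\<lambda>q. b q i) \<in> smooth_funs M"
  shows "der X p (\<lambda>q i. a q i + b q i) i = der X p a i + der X p b i"
  unfolding der_def by (rule tspace_add[OF vfieldsD(1)[OF assms(1,2)] assms(3,4)])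

lemma der_cong:
  assumes "X \<in> vfields M" "p \<in> mpoints M" "(\<lambda>q. a q i) \<in> smooth_funs M"
    "\<And>q. q \<in> mpoints M \<Longrightarrow> a q i = b q i"
  shows "der X p a i = der X p b i"
  unfolding der_def by (rule tspace_cong[OF vfieldsD(1)[OF assms(1,2)] assms(2,3,4)])

lemma bil_smooth:
  assumes "\<And>i. i < n \<Longrightarrow> (\<lambda>q. a q i) \<in> smooth_funs M" "\<And>i. i < n \<Longrightarrow> (\<lambda>q. b q i) \<in> smooth_funs M"
  shows "(\<lambda>q. bil n T (a q) (b q) k) \<in> smooth_funs M"
  unfolding bil_def by (intro smooth_funs_sum smooth_funs_mult smooth_funs_const) (use assms in auto)

lemma tri_smooth:
  assumes "\<And>i. i < n \<Longrightarrow> (\<lambda>q. x q i) \<in> smooth_funs M" "\<And>i. i < n \<Longrightarrow> (\<lambda>q. y q i) \<in> smooth_funs M"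
    "\<And>i. i < n \<Longrightarrow> (\<lambda>q. z q i) \<in> smooth_funs M"
  shows "(\<lambda>q. tri n T (x q) (y q) (z q)) \<in> smooth_funs M"
  unfolding tri_def by (intro smooth_funs_sum smooth_funs_mult smooth_funs_const) (use assms in auto)

lemma der_bil:
  assumes X: "X \<in> vfields M" and p: "p \<in> mpoints M"
    and a: "\<And>i. i < n \<Longrightarrow> (\<lambda>q. a q i) \<in> smooth_funs M" and b: "\<And>i. i < n \<Longrightarrow> (\<lambda>q. b q i) \<in> smooth_funs M"
  shows "X p (\<lambda>q. bil n T (a q) (b q) k) = bil n T (der X p a) (b p) k + bil n T (a p) (der X p b) k"
proof -
  note v = vfieldsD(1)[OF X p]
  have "X p (\<lambda>q. bil n T (a q) (b q) k) = (\<Sum>i<n. X p (\<lambda>q. \<Sum>j<n. T i j k * a q i * b q j))"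
    unfolding bil_def
    by (rule tspace_sum[OF v]) (intro smooth_funs_sum smooth_funs_mult smooth_funs_const, use a b in auto)
  also have "\<dots> = (\<Sum>i<n. \<Sum>j<n. X p (\<lambda>q. T i j k * a q i * b q j))"
    by (intro sum.cong refl tspace_sum[OF v]) (intro smooth_funs_mult smooth_funs_const, use a b in auto)
  also have "\<dots> = (\<Sum>i<n. \<Sum>j<n. T i j k * der X p a i * b p j + T i j k * a p i * der X p b j)"
  proof (intro sum.cong refl)
    fix i j assume "i \<in> {..<n}" "j \<in> {..<n}"
    then have ij: "i < n" "j < n" by auto
    have "X p (\<lambda>q. (T i j k * a q i) * b q j) = X p (\<lambda>q. T i j k * a q i) * b p j + (T i j k * a p i) * X p (\<lambda>q. b q j)"
      by (rule tspace_mult[OF v smooth_funs_mult[OF smooth_funs_const a[OF ij(1)]] b[OF ij(2)]])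
    also have "X p (\<lambda>q. T i j k * a q i) = T i j k * X p (\<lambda>q. a q i)"
      by (rule tspace_cmult[OF v a[OF ij(1)]])
    finally show "X p (\<lambda>q. T i j k * a q i * b q j) = T i j k * der X p a i * b p j + T i j k * a p i * der X p b j"
      by (simp add: der_def)
  qed
  finally show ?thesis by (simp add: bil_def sum.distrib)
qed

lemma der_tri:
  assumes X: "X \<in> vfields M" and p: "p \<in> mpoints M"
    and x: "\<And>i. i < n \<Longrightarrow> (\<lambda>q. x q i) \<in> smooth_funs M" and y: "\<And>i. i < n \<Longrightarrow> (\<lambda>q. y q i) \<in> smooth_funs M"
    and z: "\<And>i. i < n \<Longrightarrow> (\<lambda>q. z q i) \<in> smooth_funs M"
  shows "X p (\<lambda>q. tri n T (x q) (y q) (z q)) =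
    tri n T (der X p x) (y p) (z p) + tri n T (x p) (der X p y) (z p) + tri n T (x p) (y p) (der X p z)"
proof -
  note v = vfieldsD(1)[OF X p]
  have bs: "(\<lambda>q. bil n T (x q) (y q) k) \<in> smooth_funs M" for k by (rule bil_smooth[OF x y])
  have "X p (\<lambda>q. tri n T (x q) (y q) (z q)) = (\<Sum>k<n. X p (\<lambda>q. bil n T (x q) (y q) k * z q k))"
    unfolding tri_eq_bil by (rule tspace_sum[OF v]) (use smooth_funs_mult[OF bs z] in auto)
  also have "\<dots> = (\<Sum>k<n. (bil n T (der X p x) (y p) k + bil n T (x p) (der X p y) k) * z p k
      + bil n T (x p) (y p) k * der X p z k)"
  proof (rule sum.cong[OF refl])
    fix k assume "k \<in> {..<n}"
    then have k: "k < n" by simp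
    show "X p (\<lambda>q. bil n T (x q) (y q) k * z q k) = (bil n T (der X p x) (y p) k + bil n T (x p) (der X p y) k) * z p k
      + bil n T (x p) (y p) k * der X p z k"
    proof -
      have "X p (\<lambda>q. bil n T (x q) (y q) k) = bil n T (der X p x) (y p) k + bil n T (x p) (der X p y) k"
        by (rule der_bil[OF X p x y])
      then show ?thesis unfolding tspace_mult[OF v bs z[OF k]] by (simp add: der_def)
    qed
  qed
  finally show ?thesis by (simp add: tri_eq_bil algebra_simps sum.distrib)
qed

text \<open>The first-order terms differentiate the components; the second-order terms
  \<open>F i p (\<lambda>q. F j q f)\<close> survive only antisymmetrised in \<open>i\<close> and
  \<open>j\<close>, where \<open>frame_bracket\<close> turns them into structure constants.\<close>

lemma co_lie_bracket:
  assumes X: "X \<in> vfields M" and Y: "Y \<in> vfields M" and p: "p \<in> mpoints M" and k: "k < n"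
  shows "co (lie_bracket X Y) p k = der X p (co Y) k - der Y p (co X) k + bil n c (co X p) (co Y p) k"
proof -
  \<comment> \<open>Product rule for \<open>Z'\<close> expanded in the frame: one sum differentiates
    its components, the other its frame fields.\<close>
  have half: "Z p (\<lambda>q. Z' q f) = (\<Sum>i<n. der Z p (co Z') i * F i p f) +
      (\<Sum>i<n. \<Sum>j<n. co Z p i * co Z' p j * F i p (\<lambda>q. F j q f))"
    if Z: "Z \<in> vfields M" and Z': "Z' \<in> vfields M" and f: "f \<in> smooth_funs M" for Z Z' f
  proof -
    note v = vfieldsD(1)[OF Z p]
    have Ff: "(\<lambda>q. F i q f) \<in> smooth_funs M" if "i < n" for i using vfieldsD(3)[OF frame_vfields[OF that] f] .
    have "Z p (\<lambda>q. Z' q f) = Z p (\<lambda>q. \<Sum>i<n. co Z' q i * F i q f)"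
      by (rule tspace_cong[OF v p vfieldsD(3)[OF Z' f] vfield_apply[OF Z']])
    also have "\<dots> = (\<Sum>i<n. Z p (\<lambda>q. co Z' q i * F i q f))"
      by (rule tspace_sum[OF v]) (use smooth_funs_mult[OF co_smooth[OF Z'] Ff] in auto)
    also have "\<dots> = (\<Sum>i<n. der Z p (co Z') i * F i p f + co Z' p i * Z p (\<lambda>q. F i q f))"
      by (rule sum.cong[OF refl]) (use tspace_mult[OF v co_smooth[OF Z'] Ff] in \<open>auto simp: der_def\<close>)
    also have "\<dots> = (\<Sum>i<n. der Z p (co Z') i * F i p f) + (\<Sum>j<n. \<Sum>i<n. co Z p i * co Z' p j * F i p (\<lambda>q. F j q f))"
      by (simp add: sum.distrib vfield_apply[OF Z p] sum_distrib_left mult_ac)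
    also have "(\<Sum>j<n. \<Sum>i<n. co Z p i * co Z' p j * F i p (\<lambda>q. F j q f)) =
        (\<Sum>i<n. \<Sum>j<n. co Z p i * co Z' p j * F i p (\<lambda>q. F j q f))" by (rule sum.swap)
    finally show ?thesis .
  qed
  have "lie_bracket X Y p = (\<lambda>f. \<Sum>k<n. (der X p (co Y) k - der Y p (co X) k + bil n c (co X p) (co Y p) k) * F k p f)"
  proof
    fix f
    show "lie_bracket X Y p f = (\<Sum>k<n. (der X p (co Y) k - der Y p (co X) k + bil n c (co X p) (co Y p) k) * F k p f)"
    proof (cases "f \<in> smooth_funs M")
      case False
      \<comment> \<open>Off the algebra of smooth functions both sides are zero by the convention
        for tangent vectors.\<close>
      then have "F k p f = 0" if "k < n" for k using vfield_nonsmooth[OF frame_vfields[OF that]] by simp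
      then show ?thesis
        using vfield_nonsmooth[OF lie_bracket_closed[OF X Y] False] by simp
    next
      case f: True
      let ?D = "\<lambda>i j. F i p (\<lambda>q. F j q f)"
      have "(\<Sum>i<n. \<Sum>j<n. co X p i * co Y p j * ?D i j) - (\<Sum>i<n. \<Sum>j<n. co Y p i * co X p j * ?D i j)
        = (\<Sum>i<n. \<Sum>j<n. co X p i * co Y p j * ?D i j) - (\<Sum>j<n. \<Sum>i<n. co Y p i * co X p j * ?D i j)"
        by (subst (2) sum.swap) simp
      also have "\<dots> = (\<Sum>i<n. \<Sum>j<n. co X p i * co Y p j * (?D i j - ?D j i))"
        by (simp add: sum_subtractf right_diff_distrib mult_ac)
      also have "\<dots> = (\<Sum>i<n. \<Sum>j<n. co X p i * co Y p j * (\<Sum>k<n. c i j k * F k p f))"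
      proof (intro sum.cong refl)
        fix i j assume "i \<in> {..<n}" "j \<in> {..<n}"
        then have "?D i j - ?D j i = (\<Sum>k<n. c i j k * F k p f)"
          using fun_cong[OF frame_bracket[OF _ _ p], of i j f] by (simp add: lie_bracket_def)
        then show "co X p i * co Y p j * (?D i j - ?D j i) = co X p i * co Y p j * (\<Sum>k<n. c i j k * F k p f)"
          by simp
      qed
      also have "\<dots> = (\<Sum>i<n. \<Sum>k<n. \<Sum>j<n. c i j k * co X p i * co Y p j * F k p f)"
      proof (rule sum.cong[OF refl])
        fix i
        have "(\<Sum>j<n. co X p i * co Y p j * (\<Sum>k<n. c i j k * F k p f)) =
            (\<Sum>j<n. \<Sum>k<n. c i j k * co X p i * co Y p j * F k p f)"
          by (simp add: sum_distrib_left mult_ac)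
        also have "\<dots> = (\<Sum>k<n. \<Sum>j<n. c i j k * co X p i * co Y p j * F k p f)" by (rule sum.swap)
        finally show "(\<Sum>j<n. co X p i * co Y p j * (\<Sum>k<n. c i j k * F k p f)) =
            (\<Sum>k<n. \<Sum>j<n. c i j k * co X p i * co Y p j * F k p f)" .
      qed
      also have "\<dots> = (\<Sum>k<n. bil n c (co X p) (co Y p) k * F k p f)"
        by (subst sum.swap) (simp add: bil_def sum_distrib_right)
      finally show ?thesis
        unfolding lie_bracket_def half[OF X Y f] half[OF Y X f]
        by (simp add: sum.distrib sum_subtractf left_diff_distrib distrib_right)
    qed
  qed
  then show ?thesis unfolding co_def[of "lie_bracket X Y"] using coframe_comb[OF k p] by simp
qed

subsection \<open>Connections with constant coefficients\<close>

text \<open>The connection for which the derivative of \<open>F j\<close> along \<open>F i\<close>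
  has components \<open>\<Gamma> i j k\<close>.\<close>

definition conn :: "(nat \<Rightarrow> nat \<Rightarrow> nat \<Rightarrow> real) \<Rightarrow> 'a conn" where
  "conn \<Gamma> X Y = vf (\<lambda>p k. der X p (co Y) k + bil n \<Gamma> (co X p) (co Y p) k)"

lemma der_co_smooth: "X \<in> vfields M \<Longrightarrow> Y \<in> vfields M \<Longrightarrow> k < n \<Longrightarrow> (\<lambda>p. der X p (co Y) k) \<in> smooth_funs M"
  unfolding der_def by (rule vfieldsD(3)[OF _ co_smooth])

lemma conn_closed:
  assumes X: "X \<in> vfields M" and Y: "Y \<in> vfields M"
  shows "conn \<Gamma> X Y \<in> vfields M"
  unfolding conn_def
proof (rule vf_closed)
  fix k assume "k < n"
  then show "(\<lambda>p. der X p (co Y) k + bil n \<Gamma> (co X p) (co Y p) k) \<in> smooth_funs M"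
    by (intro smooth_funs_add[OF der_co_smooth[OF X Y] bil_smooth[OF co_smooth[OF X] co_smooth[OF Y]]])
qed

lemma co_conn:
  "p \<in> mpoints M \<Longrightarrow> k < n \<Longrightarrow> co (conn \<Gamma> X Y) p k = der X p (co Y) k + bil n \<Gamma> (co X p) (co Y p) k"
  unfolding conn_def by (rule co_vf)

lemma der_vf_add: "der (vf_add X Y) p a k = der X p a k + der Y p a k"
  by (simp add: der_def vf_add_def)

lemma der_vf_scale: "der (vf_scale u X) p a k = u p * der X p a k"
  by (simp add: der_def vf_scale_def)

lemma connection_conn: "connection M (conn \<Gamma>)"
  unfolding connection_def
proof (intro ballI conjI)
  fix X Y Z u assume X: "X \<in> vfields M" and Y: "Y \<in> vfields M" and Z: "Z \<in> vfields M" and u: "u \<in> smooth_funs M"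
  note cl = conn_closed vf_add_closed vf_scale_closed X Y Z u
  show "conn \<Gamma> X Y \<in> vfields M" by (intro cl)
  show "conn \<Gamma> (vf_add X Y) Z = vf_add (conn \<Gamma> X Z) (conn \<Gamma> Y Z)"
  proof (rule vfields_eqI)
    fix p k assume p: "p \<in> mpoints M" "k < n"
    have "bil n \<Gamma> (co (vf_add X Y) p) (co Z p) k = bil n \<Gamma> (\<lambda>i. co X p i + co Y p i) (co Z p) k"
      by (rule bil_cong) (simp_all add: co_lincomb X Y p)
    then show "co (conn \<Gamma> (vf_add X Y) Z) p k = co (vf_add (conn \<Gamma> X Z) (conn \<Gamma> Y Z)) p k"
      by (simp add: co_lincomb cl p co_conn der_vf_add bil_add)
  qed (intro cl)+
  show "conn \<Gamma> (vf_scale u X) Y = vf_scale u (conn \<Gamma> X Y)"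
  proof (rule vfields_eqI)
    fix p k assume p: "p \<in> mpoints M" "k < n"
    have "bil n \<Gamma> (co (vf_scale u X) p) (co Y p) k = bil n \<Gamma> (\<lambda>i. u p * co X p i) (co Y p) k"
      by (rule bil_cong) (simp_all add: co_lincomb[OF X X] p)
    then show "co (conn \<Gamma> (vf_scale u X) Y) p k = co (vf_scale u (conn \<Gamma> X Y)) p k"
      by (simp add: co_lincomb(3)[OF conn_closed[OF X Y] conn_closed[OF X Y]] p co_conn der_vf_scale bil_scale algebra_simps)
  qed (intro cl)+
  show "conn \<Gamma> X (vf_add Y Z) = vf_add (conn \<Gamma> X Y) (conn \<Gamma> X Z)"
  proof (rule vfields_eqI)
    fix p k assume p: "p \<in> mpoints M" "k < n"
    have "bil n \<Gamma> (co X p) (co (vf_add Y Z) p) k = bil n \<Gamma> (co X p) (\<lambda>i. co Y p i + co Z p i) k"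
      by (rule bil_cong) (simp_all add: co_lincomb Y Z p)
    moreover have "der X p (co (vf_add Y Z)) k = der X p (\<lambda>q i. co Y q i + co Z q i) k"
      by (rule der_cong[OF X p(1) co_smooth]) (simp_all add: co_lincomb cl p)
    ultimately show "co (conn \<Gamma> X (vf_add Y Z)) p k = co (vf_add (conn \<Gamma> X Y) (conn \<Gamma> X Z)) p k"
      by (simp add: co_lincomb cl p co_conn der_add co_smooth bil_add)
  qed (intro cl)+
  have dsc: "vf_scale (\<lambda>p. X p u) Y \<in> vfields M" by (intro vf_scale_closed Y vfieldsD(3)[OF X u])
  show "conn \<Gamma> X (vf_scale u Y) = vf_add (vf_scale (\<lambda>p. X p u) Y) (vf_scale u (conn \<Gamma> X Y))"
  proof (rule vfields_eqI)
    fix p k assume p: "p \<in> mpoints M" "k < n"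
    have "bil n \<Gamma> (co X p) (co (vf_scale u Y) p) k = bil n \<Gamma> (co X p) (\<lambda>i. u p * co Y p i) k"
      by (rule bil_cong) (simp_all add: co_lincomb[OF Y Y] p)
    moreover have "der X p (co (vf_scale u Y)) k = der X p (\<lambda>q i. u q * co Y q i) k"
      by (rule der_cong[OF X p(1) co_smooth]) (simp_all add: co_lincomb[OF Y Y] cl p)
    moreover have "der X p (\<lambda>q i. u q * co Y q i) k = X p u * co Y p k + u p * der X p (co Y) k"
      unfolding der_def by (rule tspace_mult[OF vfieldsD(1)[OF X p(1)] u co_smooth[OF Y p(2)]])
    ultimately show "co (conn \<Gamma> X (vf_scale u Y)) p k = co (vf_add (vf_scale (\<lambda>p. X p u) Y) (vf_scale u (conn \<Gamma> X Y))) p k"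
      by (simp add: co_lincomb(1)[OF dsc vf_scale_closed[OF conn_closed[OF X Y] u]] co_lincomb(3)[OF Y Y]
          co_lincomb(3)[OF conn_closed[OF X Y] conn_closed[OF X Y]] p co_conn bil_scale algebra_simps)
  qed (intro cl dsc)+
qed

subsection \<open>The metric for which the frame is orthonormal\<close>

definition frame_metric :: "'a metric" where
  "frame_metric p v w = (\<Sum>i<n. \<theta> i p v * \<theta> i p w)"

lemma frame_metric_co: "frame_metric p (X p) (Y p) = (\<Sum>i<n. co X p i * co Y p i)"
  by (simp add: frame_metric_def co_def)

lemma riemannian_frame_metric: "riemannian_metric M frame_metric"
  unfolding riemannian_metric_def
proof (intro conjI ballI impI)
  fix p v w assume p: "p \<in> mpoints M" and v: "v \<in> tspace M p" and w: "w \<in> tspace M p"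
  show "tlinear M p (\<lambda>u. frame_metric p u w)"
    unfolding tlinear_def
  proof (intro ballI allI)
    fix v' w' a b assume "v' \<in> tspace M p" "w' \<in> tspace M p"
    then have "frame_metric p (\<lambda>f. a * v' f + b * w' f) w = (\<Sum>i<n. (a * \<theta> i p v' + b * \<theta> i p w') * \<theta> i p w)"
      unfolding frame_metric_def by (intro sum.cong refl) (simp add: coframe_lin p)
    then show "frame_metric p (\<lambda>f. a * v' f + b * w' f) w = a * frame_metric p v' w + b * frame_metric p w' w"
      by (simp add: frame_metric_def algebra_simps sum.distrib sum_distrib_left)
  qed
  show "frame_metric p v w = frame_metric p w v" by (simp add: frame_metric_def mult.commute)
  assume "v \<noteq> (\<lambda>f. 0)"
  have "\<exists>i<n. \<theta> i p v \<noteq> 0"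
  proof (rule ccontr)
    assume "\<not> (\<exists>i<n. \<theta> i p v \<noteq> 0)"
    then have "v = (\<lambda>f. 0)" by (subst frame_expansion[OF p v]) simp
    then show False using \<open>v \<noteq> (\<lambda>f. 0)\<close> by simp
  qed
  then obtain i where i: "i < n" "\<theta> i p v \<noteq> 0" by blast
  have "0 < \<theta> i p v * \<theta> i p v" using i(2) not_real_square_gt_zero by blast
  also have "\<dots> \<le> frame_metric p v v"
    unfolding frame_metric_def by (rule member_le_sum) (use i in auto)
  finally show "0 < frame_metric p v v" .
next
  fix X Y assume "X \<in> vfields M" "Y \<in> vfields M"
  then show "(\<lambda>p. frame_metric p (X p) (Y p)) \<in> smooth_funs M"
    unfolding frame_metric_co by (intro smooth_funs_sum smooth_funs_mult co_smooth) auto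
qed

text \<open>The frame has constant inner products, so compatibility says that
  \<open>\<Gamma> i\<close> is a skew matrix for each \<open>i\<close>; the components themselves
  obey the product rule.\<close>

lemma metric_connection_conn:
  assumes anti: "\<And>i j k. i < n \<Longrightarrow> j < n \<Longrightarrow> k < n \<Longrightarrow> \<Gamma> i j k = - \<Gamma> i k j"
  shows "metric_connection M frame_metric (conn \<Gamma>)"
  unfolding metric_connection_def
proof (intro conjI connection_conn ballI)
  fix X Y Z p assume X: "X \<in> vfields M" and Y: "Y \<in> vfields M" and Z: "Z \<in> vfields M" and p: "p \<in> mpoints M"
  note v = vfieldsD(1)[OF X p]
  have "X p (\<lambda>q. frame_metric q (Y q) (Z q)) = (\<Sum>k<n. X p (\<lambda>q. co Y q k * co Z q k))"
    unfolding frame_metric_co by (rule tspace_sum[OF v]) (use smooth_funs_mult co_smooth Y Z in auto)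
  also have "\<dots> = (\<Sum>k<n. der X p (co Y) k * co Z p k + co Y p k * der X p (co Z) k)"
    by (rule sum.cong[OF refl]) (use tspace_mult[OF v co_smooth[OF Y] co_smooth[OF Z]] in \<open>auto simp: der_def\<close>)
  \<comment> \<open>Adds a zero: the two new terms cancel by antisymmetry of \<open>\<Gamma>\<close>
    in its last two indices.\<close>
  also have "\<dots> = (\<Sum>k<n. der X p (co Y) k * co Z p k + co Y p k * der X p (co Z) k)
      + (tri n \<Gamma> (co X p) (co Y p) (co Z p) + tri n \<Gamma> (co X p) (co Z p) (co Y p))"
    using tri_antisym23[of n \<Gamma> "co X p" "co Y p" "co Z p", OF anti] by linarith
  also have "\<dots> = (\<Sum>k<n. (der X p (co Y) k + bil n \<Gamma> (co X p) (co Y p) k) * co Z p k)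
      + (\<Sum>k<n. co Y p k * (der X p (co Z) k + bil n \<Gamma> (co X p) (co Z p) k))"
    by (simp add: tri_eq_bil sum.distrib algebra_simps)
  also have "\<dots> = frame_metric p (conn \<Gamma> X Y p) (Z p) + frame_metric p (Y p) (conn \<Gamma> X Z p)"
    unfolding frame_metric_co by (simp add: co_conn p)
  finally show "X p (\<lambda>q. frame_metric q (Y q) (Z q)) =
    frame_metric p (conn \<Gamma> X Y p) (Z p) + frame_metric p (Y p) (conn \<Gamma> X Z p)" .
qed

text \<open>The Koszul formula in an orthonormal frame: derivatives of inner products drop out and
  three bracket terms remain.\<close>

definition lc_coeff :: "nat \<Rightarrow> nat \<Rightarrow> nat \<Rightarrow> real" where
  "lc_coeff i j k = (c i j k - c j k i + c k i j) / 2"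

lemma levi_civita_conn:
  assumes c_anti: "\<And>i j k. i < n \<Longrightarrow> j < n \<Longrightarrow> k < n \<Longrightarrow> c i j k = - c j i k"
  shows "levi_civita M frame_metric (conn lc_coeff)"
  unfolding levi_civita_def
proof (intro conjI ballI)
  show "metric_connection M frame_metric (conn lc_coeff)"
  proof (rule metric_connection_conn)
    fix i j k assume ijk: "i < n" "j < n" "k < n"
    show "lc_coeff i j k = - lc_coeff i k j"
      using c_anti[OF ijk] c_anti[OF ijk(2,3,1)] c_anti[OF ijk(3,1,2)] by (simp add: lc_coeff_def field_simps)
  qed
next
  fix X Y assume X: "X \<in> vfields M" and Y: "Y \<in> vfields M"
  show "vf_diff (conn lc_coeff X Y) (conn lc_coeff Y X) = lie_bracket X Y"
  proof (rule vfields_eqI)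
    fix p k assume p: "p \<in> mpoints M" "k < n"
    have "bil n lc_coeff (co X p) (co Y p) k - bil n lc_coeff (co Y p) (co X p) k = bil n c (co X p) (co Y p) k"
      unfolding bil_swap[of n lc_coeff "co Y p"] unfolding bil_def sum_subtractf[symmetric]
    proof (intro sum.cong refl)
      fix i j assume "i \<in> {..<n}" "j \<in> {..<n}"
      then have "c i j k = - c j i k" "c j k i = - c k j i" "c k i j = - c i k j"
        using c_anti[of i j k] c_anti[of j k i] c_anti[of k i j] p(2) by blast+
      then have "lc_coeff i j k - lc_coeff j i k = c i j k"
        unfolding lc_coeff_def by (simp add: field_simps)
      then have "(lc_coeff i j k - lc_coeff j i k) * (co X p i * co Y p j) = c i j k * (co X p i * co Y p j)"
        by simp
      then show "lc_coeff i j k * co X p i * co Y p j - lc_coeff j i k * co X p i * co Y p j = c i j k * co X p i * co Y p j"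
        by (simp only: left_diff_distrib mult.assoc)
    qed
    then show "co (vf_diff (conn lc_coeff X Y) (conn lc_coeff Y X)) p k = co (lie_bracket X Y) p k"
      by (simp add: co_lincomb conn_closed X Y p co_conn co_lie_bracket)
  qed (intro vf_diff_closed conn_closed lie_bracket_closed X Y)+
qed

subsection \<open>Three-forms with constant coefficients\<close>

definition frame_form :: "(nat \<Rightarrow> nat \<Rightarrow> nat \<Rightarrow> real) \<Rightarrow> 'a threeform" where
  "frame_form h p u v w = tri n h (\<lambda>i. \<theta> i p u) (\<lambda>i. \<theta> i p v) (\<lambda>i. \<theta> i p w)"

lemma frame_form_co: "frame_form h p (X p) (Y p) (Z p) = tri n h (co X p) (co Y p) (co Z p)"
  by (simp add: frame_form_def co_def[abs_def])

lemma three_form_frame_form: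
  assumes h12: "\<And>i j k. i < n \<Longrightarrow> j < n \<Longrightarrow> k < n \<Longrightarrow> h i j k = - h j i k"
    and h23: "\<And>i j k. i < n \<Longrightarrow> j < n \<Longrightarrow> k < n \<Longrightarrow> h i j k = - h i k j"
  shows "three_form M (frame_form h)"
  unfolding three_form_def
proof (intro conjI ballI)
  fix p u v w assume p: "p \<in> mpoints M"
  show "frame_form h p u v w = - frame_form h p v u w" "frame_form h p u v w = - frame_form h p u w v"
    unfolding frame_form_def using tri_antisym12[of n h, OF h12] tri_antisym23[of n h, OF h23] by blast+
  show "tlinear M p (\<lambda>z. frame_form h p z v w)"
    unfolding tlinear_def
  proof (intro ballI allI)
    fix v' w' a b assume "v' \<in> tspace M p" "w' \<in> tspace M p"
    then have "frame_form h p (\<lambda>f. a * v' f + b * w' f) v w =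
        tri n h (\<lambda>i. a * \<theta> i p v' + b * \<theta> i p w') (\<lambda>i. \<theta> i p v) (\<lambda>i. \<theta> i p w)"
      unfolding frame_form_def by (intro tri_cong) (simp_all add: coframe_lin p)
    then show "frame_form h p (\<lambda>f. a * v' f + b * w' f) v w = a * frame_form h p v' v w + b * frame_form h p w' v w"
      by (simp add: tri_lin1 frame_form_def)
  qed
next
  fix X Y Z assume "X \<in> vfields M" "Y \<in> vfields M" "Z \<in> vfields M"
  then show "(\<lambda>p. frame_form h p (X p) (Y p) (Z p)) \<in> smooth_funs M"
    unfolding frame_form_co by (intro tri_smooth co_smooth)
qed

text \<open>Terms containing derivatives of components cancel. What is left is the
  Chevalley-Eilenberg differential of \<open>h\<close>, of which \<open>closed\<close> is the
  negative on four frame vectors.\<close>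

lemma closed_frame_form:
  assumes h12: "\<And>i j k. i < n \<Longrightarrow> j < n \<Longrightarrow> k < n \<Longrightarrow> h i j k = - h j i k"
    and h23: "\<And>i j k. i < n \<Longrightarrow> j < n \<Longrightarrow> k < n \<Longrightarrow> h i j k = - h i k j"
    and closed: "\<And>i j k l. i < n \<Longrightarrow> j < n \<Longrightarrow> k < n \<Longrightarrow> l < n \<Longrightarrow>
      (\<Sum>m<n. c i j m * h m k l) - (\<Sum>m<n. c i k m * h m j l) + (\<Sum>m<n. c i l m * h m j k)
      + (\<Sum>m<n. c j k m * h m i l) - (\<Sum>m<n. c j l m * h m i k) + (\<Sum>m<n. c k l m * h m i j) = 0"
  shows "closed_three_form M (frame_form h)"
  unfolding closed_three_form_def
proof (intro conjI ballI three_form_frame_form[OF h12 h23])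
  fix W X Y Z p assume W: "W \<in> vfields M" and X: "X \<in> vfields M" and Y: "Y \<in> vfields M" and Z: "Z \<in> vfields M"
    and p: "p \<in> mpoints M"
  define w x y z where "w = co W p" and "x = co X p" and "y = co Y p" and "z = co Z p"
  let ?t = "tri n h"
  define Q where "Q i j k l = (\<Sum>m<n. c i j m * h m k l)" for i j k l
  note anti = tri_antisym12[of n h, OF h12] tri_antisym23[of n h, OF h23]
  have d: "A p (\<lambda>q. ?t (co B q) (co C q) (co E q)) =
      ?t (der A p (co B)) (co C p) (co E p) + ?t (co B p) (der A p (co C)) (co E p) + ?t (co B p) (co C p) (der A p (co E))"
    if "A \<in> vfields M" "B \<in> vfields M" "C \<in> vfields M" "E \<in> vfields M" for A B C E
    by (rule der_tri[OF that(1) p co_smooth[OF that(2)] co_smooth[OF that(3)] co_smooth[OF that(4)]])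
  have br: "?t (co (lie_bracket A B) p) a b = ?t (der A p (co B)) a b - ?t (der B p (co A)) a b + ?t (bil n c (co A p) (co B p)) a b"
    if "A \<in> vfields M" "B \<in> vfields M" for A B a b
    unfolding tri_add_diff[symmetric] by (rule tri_cong) (simp_all add: co_lie_bracket that p)
  \<comment> \<open>The differentiated field is moved into the first slot, one sign per
    transposition, so that product rule terms and bracket terms can be matched.\<close>
  have rot1: "?t a (der A p (co B)) b = - ?t (der A p (co B)) a b" for a b A B
    by (rule anti(1))
  have rot2: "?t a b (der A p (co B)) = ?t (der A p (co B)) a b" for a b A B
    using anti(2)[of a b "der A p (co B)"] anti(1)[of a "der A p (co B)" b] by linarith
  have sgn: "?t (der A p (co B)) a b = - ?t (der A p (co B)) b a" for a b A B
    by (rule anti(2))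
  have Qs: "?t (bil n c a b) u v = quad n Q a b u v" for a b u v
    unfolding tri_bil Q_def ..
  \<comment> \<open>All six contractions are read as four-fold forms in the same order
    \<open>w x y z\<close>, so that they can be added coefficientwise.\<close>
  have q: "?t (bil n c w x) y z = quad n Q w x y z"
    "?t (bil n c w y) x z = quad n (\<lambda>i j k l. Q i k j l) w x y z"
    "?t (bil n c w z) x y = quad n (\<lambda>i j k l. Q i l j k) w x y z"
    "?t (bil n c x y) w z = quad n (\<lambda>i j k l. Q j k i l) w x y z"
    "?t (bil n c x z) w y = quad n (\<lambda>i j k l. Q j l i k) w x y z"
    "?t (bil n c y z) w x = quad n (\<lambda>i j k l. Q k l i j) w x y z"
    unfolding Qs
    subgoal ..
    subgoal by (rule quad_swap23)
    subgoal by (subst quad_swap23, subst quad_swap34) simp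
    subgoal by (subst quad_swap23, subst quad_swap12) simp
    subgoal by (subst quad_swap23, subst quad_swap12, subst quad_swap34) simp
    subgoal by (subst quad_swap23, subst quad_swap12, subst quad_swap34, subst quad_swap23) simp
    done
  have "quad n (\<lambda>i j k l. Q i j k l - Q i k j l + Q i l j k + Q j k i l - Q j l i k + Q k l i j) w x y z = 0"
    by (rule quad_eq_0) (use closed in \<open>simp add: Q_def\<close>)
  then have zero: "?t (bil n c w x) y z - ?t (bil n c w y) x z + ?t (bil n c w z) x y
      + ?t (bil n c x y) w z - ?t (bil n c x z) w y + ?t (bil n c y z) w x = 0"
    unfolding q quad_add quad_diff .
  show "ext_deriv3 (frame_form h) W X Y Z p = 0"
    unfolding ext_deriv3_def Let_def frame_form_co d[OF W X Y Z] d[OF X W Y Z] d[OF Y W X Z] d[OF Z W X Y]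
      br[OF W X] br[OF W Y] br[OF W Z] br[OF X Y] br[OF X Z] br[OF Y Z]
      w_def[symmetric] x_def[symmetric] y_def[symmetric] z_def[symmetric] rot1 rot2
    using zero sgn[of W X z y] sgn[of W Y z x] sgn[of W Z y x] sgn[of X W z y] sgn[of X Y z w] sgn[of X Z y w]
      sgn[of Y W z x] sgn[of Y X z w] sgn[of Y Z x w] sgn[of Z W y x] sgn[of Z X y w] sgn[of Z Y x w]
    by linarith
qed

lemma bismut_connection_conn:
  assumes c_anti: "\<And>i j k. i < n \<Longrightarrow> j < n \<Longrightarrow> k < n \<Longrightarrow> c i j k = - c j i k"
    and h12: "\<And>i j k. i < n \<Longrightarrow> j < n \<Longrightarrow> k < n \<Longrightarrow> h i j k = - h j i k"
    and h23: "\<And>i j k. i < n \<Longrightarrow> j < n \<Longrightarrow> k < n \<Longrightarrow> h i j k = - h i k j"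
    and \<Gamma>: "\<And>i j k. i < n \<Longrightarrow> j < n \<Longrightarrow> k < n \<Longrightarrow> \<Gamma> i j k = lc_coeff i j k + h i j k / 2"
  shows "bismut_connection M frame_metric (frame_form h) (conn \<Gamma>)"
  unfolding bismut_connection_def
proof (intro conjI exI[of _ "conn lc_coeff"] levi_civita_conn c_anti ballI)
  show "metric_connection M frame_metric (conn \<Gamma>)"
  proof (rule metric_connection_conn)
    fix i j k assume ijk: "i < n" "j < n" "k < n"
    show "\<Gamma> i j k = - \<Gamma> i k j"
      using c_anti[OF ijk] c_anti[OF ijk(2,3,1)] c_anti[OF ijk(3,1,2)] h23[OF ijk]
      unfolding \<Gamma>[OF ijk] \<Gamma>[OF ijk(1,3,2)] lc_coeff_def by (simp add: field_simps)
  qed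
next
  fix X Y Z p assume X: "X \<in> vfields M" and Y: "Y \<in> vfields M" and Z: "Z \<in> vfields M" and p: "p \<in> mpoints M"
  have b: "bil n \<Gamma> (co X p) (co Y p) k = bil n lc_coeff (co X p) (co Y p) k + bil n h (co X p) (co Y p) k / 2"
    if "k < n" for k
    unfolding bil_def sum_divide_distrib sum.distrib[symmetric]
    by (intro sum.cong refl) (simp add: \<Gamma> that algebra_simps)
  show "frame_metric p (conn \<Gamma> X Y p) (Z p) = frame_metric p (conn lc_coeff X Y p) (Z p)
      + 1 / 2 * frame_form h p (X p) (Y p) (Z p)"
    unfolding frame_metric_co frame_form_co tri_eq_bil
    by (simp add: co_conn p b algebra_simps sum.distrib sum_distrib_left)
qed

subsection \<open>Curvature\<close>

text \<open>The component along \<open>F l\<close> of the curvature applied to \<open>F i\<close>,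
  \<open>F j\<close> and \<open>F k\<close>, for the connection with coefficients
  \<open>\<Gamma>\<close>.\<close>

definition curv_coeff :: "(nat \<Rightarrow> nat \<Rightarrow> nat \<Rightarrow> real) \<Rightarrow> nat \<Rightarrow> nat \<Rightarrow> nat \<Rightarrow> nat \<Rightarrow> real" where
  "curv_coeff \<Gamma> i j k l = (\<Sum>m<n. \<Gamma> j k m * \<Gamma> i m l) - (\<Sum>m<n. \<Gamma> i k m * \<Gamma> j m l) - (\<Sum>m<n. c i j m * \<Gamma> m k l)"

lemma co_curvature:
  assumes X: "X \<in> vfields M" and Y: "Y \<in> vfields M" and Z: "Z \<in> vfields M"
    and p: "p \<in> mpoints M" and l: "l < n"
  shows "co (curvature (conn \<Gamma>) X Y Z) p l = tri n (\<lambda>i j k. curv_coeff \<Gamma> i j k l) (co X p) (co Y p) (co Z p)"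
proof -
  \<comment> \<open>Of these terms, the two with one derivative of \<open>co Z\<close> are symmetric
    in \<open>A\<close> and \<open>B\<close> together and cancel in the commutator; those
    differentiating \<open>co B\<close> or \<open>co Z\<close> twice match the bracket term
    \<open>third\<close>.\<close>
  have second: "co (conn \<Gamma> A (conn \<Gamma> B Z)) p l = A p (\<lambda>q. B q (\<lambda>q. co Z q l))
      + bil n \<Gamma> (der A p (co B)) (co Z p) l + bil n \<Gamma> (co B p) (der A p (co Z)) l
      + bil n \<Gamma> (co A p) (der B p (co Z)) l + bil n \<Gamma> (co A p) (bil n \<Gamma> (co B p) (co Z p)) l"
    if A: "A \<in> vfields M" and B: "B \<in> vfields M" for A B
  proof -
    have "der A p (co (conn \<Gamma> B Z)) l = A p (\<lambda>q. der B q (co Z) l + bil n \<Gamma> (co B q) (co Z q) l)"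
      unfolding der_def[of A]
      by (rule tspace_cong[OF vfieldsD(1)[OF A p] p co_smooth[OF conn_closed[OF B Z] l] co_conn[OF _ l]])
    also have "\<dots> = A p (\<lambda>q. der B q (co Z) l) + A p (\<lambda>q. bil n \<Gamma> (co B q) (co Z q) l)"
      by (rule tspace_add[OF vfieldsD(1)[OF A p] der_co_smooth[OF B Z l] bil_smooth[OF co_smooth[OF B] co_smooth[OF Z]]])
    also have "A p (\<lambda>q. bil n \<Gamma> (co B q) (co Z q) l) = bil n \<Gamma> (der A p (co B)) (co Z p) l + bil n \<Gamma> (co B p) (der A p (co Z)) l"
      by (rule der_bil[OF A p co_smooth[OF B] co_smooth[OF Z]])
    finally have 1: "der A p (co (conn \<Gamma> B Z)) l = A p (\<lambda>q. B q (\<lambda>q. co Z q l))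
      + (bil n \<Gamma> (der A p (co B)) (co Z p) l + bil n \<Gamma> (co B p) (der A p (co Z)) l)"
      by (simp add: der_def[of B])
    have 2: "bil n \<Gamma> (co A p) (co (conn \<Gamma> B Z) p) l =
        bil n \<Gamma> (co A p) (\<lambda>k. der B p (co Z) k + bil n \<Gamma> (co B p) (co Z p) k) l"
      by (rule bil_cong) (simp_all add: co_conn p)
    show ?thesis unfolding co_conn[OF p l] 1 2 bil_add by simp
  qed
  have third: "co (conn \<Gamma> (lie_bracket X Y) Z) p l = X p (\<lambda>q. Y q (\<lambda>q. co Z q l)) - Y p (\<lambda>q. X q (\<lambda>q. co Z q l))
     + bil n \<Gamma> (der X p (co Y)) (co Z p) l - bil n \<Gamma> (der Y p (co X)) (co Z p) l + bil n \<Gamma> (bil n c (co X p) (co Y p)) (co Z p) l"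
  proof -
    have "bil n \<Gamma> (co (lie_bracket X Y) p) (co Z p) l =
      bil n \<Gamma> (\<lambda>k. (der X p (co Y) k - der Y p (co X) k) + bil n c (co X p) (co Y p) k) (co Z p) l"
      by (rule bil_cong) (simp_all add: co_lie_bracket X Y p)
    also have "\<dots> = bil n \<Gamma> (der X p (co Y)) (co Z p) l - bil n \<Gamma> (der Y p (co X)) (co Z p) l
      + bil n \<Gamma> (bil n c (co X p) (co Y p)) (co Z p) l"
      unfolding bil_add(1) bil_diff ..
    finally show ?thesis unfolding co_conn[OF p l] by (simp add: der_def lie_bracket_def)
  qed
  have "co (curvature (conn \<Gamma>) X Y Z) p l = co (conn \<Gamma> X (conn \<Gamma> Y Z)) p l - co (conn \<Gamma> Y (conn \<Gamma> X Z)) p l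
      - co (conn \<Gamma> (lie_bracket X Y) Z) p l"
    unfolding curvature_def by (simp add: co_lincomb vf_diff_closed conn_closed lie_bracket_closed X Y Z p l)
  also have "\<dots> = bil n \<Gamma> (co X p) (bil n \<Gamma> (co Y p) (co Z p)) l - bil n \<Gamma> (co Y p) (bil n \<Gamma> (co X p) (co Z p)) l
      - bil n \<Gamma> (bil n c (co X p) (co Y p)) (co Z p) l"
    unfolding second[OF X Y] second[OF Y X] third by simp
  also have "bil n \<Gamma> (co Y p) (bil n \<Gamma> (co X p) (co Z p)) l =
      tri n (\<lambda>i j k. \<Sum>m<n. \<Gamma> i k m * \<Gamma> j m l) (co X p) (co Y p) (co Z p)"
    unfolding bil_bil_right by (subst tri_swap12) simp
  finally show ?thesis
    unfolding bil_bil_right bil_bil_left tri_diff curv_coeff_def .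
qed

text \<open>The basis \<open>E\<close> is orthonormal only at \<open>p\<close> and otherwise
  arbitrary. Its component matrix has orthonormal rows, hence orthonormal columns, and this turns
  the trace over \<open>E\<close> into the trace over the frame.\<close>

lemma ricci_flat_conn:
  assumes ric: "\<And>j k. j < n \<Longrightarrow> k < n \<Longrightarrow> (\<Sum>i<n. curv_coeff \<Gamma> i j k i) = 0"
  shows "ricci_flat M frame_metric (conn \<Gamma>)"
  unfolding ricci_flat_def
proof (intro ballI allI impI)
  fix p E Y Z assume p: "p \<in> mpoints M" and E: "orthonormal_at M frame_metric p E"
    and Y: "Y \<in> vfields M" and Z: "Z \<in> vfields M"
  define a where "a j i = co (E j) p i" for j i
  define y z where "y = co Y p" and "z = co Z p"
  have Ev: "E j \<in> vfields M" if "j < n" for j using E that by (simp add: orthonormal_at_def)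
  have rows: "(\<Sum>i<n. a j i * a k i) = (if j = k then 1 else 0)" if "j < n" "k < n" for j k
    using E that unfolding orthonormal_at_def frame_metric_co a_def by blast
  define S where "S i l = (\<Sum>r<n. \<Sum>k<n. curv_coeff \<Gamma> i r k l * y r * z k)" for i l
  have tS: "tri n (\<lambda>i j k. curv_coeff \<Gamma> i j k l) x y z = (\<Sum>i<n. x i * S i l)" for x l
    by (simp add: tri_def S_def sum_distrib_left mult_ac)
  have "ricci M frame_metric (conn \<Gamma>) E Y Z p = (\<Sum>j<n. \<Sum>l<n. (\<Sum>i<n. a j i * S i l) * a j l)"
    unfolding ricci_def
  proof (rule sum.cong[OF refl])
    fix j assume "j \<in> {..<n}"
    then have j: "j < n" by simp
    have "frame_metric p (curvature (conn \<Gamma>) (E j) Y Z p) (E j p) = (\<Sum>l<n. co (curvature (conn \<Gamma>) (E j) Y Z) p l * co (E j) p l)"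
      by (rule frame_metric_co)
    also have "\<dots> = (\<Sum>l<n. (\<Sum>i<n. a j i * S i l) * a j l)"
      by (rule sum.cong[OF refl]) (simp add: co_curvature[OF Ev[OF j] Y Z p] tS a_def flip: y_def z_def)
    finally show "frame_metric p (curvature (conn \<Gamma>) (E j) Y Z p) (E j p) = (\<Sum>l<n. (\<Sum>i<n. a j i * S i l) * a j l)" .
  qed
  also have "\<dots> = (\<Sum>j<n. \<Sum>l<n. \<Sum>i<n. S i l * (a j i * a j l))"
    by (simp add: sum_distrib_left mult_ac)
  also have "\<dots> = (\<Sum>l<n. \<Sum>j<n. \<Sum>i<n. S i l * (a j i * a j l))" by (rule sum.swap)
  also have "\<dots> = (\<Sum>l<n. \<Sum>i<n. \<Sum>j<n. S i l * (a j i * a j l))"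
    by (rule sum.cong[OF refl], rule sum.swap)
  also have "\<dots> = (\<Sum>l<n. \<Sum>i<n. S i l * (if i = l then 1 else 0))"
    by (simp add: orthonormal_rows_imp_columns[OF rows] flip: sum_distrib_left)
  also have "\<dots> = (\<Sum>l<n. S l l)"
    by (simp add: if_distrib cong: if_cong)
  also have "\<dots> = (\<Sum>r<n. \<Sum>l<n. \<Sum>k<n. curv_coeff \<Gamma> l r k l * y r * z k)"
    unfolding S_def by (rule sum.swap)
  also have "\<dots> = (\<Sum>r<n. \<Sum>k<n. (\<Sum>l<n. curv_coeff \<Gamma> l r k l) * y r * z k)"
    by (rule sum.cong[OF refl], subst sum.swap) (simp add: sum_distrib_right)
  also have "\<dots> = 0" by (simp add: ric)
  finally show "ricci M frame_metric (conn \<Gamma>) E Y Z p = 0" .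
qed

lemma not_flat_conn:
  assumes ijkl: "i < n" "j < n" "k < n" "l < n" and R: "curv_coeff \<Gamma> i j k l \<noteq> 0" and p: "p \<in> mpoints M"
  shows "\<not> flat_connection M (conn \<Gamma>)"
proof
  assume flat: "flat_connection M (conn \<Gamma>)"
  have co_F: "co (F i) p j = (if j = i then 1 else 0)" if "i < n" "j < n" for i j
    using coframe_frame[OF that(2,1) p] by (simp add: co_def)
  have "co (curvature (conn \<Gamma>) (F i) (F j) (F k)) p l =
      tri n (\<lambda>i j k. curv_coeff \<Gamma> i j k l) (co (F i) p) (co (F j) p) (co (F k) p)"
    by (rule co_curvature) (use ijkl p frame_vfields in auto)
  also have "\<dots> = tri n (\<lambda>i j k. curv_coeff \<Gamma> i j k l) (\<lambda>m. if m = i then 1 else 0)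
      (\<lambda>m. if m = j then 1 else 0) (\<lambda>m. if m = k then 1 else 0)"
    by (rule tri_cong) (simp_all add: co_F ijkl)
  also have "\<dots> = curv_coeff \<Gamma> i j k l"
    by (rule tri_unit[OF ijkl(1,2,3)])
  finally have "co (curvature (conn \<Gamma>) (F i) (F j) (F k)) p l \<noteq> 0" using R by simp
  moreover have "curvature (conn \<Gamma>) (F i) (F j) (F k) = (\<lambda>p f. 0)"
    using flat frame_vfields ijkl unfolding flat_connection_def by blast
  moreover have "\<theta> l p (\<lambda>f. 0) = 0" using coframe_comb[OF ijkl(4) p, of "\<lambda>_. 0"] by simp
  ultimately show False by (simp add: co_def)
qed

end

section \<open>The structure constants\<close>

text \<open>Block \<open>i = 0, 1, 2\<close> of the frame is spanned by \<open>(e\<^sub>0 - e\<^sub>1) / 2\<close>, \<open>(e\<^sub>0 + e\<^sub>1) / 2 + e\<^sub>2\<close> and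
  \<open>(e\<^sub>0 + e\<^sub>1) / 2\<close>, where \<open>e\<^sub>l\<close> is the \<open>l\<close>-th quaternion factor; the remaining blocks are \<open>e\<^sub>i / 2\<close>.
  All structure constants are products of \<open>eps\<close> and an array on the blocks.\<close>

definition eps :: "nat \<Rightarrow> nat \<Rightarrow> nat \<Rightarrow> real" where
  "eps a b c = (if a < 3 \<and> b < 3 \<and> c < 3 then
     [[[0, 0, 0], [0, 0, 1], [0, -1, 0]],
      [[0, 0, -1], [0, 0, 0], [1, 0, 0]],
      [[0, 1, 0], [-1, 0, 0], [0, 0, 0]]] ! a ! b ! c else 0)"

definition mix :: "nat \<Rightarrow> nat \<Rightarrow> real" where
  "mix i l = (if i = 0 then (if l = 0 then 1/2 else if l = 1 then -1/2 else 0)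
     else if i = 1 then (if l = 0 \<or> l = 1 then 1/2 else if l = 2 then 1 else 0)
     else if i = 2 then (if l = 0 \<or> l = 1 then 1/2 else 0)
     else if l = i then 1/2 else 0)"

text \<open>The inverse transpose of \<open>mix\<close>: its rows give the coframe dual to the new
  frame.\<close>

definition comix :: "nat \<Rightarrow> nat \<Rightarrow> real" where
  "comix i l = (if i = 0 then (if l = 0 then 1 else if l = 1 then -1 else 0)
     else if i = 1 then (if l = 2 then 1 else 0)
     else if i = 2 then (if l = 0 \<or> l = 1 then 1 else if l = 2 then -1 else 0)
     else if l = i then 2 else 0)"

text \<open>The multiplication table of the blocks: twice the componentwise product of rows
  \<open>i\<close> and \<open>j\<close> of \<open>mix\<close>, expanded in the rows of
  \<open>mix\<close>. Only the square of block 1, which is 2t - r, has two terms.\<close>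

definition kap :: "nat \<Rightarrow> nat \<Rightarrow> nat \<Rightarrow> real" where
  "kap i j k = (if i < 3 \<and> j < 3 \<and> k < 3 then
     [[[0, 0, 1], [1, 0, 0], [1, 0, 0]],
      [[1, 0, 0], [0, 2, -1], [0, 0, 1]],
      [[1, 0, 0], [0, 0, 1], [0, 0, 1]]] ! i ! j ! k
     else if i = j \<and> j = k then 1 else 0)"

text \<open>The value -1 on a further block is the sign for which \<open>gam\<close> vanishes there,
  so that left-invariant fields of that factor are parallel.\<close>

definition eta :: "nat \<Rightarrow> nat \<Rightarrow> nat \<Rightarrow> real" where
  "eta i j k = (if i < 3 \<and> j < 3 \<and> k < 3 then
     [[[0, 0, 1], [0, 0, 0], [1, 0, 0]],
      [[0, 0, 0], [0, 0, 1], [0, 1, 0]],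
      [[1, 0, 0], [0, 1, 0], [0, 0, 1]]] ! i ! j ! k
     else if i = j \<and> j = k then -1 else 0)"

definition gam :: "nat \<Rightarrow> nat \<Rightarrow> nat \<Rightarrow> real" where
  "gam i j k = (if i < 3 \<and> j < 3 \<and> k < 3 then
     [[[0, 0, 1], [0, 0, 0], [1, 0, 0]],
      [[1, 0, 0], [0, 1, 0], [0, 0, 1]],
      [[1, 0, 0], [0, 1, 0], [0, 0, 1]]] ! i ! j ! k else 0)"

lemma less_3_cases: "(i :: nat) < 3 \<Longrightarrow> i = 0 \<or> i = 1 \<or> i = 2"
  by arith

lemma sum_three:
  assumes "3 \<le> N" "\<And>l. l \<ge> 3 \<Longrightarrow> f l = 0"
  shows "(\<Sum>l<N. f l) = f 0 + f 1 + (f (2 :: nat) :: real)"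
proof -
  have "(\<Sum>l<N. f l) = (\<Sum>l\<in>{0, 1, 2}. f l)"
    by (rule sum.mono_neutral_right) (use assms less_3_cases in \<open>auto simp: not_less[symmetric]\<close>)
  then show ?thesis by simp
qed

lemma sum_single:
  assumes "a < N" "\<And>l. l \<noteq> a \<Longrightarrow> f l = 0"
  shows "(\<Sum>l<N. f l) = (f (a :: nat) :: real)"
proof -
  have "(\<Sum>l<N. f l) = (\<Sum>l\<in>{a}. f l)"
    by (rule sum.mono_neutral_right) (use assms in auto)
  then show ?thesis by simp
qed

lemma eps_antisym: "eps a b c = - eps b a c" "eps a b c = - eps a c b"
proof -
  have "eps a b c = - eps b a c \<and> eps a b c = - eps a c b"
  proof (cases "a < 3 \<and> b < 3 \<and> c < 3")
    case True
    then have "a < 3" "b < 3" "c < 3" by blast+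
    from this[THEN less_3_cases] show ?thesis
      by (elim disjE; simp add: eps_def)
  next
    case False
    then have "\<not> (b < 3 \<and> a < 3 \<and> c < 3)" "\<not> (a < 3 \<and> c < 3 \<and> b < 3)" by blast+
    with False show ?thesis unfolding eps_def by (simp only: if_False) simp
  qed
  then show "eps a b c = - eps b a c" "eps a b c = - eps a c b" by blast+
qed

lemma eps_cyc: "eps b c a = eps a b c"
  using eps_antisym(2)[of b c a] eps_antisym(1)[of b a c] by linarith

text \<open>The inner product of [u_a, u_b] with [u_c, u_d] in so(3), equivalently the component
  along u_d of [[u_a, u_b], u_c].\<close>

definition eps2 :: "nat \<Rightarrow> nat \<Rightarrow> nat \<Rightarrow> nat \<Rightarrow> real" where
  "eps2 a b c d = eps a b 0 * eps 0 c d + eps a b 1 * eps 1 c d + eps a b 2 * eps 2 c d"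

lemma eps2_sym: "eps2 c d a b = eps2 a b c d"
  unfolding eps2_def eps_cyc[of c d] eps_cyc[of a b] by (simp add: mult.commute)

text \<open>The Jacobi identity of so(3) paired with a fourth vector, checked on all 81 index
  tuples.\<close>

lemma eps2_jacobi: "a < 3 \<Longrightarrow> b < 3 \<Longrightarrow> c < 3 \<Longrightarrow> d < 3 \<Longrightarrow> eps2 a b c d - eps2 a c b d + eps2 a d b c = 0"
  by (drule less_3_cases)+ (elim disjE; simp add: eps2_def eps_def)

lemma kap_large: "\<not> (i < 3 \<and> j < 3 \<and> k < 3) \<Longrightarrow> kap i j k = (if i = j \<and> j = k then 1 else 0)"
  unfolding kap_def by (simp only: if_False)

lemma eta_large: "\<not> (i < 3 \<and> j < 3 \<and> k < 3) \<Longrightarrow> eta i j k = (if i = j \<and> j = k then -1 else 0)"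
  unfolding eta_def by (simp only: if_False)

lemma gam_large: "\<not> (i < 3 \<and> j < 3 \<and> k < 3) \<Longrightarrow> gam i j k = 0"
  unfolding gam_def by (simp only: if_False)

lemma kap_eta_sym: "kap i j k = kap j i k" "eta i j k = eta j i k" "eta i j k = eta i k j"
proof -
  have "kap i j k = kap j i k \<and> eta i j k = eta j i k \<and> eta i j k = eta i k j"
  proof (cases "i < 3 \<and> j < 3 \<and> k < 3")
    case True
    then have "i < 3" "j < 3" "k < 3" by blast+
    from this[THEN less_3_cases] show ?thesis
      by (elim disjE; simp add: kap_def eta_def)
  next
    case False
    then have "\<not> (j < 3 \<and> i < 3 \<and> k < 3)" "\<not> (i < 3 \<and> k < 3 \<and> j < 3)" by blast+
    with False show ?thesis by (auto simp: kap_large eta_large)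
  qed
  then show "kap i j k = kap j i k" "eta i j k = eta j i k" "eta i j k = eta i k j" by blast+
qed

lemma mix_large: "i \<ge> 3 \<Longrightarrow> mix i l = (if l = i then 1/2 else 0)" "l \<ge> 3 \<Longrightarrow> mix i l = (if l = i then 1/2 else 0)"
  by (auto simp: mix_def)

lemma comix_large: "i \<ge> 3 \<Longrightarrow> comix i l = (if l = i then 2 else 0)" "l \<ge> 3 \<Longrightarrow> comix i l = (if l = i then 2 else 0)"
  by (auto simp: comix_def)

lemma comix_mix:
  assumes N: "3 \<le> N" and i: "i < N" and j: "j < N"
  shows "(\<Sum>l<N. comix i l * mix j l) = (if i = j then 1 else 0)"
proof (cases "i < 3")
  case i3: True
  have "(\<Sum>l<N. comix i l * mix j l) = comix i 0 * mix j 0 + comix i 1 * mix j 1 + comix i 2 * mix j 2"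
    by (rule sum_three[OF N]) (use i3 in \<open>simp add: comix_large\<close>)
  also have "\<dots> = (if i = j then 1 else 0)"
  proof (cases "j < 3")
    case True
    then show ?thesis using less_3_cases[OF i3] less_3_cases[OF True]
      by (elim disjE; simp add: comix_def mix_def)
  qed (use i3 in \<open>auto simp: mix_large\<close>)
  finally show ?thesis .
next
  case False
  have "(\<Sum>l<N. comix i l * mix j l) = comix i i * mix j i"
    by (rule sum_single[OF i]) (use False in \<open>simp add: comix_large\<close>)
  then show ?thesis using False by (simp add: comix_large mix_large)
qed

lemma mix_comix:
  assumes N: "3 \<le> N" and k: "k < N" and l: "l < N"
  shows "(\<Sum>i<N. comix i k * mix i l) = (if k = l then 1 else 0)"
proof (cases "k < 3")
  case k3: True
  have "(\<Sum>i<N. comix i k * mix i l) = comix 0 k * mix 0 l + comix 1 k * mix 1 l + comix 2 k * mix 2 l"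
    by (rule sum_three[OF N]) (use k3 in \<open>simp add: comix_large\<close>)
  also have "\<dots> = (if k = l then 1 else 0)"
  proof (cases "l < 3")
    case True
    then show ?thesis using less_3_cases[OF k3] less_3_cases[OF True]
      by (elim disjE; simp add: comix_def mix_def)
  qed (use k3 in \<open>auto simp: mix_large\<close>)
  finally show ?thesis .
next
  case False
  have "(\<Sum>i<N. comix i k * mix i l) = comix k k * mix k l"
    by (rule sum_single[OF k]) (use False in \<open>simp add: comix_large\<close>)
  then show ?thesis using False by (simp add: comix_large mix_large)
qed

text \<open>Identifies \<open>kap\<close> as the product table of the blocks; the factor 2 is that
  of the quaternion commutators in \<open>lef_bracket_eq\<close>.\<close>

lemma mix_kap:
  assumes N: "3 \<le> N" and i: "i < N" and j: "j < N"
  shows "(\<Sum>b<N. kap i j b * mix b k) = 2 * mix i k * mix j k"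
proof (cases "i < 3 \<and> j < 3")
  case True
  have "(\<Sum>b<N. kap i j b * mix b k) = kap i j 0 * mix 0 k + kap i j 1 * mix 1 k + kap i j 2 * mix 2 k"
    by (rule sum_three[OF N]) (use True in \<open>simp add: kap_large\<close>)
  also have "\<dots> = 2 * mix i k * mix j k"
  proof (cases "k < 3")
    case k3: True
    have "i < 3" "j < 3" using True by blast+
    from this[THEN less_3_cases] less_3_cases[OF k3] show ?thesis
      by (elim disjE; simp add: kap_def mix_def)
  next
    case False
    then show ?thesis using True by (simp add: mix_large(2))
  qed
  finally show ?thesis .
next
  case False
  have "(\<Sum>b<N. kap i j b * mix b k) = kap i j i * mix i k"
    by (rule sum_single[OF i]) (use False in \<open>auto simp: kap_large\<close>)
  also have "\<dots> = 2 * mix i k * mix j k"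
  proof (cases "i = j")
    case True
    then show ?thesis using False by (simp add: kap_large mix_large)
  next
    case ij: False
    then have "mix i k * mix j k = 0" using False by (cases "3 \<le> i") (auto simp: mix_large not_less)
    moreover have "kap i j i = 0" using False ij by (subst kap_large) auto
    ultimately show ?thesis by simp
  qed
  finally show ?thesis .
qed

text \<open>The block part of one summand of the differential: \<open>eta\<close> evaluated on the
  product of blocks \<open>i\<close> and \<open>j\<close> and on blocks \<open>k\<close> and
  \<open>l\<close>.\<close>

definition kapeta :: "nat \<Rightarrow> nat \<Rightarrow> nat \<Rightarrow> nat \<Rightarrow> nat \<Rightarrow> real" where
  "kapeta N i j k l = (\<Sum>b<N. kap i j b * eta b k l)"

lemma kapeta_small:
  assumes "3 \<le> N" "i < 3" "j < 3"
  shows "kapeta N i j k l = kap i j 0 * eta 0 k l + kap i j 1 * eta 1 k l + kap i j 2 * eta 2 k l"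
  unfolding kapeta_def by (rule sum_three) (use assms in \<open>simp_all add: kap_large\<close>)

lemma kapeta_large:
  assumes N: "3 \<le> N" and i: "i < N" and "\<not> (i < 3 \<and> j < 3 \<and> k < 3 \<and> l < 3)"
  shows "kapeta N i j k l = (if i = j \<and> j = k \<and> k = l then -1 else 0)"
proof (cases "i < 3 \<and> j < 3")
  case True
  have kl: "\<not> (k < 3 \<and> l < 3)" using assms(3) True by blast
  have "eta b k l = 0" if "b < 3" for b using that kl by (auto simp: eta_large)
  then have "kapeta N i j k l = 0" using kapeta_small[OF N] True by simp
  then show ?thesis using True kl by auto
next
  case False
  have "kapeta N i j k l = kap i j i * eta i k l"
    unfolding kapeta_def by (rule sum_single[OF i]) (use False in \<open>auto simp: kap_large\<close>)
  then show ?thesis using False by (auto simp: kap_large eta_large)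
qed

text \<open>Splitting four blocks into two pairs can be done in three ways, and the symmetrised
  value of \<open>kapeta\<close> is the same for each. This common factor is what reduces closedness
  of the form to the Jacobi identity. On the first three blocks it is a finite check; elsewhere
  everything is diagonal.\<close>

lemma kapeta_pairings:
  assumes N: "3 \<le> N" and "i < N" "j < N" "k < N" "l < N"
  shows "kapeta N i k j l + kapeta N j l i k = kapeta N i j k l + kapeta N k l i j"
    and "kapeta N i l j k + kapeta N j k i l = kapeta N i j k l + kapeta N k l i j"
proof -
  have "kapeta N i k j l + kapeta N j l i k = kapeta N i j k l + kapeta N k l i j \<and>
      kapeta N i l j k + kapeta N j k i l = kapeta N i j k l + kapeta N k l i j"
  proof (cases "i < 3 \<and> j < 3 \<and> k < 3 \<and> l < 3")
    case True
    then have s: "i < 3" "j < 3" "k < 3" "l < 3" by auto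
    note e = kapeta_small[OF N s(1,2)] kapeta_small[OF N s(3,4)] kapeta_small[OF N s(1,3)] kapeta_small[OF N s(2,4)]
      kapeta_small[OF N s(1,4)] kapeta_small[OF N s(2,3)]
    show ?thesis unfolding e
      using less_3_cases[OF s(1)] less_3_cases[OF s(2)] less_3_cases[OF s(3)] less_3_cases[OF s(4)]
      by (elim disjE; simp add: kap_def eta_def)
  next
    case False
    then have "\<not> (i < 3 \<and> k < 3 \<and> j < 3 \<and> l < 3)" "\<not> (j < 3 \<and> l < 3 \<and> i < 3 \<and> k < 3)"
      "\<not> (k < 3 \<and> l < 3 \<and> i < 3 \<and> j < 3)" "\<not> (i < 3 \<and> l < 3 \<and> j < 3 \<and> k < 3)" "\<not> (j < 3 \<and> k < 3 \<and> i < 3 \<and> l < 3)"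
      by blast+
    note e = kapeta_large[OF N assms(2) False] kapeta_large[OF N assms(2) this(1)] kapeta_large[OF N assms(3) this(2)]
      kapeta_large[OF N assms(4) this(3)] kapeta_large[OF N assms(2) this(4)] kapeta_large[OF N assms(3) this(5)]
    show ?thesis unfolding e by auto
  qed
  then show "kapeta N i k j l + kapeta N j l i k = kapeta N i j k l + kapeta N k l i j"
    "kapeta N i l j k + kapeta N j k i l = kapeta N i j k l + kapeta N k l i j" by blast+
qed

text \<open>The Koszul formula with half the three-form added, on block indices alone: the direction
  indices contribute the same factor \<open>eps\<close> to every term because \<open>eps\<close> is
  cyclically invariant.\<close>

lemma gam_eq: "gam i j k = (kap i j k - kap j k i + kap k i j + eta i j k) / 2"
proof (cases "i < 3 \<and> j < 3 \<and> k < 3")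
  case True
  then have "i < 3" "j < 3" "k < 3" by blast+
  from this[THEN less_3_cases] show ?thesis
    by (elim disjE; simp add: kap_def eta_def gam_def)
next
  case False
  then have "\<not> (j < 3 \<and> k < 3 \<and> i < 3)" "\<not> (k < 3 \<and> i < 3 \<and> j < 3)" by blast+
  then show ?thesis using False by (simp add: kap_large eta_large gam_large)
qed

text \<open>As matrices, \<open>gam i\<close> and \<open>gam j\<close> commute, and their product is
  the matrix of the product block, except that \<open>gam 0\<close> squared differs from
  \<open>gam 2\<close> on block 1. That exception has no component along block 0, so it is invisible
  when the last index equals the first.\<close>

lemma gam_contractions:
  assumes N: "3 \<le> N"
  shows "(\<Sum>m<N. gam i k m * gam j m i) = (\<Sum>m<N. gam j k m * gam i m i)"
    and "(\<Sum>m<N. kap i j m * gam m k i) = (\<Sum>m<N. gam j k m * gam i m i)"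
proof -
  have t: "(\<Sum>m<N. gam i k m * gam j m i) = gam i k 0 * gam j 0 i + gam i k 1 * gam j 1 i + gam i k 2 * gam j 2 i"
    "(\<Sum>m<N. kap i j m * gam m k i) = kap i j 0 * gam 0 k i + kap i j 1 * gam 1 k i + kap i j 2 * gam 2 k i"
    "(\<Sum>m<N. gam j k m * gam i m i) = gam j k 0 * gam i 0 i + gam j k 1 * gam i 1 i + gam j k 2 * gam i 2 i"
    by (rule sum_three[OF N]; simp add: gam_large)+
  have "gam i k 0 * gam j 0 i + gam i k 1 * gam j 1 i + gam i k 2 * gam j 2 i
       = gam j k 0 * gam i 0 i + gam j k 1 * gam i 1 i + gam j k 2 * gam i 2 i \<and>
     kap i j 0 * gam 0 k i + kap i j 1 * gam 1 k i + kap i j 2 * gam 2 k i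
       = gam j k 0 * gam i 0 i + gam j k 1 * gam i 1 i + gam j k 2 * gam i 2 i"
  proof (cases "i < 3 \<and> j < 3 \<and> k < 3")
    case True
    then have "i < 3" "j < 3" "k < 3" by blast+
    from this[THEN less_3_cases] show ?thesis
      by (elim disjE; simp add: kap_def gam_def)
  next
    case False
    then consider "\<not> i < 3" | "\<not> k < 3" | "i < 3" "\<not> j < 3" by blast
    then show ?thesis by cases (auto simp: gam_large kap_large)
  qed
  then show "(\<Sum>m<N. gam i k m * gam j m i) = (\<Sum>m<N. gam j k m * gam i m i)"
    "(\<Sum>m<N. kap i j m * gam m k i) = (\<Sum>m<N. gam j k m * gam i m i)" unfolding t by blast+
qed

section \<open>Products of three-spheres\<close>

subsection \<open>Tuples of quaternions\<close>

text \<open>Block \<open>j\<close> of a sequence, its entries \<open>4 * j, \<dots>, 4 * j + 3\<close>, is read as a quaternion, and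
  entries \<open>3 * j, 3 * j + 1, 3 * j + 2\<close> of a coordinate vector belong to block \<open>j\<close>. The index
  functions are opaque constants because the simplifier rewrites \<open>4 * j + 2\<close> to successor form.\<close>

definition ix0 :: "nat \<Rightarrow> nat" where "ix0 j = 4 * j"
definition ix1 :: "nat \<Rightarrow> nat" where "ix1 j = 4 * j + 1"
definition ix2 :: "nat \<Rightarrow> nat" where "ix2 j = 4 * j + 2"
definition ix3 :: "nat \<Rightarrow> nat" where "ix3 j = 4 * j + 3"
definition tx0 :: "nat \<Rightarrow> nat" where "tx0 j = 3 * j"
definition tx1 :: "nat \<Rightarrow> nat" where "tx1 j = 3 * j + 1"
definition tx2 :: "nat \<Rightarrow> nat" where "tx2 j = 3 * j + 2"

lemma ix_simps [simp]:
  "ix0 j div 4 = j" "ix1 j div 4 = j" "ix2 j div 4 = j" "ix3 j div 4 = j"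
  "ix0 j mod 4 = 0" "ix1 j mod 4 = 1" "ix2 j mod 4 = 2" "ix3 j mod 4 = 3"
  "ix0 j < 4 * m \<longleftrightarrow> j < m" "ix1 j < 4 * m \<longleftrightarrow> j < m" "ix2 j < 4 * m \<longleftrightarrow> j < m" "ix3 j < 4 * m \<longleftrightarrow> j < m"
  "4 * m \<le> ix0 j \<longleftrightarrow> m \<le> j" "4 * m \<le> ix1 j \<longleftrightarrow> m \<le> j" "4 * m \<le> ix2 j \<longleftrightarrow> m \<le> j" "4 * m \<le> ix3 j \<longleftrightarrow> m \<le> j"
  "4 dvd ix0 j" "\<not> 4 dvd ix1 j" "\<not> 4 dvd ix2 j" "\<not> 4 dvd ix3 j"
  unfolding ix0_def ix1_def ix2_def ix3_def by presburger+

lemma tx_simps [simp]: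
  "tx0 j div 3 = j" "tx1 j div 3 = j" "tx2 j div 3 = j"
  "tx0 j mod 3 = 0" "tx1 j mod 3 = 1" "tx2 j mod 3 = 2"
  "tx0 j < 3 * m \<longleftrightarrow> j < m" "tx1 j < 3 * m \<longleftrightarrow> j < m" "tx2 j < 3 * m \<longleftrightarrow> j < m"
  unfolding tx0_def tx1_def tx2_def by presburger+

lemma ix_neq [simp]:
  "ix0 j \<noteq> ix1 k" "ix0 j \<noteq> ix2 k" "ix0 j \<noteq> ix3 k" "ix1 j \<noteq> ix0 k" "ix1 j \<noteq> ix2 k" "ix1 j \<noteq> ix3 k"
  "ix2 j \<noteq> ix0 k" "ix2 j \<noteq> ix1 k" "ix2 j \<noteq> ix3 k" "ix3 j \<noteq> ix0 k" "ix3 j \<noteq> ix1 k" "ix3 j \<noteq> ix2 k"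
  "ix0 j = ix0 k \<longleftrightarrow> j = k" "ix1 j = ix1 k \<longleftrightarrow> j = k" "ix2 j = ix2 k \<longleftrightarrow> j = k" "ix3 j = ix3 k \<longleftrightarrow> j = k"
  unfolding ix0_def ix1_def ix2_def ix3_def by presburger+

lemma quat_cases:
  assumes "\<And>j. P (ix0 j)" "\<And>j. P (ix1 j)" "\<And>j. P (ix2 j)" "\<And>j. P (ix3 j)"
  shows "P (i :: nat)"
proof -
  have "i = ix0 (i div 4) \<or> i = ix1 (i div 4) \<or> i = ix2 (i div 4) \<or> i = ix3 (i div 4)"
    unfolding ix0_def ix1_def ix2_def ix3_def by presburger
  then show ?thesis using assms by metis
qed

lemma triple_cases:
  assumes "\<And>j. P (tx0 j)" "\<And>j. P (tx1 j)" "\<And>j. P (tx2 j)"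
  shows "P (i :: nat)"
proof -
  have "i = tx0 (i div 3) \<or> i = tx1 (i div 3) \<or> i = tx2 (i div 3)"
    unfolding tx0_def tx1_def tx2_def by presburger
  then show ?thesis using assms by metis
qed

definition qmul :: "(nat \<Rightarrow> real) \<Rightarrow> (nat \<Rightarrow> real) \<Rightarrow> nat \<Rightarrow> real" where
  "qmul p q i = (let j = i div 4 in
     if i mod 4 = 0 then p (ix0 j) * q (ix0 j) - p (ix1 j) * q (ix1 j) - p (ix2 j) * q (ix2 j) - p (ix3 j) * q (ix3 j)
     else if i mod 4 = 1 then p (ix0 j) * q (ix1 j) + p (ix1 j) * q (ix0 j) + p (ix2 j) * q (ix3 j) - p (ix3 j) * q (ix2 j)
     else if i mod 4 = 2 then p (ix0 j) * q (ix2 j) - p (ix1 j) * q (ix3 j) + p (ix2 j) * q (ix0 j) + p (ix3 j) * q (ix1 j)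
     else p (ix0 j) * q (ix3 j) + p (ix1 j) * q (ix2 j) - p (ix2 j) * q (ix1 j) + p (ix3 j) * q (ix0 j))"

definition qconj :: "(nat \<Rightarrow> real) \<Rightarrow> nat \<Rightarrow> real" where
  "qconj q i = (if i mod 4 = 0 then q i else - q i)"

definition qone :: "nat \<Rightarrow> nat \<Rightarrow> real" where
  "qone m i = (if i < 4 * m \<and> i mod 4 = 0 then 1 else 0)"

definition qnorm2 :: "(nat \<Rightarrow> real) \<Rightarrow> nat \<Rightarrow> real" where
  "qnorm2 q j = (q (ix0 j))\<^sup>2 + (q (ix1 j))\<^sup>2 + (q (ix2 j))\<^sup>2 + (q (ix3 j))\<^sup>2"

lemma qmul_simps:
  "qmul p q (ix0 j) = p (ix0 j) * q (ix0 j) - p (ix1 j) * q (ix1 j) - p (ix2 j) * q (ix2 j) - p (ix3 j) * q (ix3 j)"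
  "qmul p q (ix1 j) = p (ix0 j) * q (ix1 j) + p (ix1 j) * q (ix0 j) + p (ix2 j) * q (ix3 j) - p (ix3 j) * q (ix2 j)"
  "qmul p q (ix2 j) = p (ix0 j) * q (ix2 j) - p (ix1 j) * q (ix3 j) + p (ix2 j) * q (ix0 j) + p (ix3 j) * q (ix1 j)"
  "qmul p q (ix3 j) = p (ix0 j) * q (ix3 j) + p (ix1 j) * q (ix2 j) - p (ix2 j) * q (ix1 j) + p (ix3 j) * q (ix0 j)"
  by (simp_all add: qmul_def Let_def)

lemma qconj_simps:
  "qconj q (ix0 j) = q (ix0 j)" "qconj q (ix1 j) = - q (ix1 j)"
  "qconj q (ix2 j) = - q (ix2 j)" "qconj q (ix3 j) = - q (ix3 j)"
  by (simp_all add: qconj_def)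

lemma qone_simps:
  "qone m (ix0 j) = (if j < m then 1 else 0)" "qone m (ix1 j) = 0" "qone m (ix2 j) = 0" "qone m (ix3 j) = 0"
  by (auto simp: qone_def)

lemma qmul_assoc: "qmul (qmul p q) r = qmul p (qmul q r)"
proof
  show "qmul (qmul p q) r i = qmul p (qmul q r) i" for i
    by (rule quat_cases[of _ i]) (simp_all add: qmul_simps algebra_simps)
qed

lemma qnorm2_qmul: "qnorm2 (qmul p q) j = qnorm2 p j * qnorm2 q j"
  by (simp add: qnorm2_def qmul_simps power2_eq_square algebra_simps)

lemma qnorm2_qconj: "qnorm2 (qconj q) j = qnorm2 q j"
  by (simp add: qnorm2_def qconj_simps)

lemma qmul_zero:
  assumes z: "\<And>i. i \<ge> 4 * m \<Longrightarrow> q i = 0" and "i \<ge> 4 * m"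
  shows "qmul p q i = 0"
proof -
  have "4 * m \<le> i \<longrightarrow> qmul p q i = 0"
    by (rule quat_cases[of _ i]) (simp_all add: qmul_simps z)
  then show ?thesis using assms(2) by blast
qed

lemma qmul_lin:
  "qmul p (\<lambda>i. a * q i + b * r i) i = a * qmul p q i + b * qmul p r i"
  "qmul (\<lambda>i. a * q i + b * r i) p i = a * qmul q p i + b * qmul r p i"
  by (rule quat_cases[of _ i]; simp add: qmul_simps algebra_simps)+

text \<open>Real factors in each block are central; this moves normalisations through
  products.\<close>

lemma qmul_block_scale:
  "qmul p (\<lambda>i. q i / s (i div 4)) i = qmul p q i / s (i div 4)"
  "qmul (\<lambda>i. q i / s (i div 4)) p i = qmul q p i / s (i div 4)"
  by (rule quat_cases[of _ i]; simp add: qmul_simps add_divide_distrib diff_divide_distrib)+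

definition spheres :: "nat \<Rightarrow> (nat \<Rightarrow> real) set" where
  "spheres m = {q. (\<forall>j<m. qnorm2 q j = 1) \<and> (\<forall>i\<ge>4 * m. q i = 0)}"

lemma spheresD: "q \<in> spheres m \<Longrightarrow> j < m \<Longrightarrow> qnorm2 q j = 1" "q \<in> spheres m \<Longrightarrow> i \<ge> 4 * m \<Longrightarrow> q i = 0"
  by (simp_all add: spheres_def)

lemma qone_in: "qone m \<in> spheres m"
  by (auto simp: spheres_def qnorm2_def qone_simps qone_def)

lemma qmul_in: "p \<in> spheres m \<Longrightarrow> q \<in> spheres m \<Longrightarrow> qmul p q \<in> spheres m"
  unfolding spheres_def mem_Collect_eq using qmul_zero[of m q] by (simp add: qnorm2_qmul)

lemma qconj_in: "p \<in> spheres m \<Longrightarrow> qconj p \<in> spheres m"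
  unfolding spheres_def mem_Collect_eq by (auto simp: qnorm2_qconj qconj_def)

lemma qmul_qone_left:
  assumes z: "\<And>i. i \<ge> 4 * m \<Longrightarrow> q i = 0"
  shows "qmul (qone m) q = q"
proof
  show "qmul (qone m) q i = q i" for i
    by (rule quat_cases[of _ i]) (auto simp: qmul_simps qone_simps z)
qed

lemma qmul_qone_right:
  assumes z: "\<And>i. i \<ge> 4 * m \<Longrightarrow> q i = 0"
  shows "qmul q (qone m) = q"
proof
  show "qmul q (qone m) i = q i" for i
    by (rule quat_cases[of _ i]) (auto simp: qmul_simps qone_simps z)
qed

lemma qmul_qconj:
  assumes "p \<in> spheres m"
  shows "qmul (qconj p) p = qone m" "qmul p (qconj p) = qone m"
proof -
  have n: "p (ix0 j) * p (ix0 j) + p (ix1 j) * p (ix1 j) + p (ix2 j) * p (ix2 j) + p (ix3 j) * p (ix3 j)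
      = (if j < m then 1 else 0)" for j
    using spheresD[OF assms, unfolded qnorm2_def power2_eq_square] by auto
  show "qmul (qconj p) p = qone m"
  proof
    show "qmul (qconj p) p i = qone m i" for i
    proof (rule quat_cases[of _ i])
      show "qmul (qconj p) p (ix0 j) = qone m (ix0 j)" for j
        using n[of j] by (simp add: qmul_simps qconj_simps qone_simps)
    qed (simp_all add: qmul_simps qconj_simps qone_simps)
  qed
  show "qmul p (qconj p) = qone m"
  proof
    show "qmul p (qconj p) i = qone m i" for i
    proof (rule quat_cases[of _ i])
      show "qmul p (qconj p) (ix0 j) = qone m (ix0 j)" for j
        using n[of j] by (simp add: qmul_simps qconj_simps qone_simps)
    qed (simp_all add: qmul_simps qconj_simps qone_simps)
  qed
qed

lemma qmul_qconj_cancel: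
  assumes "p \<in> spheres m" "\<And>i. i \<ge> 4 * m \<Longrightarrow> q i = 0"
  shows "qmul (qconj p) (qmul p q) = q" "qmul p (qmul (qconj p) q) = q"
  using qmul_qconj[OF assms(1)] qmul_qone_left[OF assms(2)] by (simp_all flip: qmul_assoc)

subsection \<open>Gnomonic charts\<close>

text \<open>Central projection of the half sphere around \<open>1\<close> onto the tangent space: the inverse sends
  \<open>x\<close> to \<open>(1, x) / norm (1, x)\<close> in each block. Unit quaternion translates of this chart have
  linear-fractional transition maps.\<close>

definition cidx :: "nat \<Rightarrow> nat" where
  "cidx i = 4 * (i div 3) + i mod 3 + 1"

definition lift1 :: "nat \<Rightarrow> (nat \<Rightarrow> real) \<Rightarrow> nat \<Rightarrow> real" where
  "lift1 m x i = (if i < 4 * m then if i mod 4 = 0 then 1 else x (3 * (i div 4) + (i mod 4 - 1)) else 0)"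

definition gno :: "nat \<Rightarrow> (nat \<Rightarrow> real) \<Rightarrow> nat \<Rightarrow> real" where
  "gno m x i = lift1 m x i / sqrt (qnorm2 (lift1 m x) (i div 4))"

definition proj :: "nat \<Rightarrow> (nat \<Rightarrow> real) \<Rightarrow> nat \<Rightarrow> real" where
  "proj m r i = (if i < 3 * m then r (cidx i) / r (ix0 (i div 3)) else 0)"

definition chart :: "nat \<Rightarrow> (nat \<Rightarrow> real) \<Rightarrow> (nat \<Rightarrow> real) \<Rightarrow> nat \<Rightarrow> real" where
  "chart m p q = proj m (qmul (qconj p) q)"

definition chart_dom :: "nat \<Rightarrow> (nat \<Rightarrow> real) \<Rightarrow> (nat \<Rightarrow> real) set" where
  "chart_dom m p = {q \<in> spheres m. \<forall>j<m. qmul (qconj p) q (ix0 j) > 0}"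

abbreviation "Es m \<equiv> topspace (Euclidean_space (3 * m))"

lemma cidx_simps: "cidx (tx0 j) = ix1 j" "cidx (tx1 j) = ix2 j" "cidx (tx2 j) = ix3 j"
  by (simp_all add: cidx_def) (simp_all add: ix1_def ix2_def ix3_def)

lemma cidx_div: "cidx i div 4 = i div 3"
  by (rule triple_cases[of _ i]) (simp_all add: cidx_simps)

lemma cidx_less:
  assumes "i < 3 * m"
  shows "cidx i < 4 * m"
proof -
  have "i < 3 * m \<longrightarrow> cidx i < 4 * m"
    by (rule triple_cases[of _ i]) (simp_all add: cidx_simps)
  then show ?thesis using assms by blast
qed

lemma lift1_simps:
  "lift1 m x (ix0 j) = (if j < m then 1 else 0)"
  "lift1 m x (ix1 j) = (if j < m then x (tx0 j) else 0)"
  "lift1 m x (ix2 j) = (if j < m then x (tx1 j) else 0)"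
  "lift1 m x (ix3 j) = (if j < m then x (tx2 j) else 0)"
  by (auto simp: lift1_def tx0_def tx1_def tx2_def)

lemma lift1_cidx:
  assumes "i < 3 * m"
  shows "lift1 m x (cidx i) = x i"
proof -
  have "i < 3 * m \<longrightarrow> lift1 m x (cidx i) = x i"
    by (rule triple_cases[of _ i]) (auto simp: cidx_simps lift1_simps)
  then show ?thesis using assms by blast
qed

lemma lift1_zero: "i \<ge> 4 * m \<Longrightarrow> lift1 m x i = 0"
  by (simp add: lift1_def)

lemma qnorm2_lift1: "j < m \<Longrightarrow> qnorm2 (lift1 m x) j \<ge> 1"
  by (simp add: qnorm2_def lift1_simps)

lemma qnorm2_block_div: "s j \<noteq> 0 \<Longrightarrow> qnorm2 (\<lambda>i. q i / s (i div 4)) j = qnorm2 q j / (s j)\<^sup>2"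
  by (simp add: qnorm2_def power_divide add_divide_distrib)

lemma gno_zero: "i \<ge> 4 * m \<Longrightarrow> gno m x i = 0"
  by (simp add: gno_def lift1_zero)

lemma gno_in: "gno m x \<in> spheres m"
proof -
  have "qnorm2 (gno m x) j = 1" if "j < m" for j
  proof -
    have pos: "qnorm2 (lift1 m x) j > 0" using qnorm2_lift1[OF that] by (rule less_le_trans[OF zero_less_one])
    have "qnorm2 (gno m x) j = qnorm2 (lift1 m x) j / (sqrt (qnorm2 (lift1 m x) j))\<^sup>2"
      unfolding gno_def[abs_def] using qnorm2_block_div[of "\<lambda>j. sqrt (qnorm2 (lift1 m x) j)" j "lift1 m x"] pos by simp
    then show ?thesis using pos by simp
  qed
  then show ?thesis by (simp add: spheres_def gno_zero)
qed

lemma proj_block_div: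
  assumes "\<And>j. j < m \<Longrightarrow> s j \<noteq> 0"
  shows "proj m (\<lambda>i. r i / s (i div 4)) = proj m r"
proof
  fix i
  show "proj m (\<lambda>i. r i / s (i div 4)) i = proj m r i"
    using assms[of "i div 3"] by (auto simp: proj_def cidx_div)
qed

lemma proj_lift1: "x \<in> Es m \<Longrightarrow> proj m (lift1 m x) = x"
  by (auto simp: proj_def fun_eq_iff lift1_cidx lift1_simps topspace_Euclidean_space)

lemma sqrt_qnorm2_lift1: "j < m \<Longrightarrow> sqrt (qnorm2 (lift1 m x) j) > 0"
  using less_le_trans[OF zero_less_one qnorm2_lift1] by simp

lemma sqrt_qnorm2_lift1_neq: "j < m \<Longrightarrow> sqrt (qnorm2 (lift1 m x) j) \<noteq> 0"
  using sqrt_qnorm2_lift1[of j m x] by linarith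

lemma proj_gno:
  assumes "x \<in> Es m"
  shows "proj m (gno m x) = x"
proof -
  have "proj m (gno m x) = proj m (lift1 m x)"
    unfolding gno_def[abs_def]
    by (rule proj_block_div[of m "\<lambda>j. sqrt (qnorm2 (lift1 m x) j)", OF sqrt_qnorm2_lift1_neq])
  then show ?thesis using proj_lift1[OF assms] by simp
qed

lemma gno_pos: "j < m \<Longrightarrow> gno m x (ix0 j) > 0"
  using sqrt_qnorm2_lift1[of j m x] by (simp add: gno_def lift1_simps)

text \<open>Dividing a unit quaternion by its positive real part makes the real part 1 and the norm
  the reciprocal of the old real part, so normalising restores the quaternion. Positivity fixes the
  sign of the square root.\<close>

lemma gno_proj:
  assumes q: "q \<in> spheres m" and pos: "\<And>j. j < m \<Longrightarrow> q (ix0 j) > 0"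
  shows "gno m (proj m q) = q"
proof
  have l: "lift1 m (proj m q) i = q i / q (ix0 (i div 4))" if "i < 4 * m" for i
    using that
  proof (induct i rule: quat_cases[case_names 0 1 2 3])
    case (0 j)
    then have "j < m" by simp
    with pos[OF this] show ?case by (simp add: lift1_simps)
  next
    case (1 j) then have "j < m" by simp
    then show ?case by (simp add: lift1_simps proj_def cidx_simps)
  next
    case (2 j) then have "j < m" by simp
    then show ?case by (simp add: lift1_simps proj_def cidx_simps)
  next
    case (3 j) then have "j < m" by simp
    then show ?case by (simp add: lift1_simps proj_def cidx_simps)
  qed
  fix i
  show "gno m (proj m q) i = q i"
  proof (cases "i < 4 * m")
    case True
    define j where "j = i div 4"
    have j: "j < m" using True by (simp add: j_def)
    have "qnorm2 (lift1 m (proj m q)) j = qnorm2 q j / (q (ix0 j))\<^sup>2"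
      using j by (simp add: qnorm2_def l power_divide add_divide_distrib)
    then have "sqrt (qnorm2 (lift1 m (proj m q)) j) = 1 / q (ix0 j)"
      using spheresD(1)[OF q j] pos[OF j] by (simp add: real_sqrt_divide)
    then show ?thesis using pos[OF j] unfolding gno_def l[OF True] j_def[symmetric] by simp
  next
    case False
    then show ?thesis using gno_zero spheresD(2)[OF q] by simp
  qed
qed

lemma proj_in: "proj m r \<in> Es m"
  by (simp add: proj_def topspace_Euclidean_space)

lemma chart_gno:
  assumes "p \<in> spheres m" "x \<in> Es m"
  shows "chart m p (qmul p (gno m x)) = x" "qmul p (gno m x) \<in> chart_dom m p"
proof -
  have c: "qmul (qconj p) (qmul p (gno m x)) = gno m x"
    by (rule qmul_qconj_cancel(1)[OF assms(1) gno_zero])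
  show "chart m p (qmul p (gno m x)) = x" unfolding chart_def c by (rule proj_gno[OF assms(2)])
  show "qmul p (gno m x) \<in> chart_dom m p"
    by (simp add: chart_dom_def c gno_pos qmul_in[OF assms(1) gno_in])
qed

lemma gno_chart:
  assumes "p \<in> spheres m" "q \<in> chart_dom m p"
  shows "qmul p (gno m (chart m p q)) = q"
proof -
  have q: "q \<in> spheres m" "\<And>j. j < m \<Longrightarrow> qmul (qconj p) q (ix0 j) > 0" using assms(2) by (auto simp: chart_dom_def)
  have "gno m (chart m p q) = qmul (qconj p) q"
    unfolding chart_def by (rule gno_proj) (use q assms(1) qmul_in qconj_in in auto)
  then show ?thesis using qmul_qconj_cancel(2)[OF assms(1)] spheresD(2)[OF q(1)] by simp
qed

lemma chart_image: "p \<in> spheres m \<Longrightarrow> chart m p ` chart_dom m p = Es m"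
proof (intro equalityI subsetI)
  fix x assume p: "p \<in> spheres m" and x: "x \<in> Es m"
  show "x \<in> chart m p ` chart_dom m p"
    by (rule image_eqI[where x="qmul p (gno m x)"]) (simp_all add: chart_gno p x)
qed (auto simp: chart_def proj_in)

lemma inj_on_chart: "p \<in> spheres m \<Longrightarrow> inj_on (chart m p) (chart_dom m p)"
  by (rule inj_on_inverseI[of _ "\<lambda>x. qmul p (gno m x)"]) (rule gno_chart)

lemma inv_chart: "p \<in> spheres m \<Longrightarrow> x \<in> Es m \<Longrightarrow> inv_into (chart_dom m p) (chart m p) x = qmul p (gno m x)"
  by (rule inv_into_f_eq) (simp_all add: inj_on_chart chart_gno)

subsection \<open>Continuity and smoothness of the operations\<close>

lemma continuous_on_seqI: "(\<And>i. continuous_on T (\<lambda>x. A x i)) \<Longrightarrow> continuous_on T (A :: 'a :: topological_space \<Rightarrow> nat \<Rightarrow> real)"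
  by (rule continuous_on_coordinatewise_then_product)

lemmas continuous_on_seqD = continuous_on_product_then_coordinatewise

lemma continuous_on_qmul:
  assumes "continuous_on T A" "continuous_on T B"
  shows "continuous_on T (\<lambda>x. qmul (A x) (B x))"
proof (rule continuous_on_seqI)
  show "continuous_on T (\<lambda>x. qmul (A x) (B x) i)" for i
    using continuous_on_seqD[OF assms(1)] continuous_on_seqD[OF assms(2)]
    by - (rule quat_cases[of _ i], simp_all add: qmul_simps continuous_on_add continuous_on_diff continuous_on_mult)
qed

lemma continuous_on_qconj: "continuous_on T A \<Longrightarrow> continuous_on T (\<lambda>x. qconj (A x))"
proof (rule continuous_on_seqI)
  fix i assume "continuous_on T A"
  then show "continuous_on T (\<lambda>x. qconj (A x) i)"
    using continuous_on_seqD[of T A i] by (cases "i mod 4 = 0") (simp_all add: qconj_def continuous_on_minus)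
qed

lemma continuous_on_lift1: "continuous_on T A \<Longrightarrow> continuous_on T (\<lambda>x. lift1 m (A x))"
proof (rule continuous_on_seqI)
  fix i assume "continuous_on T A"
  then show "continuous_on T (\<lambda>x. lift1 m (A x) i)"
    using continuous_on_seqD[of T A] by (cases "i < 4 * m"; cases "i mod 4 = 0") (simp_all add: lift1_def)
qed

lemma continuous_on_qnorm2: "continuous_on T A \<Longrightarrow> continuous_on T (\<lambda>x. qnorm2 (A x) j)"
  using continuous_on_seqD[of T A]
  by (simp add: qnorm2_def continuous_on_add continuous_on_power)

lemma continuous_on_gno:
  assumes "continuous_on T A"
  shows "continuous_on T (\<lambda>x. gno m (A x))"
proof (rule continuous_on_seqI)
  fix i
  note l = continuous_on_lift1[OF assms, of m]
  show "continuous_on T (\<lambda>x. gno m (A x) i)"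
  proof (cases "i < 4 * m")
    case True
    then have "i div 4 < m" by auto
    then show ?thesis
      unfolding gno_def
      by (intro continuous_on_divide continuous_on_seqD[OF l] continuous_on_real_sqrt continuous_on_qnorm2[OF l] ballI
          sqrt_qnorm2_lift1_neq)
  qed (simp add: gno_zero)
qed

lemma continuous_on_proj:
  assumes "continuous_on T A" "\<And>x j. x \<in> T \<Longrightarrow> j < m \<Longrightarrow> A x (ix0 j) \<noteq> 0"
  shows "continuous_on T (\<lambda>x. proj m (A x))"
proof (rule continuous_on_seqI)
  show "continuous_on T (\<lambda>x. proj m (A x) i)" for i
    using assms(2)[of _ "i div 3"] continuous_on_seqD[OF assms(1)]
    by (cases "i < 3 * m") (auto simp: proj_def intro!: continuous_on_divide)
qed

lemma smooth_qmul:
  assumes W: "openin (Euclidean_space n) W"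
    and A: "\<And>i. smooth_real_on n W (\<lambda>x. A x i)" and B: "\<And>i. smooth_real_on n W (\<lambda>x. B x i)"
  shows "smooth_real_on n W (\<lambda>x. qmul (A x) (B x) i)"
  using smooth_mult[OF W A B]
  by - (rule quat_cases[of _ i], simp_all add: qmul_simps smooth_add[OF W] smooth_diff[OF W])

lemma smooth_qconj:
  assumes "openin (Euclidean_space n) W" "\<And>i. smooth_real_on n W (\<lambda>x. A x i)"
  shows "smooth_real_on n W (\<lambda>x. qconj (A x) i)"
  using assms by (cases "i mod 4 = 0") (simp_all add: qconj_def smooth_minus)

lemma smooth_lift1:
  assumes W: "openin (Euclidean_space n) W" and A: "\<And>i. smooth_real_on n W (\<lambda>x. A x i)"
  shows "smooth_real_on n W (\<lambda>x. lift1 m (A x) i)"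
  using A smooth_const[OF W] by (cases "i < 4 * m"; cases "i mod 4 = 0") (simp_all add: lift1_def)

lemma smooth_gno:
  assumes W: "openin (Euclidean_space n) W" and A: "\<And>i. smooth_real_on n W (\<lambda>x. A x i)"
  shows "smooth_real_on n W (\<lambda>x. gno m (A x) i)"
proof (cases "i < 4 * m")
  case True
  then have j: "i div 4 < m" by auto
  note l = smooth_lift1[OF W A, of m]
  have "smooth_real_on n W (\<lambda>x. qnorm2 (lift1 m (A x)) (i div 4))"
    unfolding qnorm2_def power2_eq_square
    by (rule smooth_add[OF W], rule smooth_add[OF W], rule smooth_add[OF W]; rule smooth_mult[OF W l l])
  then have "smooth_real_on n W (\<lambda>x. qnorm2 (lift1 m (A x)) (i div 4) powr (- 1 / 2))"
    by (rule smooth_powr[OF W]) (rule less_le_trans[OF zero_less_one qnorm2_lift1[OF j]])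
  then have "smooth_real_on n W (\<lambda>x. lift1 m (A x) i * qnorm2 (lift1 m (A x)) (i div 4) powr (- 1 / 2))"
    by (rule smooth_mult[OF W l])
  moreover have "gno m x i = lift1 m x i * qnorm2 (lift1 m x) (i div 4) powr (- 1 / 2)" for x
    using less_le_trans[OF zero_less_one qnorm2_lift1[OF j], of x]
    by (simp add: gno_def powr_minus_divide powr_half_sqrt)
  ultimately show ?thesis by simp
qed (simp add: gno_zero smooth_const[OF W])

lemma smooth_proj:
  assumes W: "openin (Euclidean_space n) W" and A: "\<And>i. smooth_real_on n W (\<lambda>x. A x i)"
    and nz: "\<And>x j. x \<in> W \<Longrightarrow> j < m \<Longrightarrow> A x (ix0 j) \<noteq> 0"
  shows "smooth_real_on n W (\<lambda>x. proj m (A x) i)"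
proof (cases "i < 3 * m")
  case True
  then have "i div 3 < m" by auto
  then have "smooth_real_on n W (\<lambda>x. A x (cidx i) / A x (ix0 (i div 3)))"
    by (intro smooth_divide[OF W A A]) (use nz in blast)
  then show ?thesis using True by (simp add: proj_def)
qed (simp add: proj_def smooth_const[OF W])

lemma openin_blocks_pos:
  assumes "continuous_on (topspace (Euclidean_space n)) A"
  shows "openin (Euclidean_space n) {x \<in> topspace (Euclidean_space n). \<forall>j<m. A x (ix0 j) > (0 :: real)}"
proof -
  let ?E = "topspace (Euclidean_space n)"
  have "openin (top_of_set ?E) (?E \<inter> (\<Inter>j<m. ?E \<inter> (\<lambda>x. A x (ix0 j)) -` {0<..}))"
  \<comment> \<open>For \<open>m = 0\<close> the intersection runs over an empty family, which
    \<open>openin_INT2\<close> does not cover.\<close>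
  proof (cases "m = 0")
    case False
    then show ?thesis
      by (intro openin_Int openin_INT2 finite_lessThan continuous_openin_preimage_gen continuous_on_seqD[OF assms]) auto
  qed simp
  moreover have "?E \<inter> (\<Inter>j<m. ?E \<inter> (\<lambda>x. A x (ix0 j)) -` {0<..}) = {x \<in> ?E. \<forall>j<m. A x (ix0 j) > 0}" by auto
  ultimately show ?thesis by (metis Euclidean_space_top_of_set)
qed

subsection \<open>Products of three-spheres as Lie groups\<close>

text \<open>Every point is the origin of a chart of its own, so pointwise computations can always be
  made at coordinate zero.\<close>

definition sph :: "nat \<Rightarrow> (nat \<Rightarrow> real) smooth_mfd" where
  "sph m = \<lparr>mtop = top_of_set (spheres m), mdim = 3 * m,
     matlas = {(chart_dom m p, chart m p) |p. p \<in> spheres m}\<rparr>"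

lemma sph_simps [simp]: "mtop (sph m) = top_of_set (spheres m)" "mdim (sph m) = 3 * m"
  by (simp_all add: sph_def)

lemma matlas_sph: "(U, \<phi>) \<in> matlas (sph m) \<longleftrightarrow> (\<exists>p\<in>spheres m. U = chart_dom m p \<and> \<phi> = chart m p)"
  by (auto simp: sph_def)

lemma gno_chart_self: "p \<in> spheres m \<Longrightarrow> p \<in> chart_dom m p"
  by (auto simp: chart_dom_def qmul_qconj qone_simps)

lemma chart_dom_subset: "chart_dom m p \<subseteq> spheres m"
  by (auto simp: chart_dom_def)

lemma openin_Es: "openin (Euclidean_space (3 * m)) (Es m)"
  by simp

lemma Es_coord_smooth: "smooth_real_on n (topspace (Euclidean_space n)) (\<lambda>x. x i)"
  by (rule smooth_coord) simp

lemma smooth_qmul_gno: "smooth_real_on (3 * m) (Es m) (\<lambda>x. qmul p (gno m x) i)"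
  by (intro smooth_qmul[OF openin_Es smooth_const[OF openin_Es]] smooth_gno[OF openin_Es] Es_coord_smooth)

lemma second_countable_seq: "second_countable (euclidean :: (nat \<Rightarrow> real) topology)"
proof -
  obtain B :: "(nat \<Rightarrow> real) set set" where B: "countable B" "topological_basis B"
    using ex_countable_basis by blast
  show ?thesis
    unfolding second_countable_def
  proof (intro exI conjI ballI allI impI)
    show "countable B" by (rule B(1))
    show "openin euclidean V" if "V \<in> B" for V using topological_basis_open[OF B(2) that] by simp
    show "\<exists>V\<in>B. x \<in> V \<and> V \<subseteq> U" if "openin euclidean U \<and> x \<in> U" for U x
      using topological_basisE[OF B(2), of U x] that by auto
  qed
qed

lemma is_smooth_mfd_sph: "is_smooth_mfd (sph m)"
  unfolding is_smooth_mfd_def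
proof (intro conjI)
  show "Hausdorff_space (mtop (sph m))" by (simp add: Hausdorff_space_subtopology)
  show "second_countable (mtop (sph m))" by (simp add: second_countable_subtopology second_countable_seq)
  show "mpoints (sph m) = \<Union> (fst ` matlas (sph m))"
    using gno_chart_self chart_dom_subset by (fastforce simp: sph_def)
  show "\<forall>(U, \<phi>)\<in>matlas (sph m). openin (mtop (sph m)) U \<and>
      openin (Euclidean_space (mdim (sph m))) (\<phi> ` U) \<and>
      homeomorphic_map (subtopology (mtop (sph m)) U) (subtopology (Euclidean_space (mdim (sph m))) (\<phi> ` U)) \<phi>"
  proof (clarify, unfold matlas_sph, clarify, intro conjI)
    fix p assume p: "p \<in> spheres m"
    have c: "continuous_on T (\<lambda>q. qmul (qconj p) q)" for T
      by (rule continuous_on_qmul[OF continuous_on_const continuous_on_id])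
    have "openin (top_of_set (spheres m)) (spheres m \<inter> (\<Inter>j<m. spheres m \<inter> (\<lambda>q. qmul (qconj p) q (ix0 j)) -` {0<..}))"
    proof (cases "m = 0")
      case False
      then show ?thesis
        by (intro openin_Int openin_INT2 finite_lessThan continuous_openin_preimage_gen continuous_on_seqD[OF c]) auto
    qed simp
    moreover have "spheres m \<inter> (\<Inter>j<m. spheres m \<inter> (\<lambda>q. qmul (qconj p) q (ix0 j)) -` {0<..}) = chart_dom m p"
      by (auto simp: chart_dom_def)
    ultimately show "openin (mtop (sph m)) (chart_dom m p)" by simp
    show "openin (Euclidean_space (mdim (sph m))) (chart m p ` chart_dom m p)" by (simp add: chart_image p)
    have "homeomorphic_maps (top_of_set (chart_dom m p)) (top_of_set (Es m)) (chart m p) (\<lambda>x. qmul p (gno m x))"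
      unfolding homeomorphic_maps_def
    proof (intro conjI)
      have "continuous_on (chart_dom m p) (chart m p)"
        unfolding chart_def[abs_def] by (rule continuous_on_proj[OF c]) (auto simp: chart_dom_def)
      then show "continuous_map (top_of_set (chart_dom m p)) (top_of_set (Es m)) (chart m p)"
        using chart_image[OF p] by (auto simp: continuous_map_in_subtopology)
      have "continuous_on (Es m) (\<lambda>x. qmul p (gno m x))"
        by (intro continuous_on_qmul continuous_on_gno continuous_on_const continuous_on_id)
      then show "continuous_map (top_of_set (Es m)) (top_of_set (chart_dom m p)) (\<lambda>x. qmul p (gno m x))"
        using chart_gno(2)[OF p] by (auto simp: continuous_map_in_subtopology)
    qed (use chart_gno[OF p] gno_chart[OF p] in auto)
    moreover have "subtopology (mtop (sph m)) (chart_dom m p) = top_of_set (chart_dom m p)"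
      using chart_dom_subset by (simp add: subtopology_subtopology inf.absorb2)
    moreover have "subtopology (Euclidean_space (mdim (sph m))) (chart m p ` chart_dom m p) = top_of_set (Es m)"
      using Euclidean_space_top_of_set by (simp add: chart_image p)
    ultimately show "homeomorphic_map (subtopology (mtop (sph m)) (chart_dom m p))
        (subtopology (Euclidean_space (mdim (sph m))) (chart m p ` chart_dom m p)) (chart m p)"
      using homeomorphic_maps_imp_map by metis
  qed
  show "\<forall>(U, \<phi>)\<in>matlas (sph m). \<forall>(V, \<psi>)\<in>matlas (sph m). \<forall>i<mdim (sph m).
      smooth_real_on (mdim (sph m)) (\<phi> ` (U \<inter> V)) (\<lambda>x. \<psi> (inv_into U \<phi> x) i)"
  proof (clarify, unfold matlas_sph, clarify)
    fix p q i assume p: "p \<in> spheres m" and q: "q \<in> spheres m"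
    let ?A = "\<lambda>x. qmul (qconj q) (qmul p (gno m x))"
    \<comment> \<open>The overlap in coordinates: points whose translate has positive real part in
      every block. There the transition map is \<open>proj\<close> of \<open>?A\<close>, a quotient
      of smooth functions.\<close>
    let ?W = "{x \<in> Es m. \<forall>j<m. ?A x (ix0 j) > 0}"
    have "continuous_on (Es m) ?A"
      by (intro continuous_on_qmul continuous_on_gno continuous_on_const continuous_on_id)
    then have W: "openin (Euclidean_space (3 * m)) ?W" by (rule openin_blocks_pos)
    have img: "chart m p ` (chart_dom m p \<inter> chart_dom m q) = ?W"
    proof (intro equalityI subsetI)
      fix x assume "x \<in> chart m p ` (chart_dom m p \<inter> chart_dom m q)"
      then obtain r where r: "r \<in> chart_dom m p" "r \<in> chart_dom m q" "x = chart m p r" by blast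
      then show "x \<in> ?W" using gno_chart[OF p r(1)] proj_in by (simp add: chart_def chart_dom_def)
    next
      fix x assume "x \<in> ?W"
      then have "qmul p (gno m x) \<in> chart_dom m p \<inter> chart_dom m q" "chart m p (qmul p (gno m x)) = x"
        using chart_gno[OF p] qmul_in[OF p gno_in] by (auto simp: chart_dom_def)
      then show "x \<in> chart m p ` (chart_dom m p \<inter> chart_dom m q)" by force
    qed
    have "smooth_real_on (3 * m) ?W (\<lambda>x. qmul p (gno m x) i)" for i
      by (rule smooth_real_on_subset[OF _ _ smooth_qmul_gno]) auto
    then have "smooth_real_on (3 * m) ?W (\<lambda>x. ?A x i)" for i
      by (rule smooth_qmul[OF W smooth_const[OF W]])
    then have "smooth_real_on (3 * m) ?W (\<lambda>x. proj m (?A x) i)"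
      by (rule smooth_proj[OF W]) auto
    then have "smooth_real_on (3 * m) ?W (\<lambda>x. chart m q (inv_into (chart_dom m p) (chart m p) x) i)"
      by (rule smooth_real_on_cong[OF W, rotated]) (simp add: inv_chart p chart_def)
    then show "smooth_real_on (mdim (sph m)) (chart m p ` (chart_dom m p \<inter> chart_dom m q))
        (\<lambda>x. chart m q (inv_into (chart_dom m p) (chart m p) x) i)" unfolding img by simp
  qed
qed

text \<open>The truncation makes the first half of the coordinates an element of
  \<open>Es m\<close>, as the inverse chart of the first factor expects.\<close>

definition prod_inv :: "nat \<Rightarrow> (nat \<Rightarrow> real) \<Rightarrow> (nat \<Rightarrow> real) \<Rightarrow> (nat \<Rightarrow> real) \<Rightarrow> (nat \<Rightarrow> real) \<times> (nat \<Rightarrow> real)" where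
  "prod_inv m p q x = (qmul p (gno m (\<lambda>i. if i < 3 * m then x i else 0)), qmul q (gno m (\<lambda>i. x (i + 3 * m))))"

definition prod_chart :: "nat \<Rightarrow> (nat \<Rightarrow> real) \<Rightarrow> (nat \<Rightarrow> real) \<Rightarrow> (nat \<Rightarrow> real) \<times> (nat \<Rightarrow> real) \<Rightarrow> nat \<Rightarrow> real" where
  "prod_chart m p q = (\<lambda>(a, b) i. if i < 3 * m then chart m p a i else chart m q b (i - 3 * m))"

lemma matlas_prod_sph:
  "matlas (prod_mfd (sph m) (sph m)) =
     {(chart_dom m p \<times> chart_dom m q, prod_chart m p q) |p q. p \<in> spheres m \<and> q \<in> spheres m}"
proof (intro equalityI subsetI)
  fix x assume "x \<in> matlas (prod_mfd (sph m) (sph m))"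
  then obtain U \<phi> V \<psi> where x: "x = (U \<times> V, \<lambda>(p, q) i. if i < 3 * m then \<phi> p i else \<psi> q (i - 3 * m))"
    and U: "(U, \<phi>) \<in> matlas (sph m)" and V: "(V, \<psi>) \<in> matlas (sph m)"
    unfolding prod_mfd_def smooth_mfd.simps sph_simps mem_Collect_eq by blast
  obtain p where p: "p \<in> spheres m" "U = chart_dom m p" "\<phi> = chart m p" using U unfolding matlas_sph by blast
  obtain q where q: "q \<in> spheres m" "V = chart_dom m q" "\<psi> = chart m q" using V unfolding matlas_sph by blast
  show "x \<in> {(chart_dom m p \<times> chart_dom m q, prod_chart m p q) |p q. p \<in> spheres m \<and> q \<in> spheres m}"
  proof -
    have "x = (chart_dom m p \<times> chart_dom m q, prod_chart m p q)"
      unfolding x p(2,3) q(2,3) prod_chart_def ..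
    then show ?thesis using p(1) q(1) by blast
  qed
next
  fix x assume "x \<in> {(chart_dom m p \<times> chart_dom m q, prod_chart m p q) |p q. p \<in> spheres m \<and> q \<in> spheres m}"
  then obtain p q where x: "x = (chart_dom m p \<times> chart_dom m q, prod_chart m p q)"
    and p: "p \<in> spheres m" and q: "q \<in> spheres m" by blast
  have "(chart_dom m p, chart m p) \<in> matlas (sph m)" "(chart_dom m q, chart m q) \<in> matlas (sph m)"
    using p q unfolding matlas_sph by blast+
  then show "x \<in> matlas (prod_mfd (sph m) (sph m))"
    unfolding prod_mfd_def x prod_chart_def smooth_mfd.simps mem_Collect_eq sph_simps
    by blast
qed

lemma chart_ge: "i \<ge> 3 * m \<Longrightarrow> chart m p a i = 0"
  by (simp add: chart_def proj_def)

lemma prod_chart_inverse: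
  assumes p: "p \<in> spheres m" and q: "q \<in> spheres m"
  shows "x \<in> topspace (Euclidean_space (3 * m + 3 * m)) \<Longrightarrow> prod_inv m p q x \<in> chart_dom m p \<times> chart_dom m q"
    "x \<in> topspace (Euclidean_space (3 * m + 3 * m)) \<Longrightarrow> prod_chart m p q (prod_inv m p q x) = x"
    "z \<in> chart_dom m p \<times> chart_dom m q \<Longrightarrow> prod_inv m p q (prod_chart m p q z) = z"
    "prod_chart m p q z \<in> topspace (Euclidean_space (3 * m + 3 * m))"
proof -
  have E: "(\<lambda>i. if i < 3 * m then x i else 0) \<in> Es m" "(\<lambda>i. x (i + 3 * m)) \<in> Es m"
    if "x \<in> topspace (Euclidean_space (3 * m + 3 * m))" for x :: "nat \<Rightarrow> real"
    using that by (auto simp: topspace_Euclidean_space)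
  show "prod_inv m p q x \<in> chart_dom m p \<times> chart_dom m q" if "x \<in> topspace (Euclidean_space (3 * m + 3 * m))"
    using chart_gno(2)[OF p E(1)[OF that]] chart_gno(2)[OF q E(2)[OF that]] by (simp add: prod_inv_def)
  show "prod_chart m p q (prod_inv m p q x) = x" if "x \<in> topspace (Euclidean_space (3 * m + 3 * m))"
    using chart_gno(1)[OF p E(1)[OF that]] chart_gno(1)[OF q E(2)[OF that]]
    by (simp add: prod_inv_def prod_chart_def fun_eq_iff)
  show "prod_inv m p q (prod_chart m p q z) = z" if "z \<in> chart_dom m p \<times> chart_dom m q"
  proof -
    from that obtain a b where z: "z = (a, b)" "a \<in> chart_dom m p" "b \<in> chart_dom m q" by (cases z) auto
    have e: "(\<lambda>i. if i < 3 * m then prod_chart m p q z i else 0) = chart m p a"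
      "(\<lambda>i. prod_chart m p q z (i + 3 * m)) = chart m q b"
      by (auto simp: prod_chart_def z(1) fun_eq_iff chart_ge)
    show ?thesis unfolding prod_inv_def e gno_chart[OF p z(2)] gno_chart[OF q z(3)] using z(1) by simp
  qed
  show "prod_chart m p q z \<in> topspace (Euclidean_space (3 * m + 3 * m))"
    by (auto simp: prod_chart_def topspace_Euclidean_space chart_ge split: prod.split)
qed

text \<open>\<open>F\<close> is constrained only on the spheres, so the lemma serves both the group
  multiplication and the restricted action \<open>translation\<close>.\<close>

lemma smooth_map_qmul:
  assumes F: "\<And>a b. a \<in> spheres m \<Longrightarrow> b \<in> spheres m \<Longrightarrow> F (a, b) = qmul a b"
  shows "smooth_map (prod_mfd (sph m) (sph m)) (sph m) F"
  unfolding smooth_map_def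
proof (intro conjI)
  have cont: "continuous_on T (\<lambda>z. qmul (fst z) (snd z))" for T
    by (intro continuous_on_qmul continuous_on_fst continuous_on_snd continuous_on_id)
  have Fm: "F z = qmul (fst z) (snd z)" if "z \<in> spheres m \<times> spheres m" for z
    using F[of "fst z" "snd z"] that by auto
  have "continuous_on (spheres m \<times> spheres m) F = continuous_on (spheres m \<times> spheres m) (\<lambda>z. qmul (fst z) (snd z))"
    by (rule continuous_on_cong[OF refl Fm])
  moreover have "F z \<in> spheres m" if "z \<in> spheres m \<times> spheres m" for z
    unfolding Fm[OF that] by (rule qmul_in) (use that in auto)
  ultimately show "continuous_map (mtop (prod_mfd (sph m) (sph m))) (mtop (sph m)) F"
    using cont by (auto simp: prod_mfd_def continuous_map_in_subtopology simp del: split_paired_All)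
  show "\<forall>(U, \<phi>)\<in>matlas (prod_mfd (sph m) (sph m)). \<forall>(V, \<psi>)\<in>matlas (sph m). \<forall>i<mdim (sph m).
      smooth_real_on (mdim (prod_mfd (sph m) (sph m))) (\<phi> ` {p \<in> U. F p \<in> V}) (\<lambda>x. \<psi> (F (inv_into U \<phi> x)) i)"
  proof (clarify, unfold matlas_sph matlas_prod_sph, clarify)
    fix p q r i assume p: "p \<in> spheres m" and q: "q \<in> spheres m" and r: "r \<in> spheres m"
    let ?n = "3 * m + 3 * m"
    let ?E = "topspace (Euclidean_space ?n)"
    let ?U = "chart_dom m p \<times> chart_dom m q"
    note inv = prod_chart_inverse[OF p q]
    have inj: "inj_on (prod_chart m p q) ?U" by (rule inj_on_inverseI[of _ "prod_inv m p q"]) (rule inv(3))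
    have inv_into: "inv_into ?U (prod_chart m p q) x = prod_inv m p q x" if "x \<in> ?E" for x
      by (rule inv_into_f_eq[OF inj inv(1,2)[OF that]])
    let ?A = "\<lambda>x. qmul (qconj r) (qmul (fst (prod_inv m p q x)) (snd (prod_inv m p q x)))"
    let ?W = "{x \<in> ?E. \<forall>j<m. ?A x (ix0 j) > 0}"
    have EO: "openin (Euclidean_space ?n) ?E" by simp
    have s1: "smooth_real_on ?n ?E (\<lambda>x. (if i < 3 * m then x i else 0))" for i
      using Es_coord_smooth smooth_const[OF EO] by (cases "i < 3 * m") simp_all
    have s2: "smooth_real_on ?n ?E (\<lambda>x. fst (prod_inv m p q x) i)" "smooth_real_on ?n ?E (\<lambda>x. snd (prod_inv m p q x) i)" for i
      unfolding prod_inv_def fst_conv snd_conv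
      by (rule smooth_qmul[OF EO smooth_const[OF EO] smooth_gno[OF EO s1]])
        (rule smooth_qmul[OF EO smooth_const[OF EO] smooth_gno[OF EO Es_coord_smooth]])
    have s3: "smooth_real_on ?n ?E (\<lambda>x. ?A x i)" for i
      by (rule smooth_qmul[OF EO smooth_const[OF EO] smooth_qmul[OF EO s2]])
    have "continuous_on ?E ?A"
      by (rule continuous_on_seqI) (rule smooth_real_onD(1)[OF EO s3])
    then have W: "openin (Euclidean_space ?n) ?W" by (rule openin_blocks_pos)
    have dom: "prod_inv m p q x \<in> spheres m \<times> spheres m" if "x \<in> ?E" for x
      using inv(1)[OF that] by (auto simp: chart_dom_def)
    have FA: "F (prod_inv m p q x) \<in> chart_dom m r \<longleftrightarrow> (\<forall>j<m. ?A x (ix0 j) > 0)" if "x \<in> ?E" for x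
      unfolding Fm[OF dom[OF that]] chart_dom_def using qmul_in dom[OF that] by auto
    have img: "prod_chart m p q ` {z \<in> ?U. F z \<in> chart_dom m r} = ?W"
    proof (intro equalityI subsetI)
      fix x assume "x \<in> prod_chart m p q ` {z \<in> ?U. F z \<in> chart_dom m r}"
      then obtain z where z: "z \<in> ?U" "F z \<in> chart_dom m r" "x = prod_chart m p q z" by blast
      have "x \<in> ?E" using inv(4) z(3) by simp
      then show "x \<in> ?W" using FA[of x] inv(3)[OF z(1)] z(2,3) by simp
    next
      fix x assume x: "x \<in> ?W"
      then have xE: "x \<in> ?E" by simp
      show "x \<in> prod_chart m p q ` {z \<in> ?U. F z \<in> chart_dom m r}"
        by (rule image_eqI[where x="prod_inv m p q x"]) (use x inv(1,2)[OF xE] FA[OF xE] in auto)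
    qed
    have "smooth_real_on ?n ?W (\<lambda>x. ?A x i)" for i
      by (rule smooth_real_on_subset[OF _ _ s3]) auto
    then have "smooth_real_on ?n ?W (\<lambda>x. proj m (?A x) i)"
      by (rule smooth_proj[OF W]) auto
    then have "smooth_real_on ?n ?W (\<lambda>x. chart m r (F (inv_into ?U (prod_chart m p q) x)) i)"
      by (rule smooth_real_on_cong[OF W, rotated]) (simp add: inv_into Fm[OF dom] chart_def)
    then show "smooth_real_on (mdim (prod_mfd (sph m) (sph m))) (prod_chart m p q ` {z \<in> ?U. F z \<in> chart_dom m r})
        (\<lambda>x. chart m r (F (inv_into ?U (prod_chart m p q) x)) i)"
      unfolding img by (simp add: prod_mfd_def)
  qed
qed

definition sph_group :: "nat \<Rightarrow> (nat \<Rightarrow> real) monoid" where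
  "sph_group m = \<lparr>carrier = spheres m, mult = qmul, one = qone m\<rparr>"

lemma sph_group_simps [simp]:
  "carrier (sph_group m) = spheres m" "mult (sph_group m) = qmul" "one (sph_group m) = qone m"
  by (simp_all add: sph_group_def)

lemma group_sph_group: "group (sph_group m)"
proof (rule groupI)
  fix x assume x: "x \<in> carrier (sph_group m)"
  then have "qmul (qone m) x = x" by (intro qmul_qone_left spheresD(2)) simp_all
  then show "\<one>\<^bsub>sph_group m\<^esub> \<otimes>\<^bsub>sph_group m\<^esub> x = x" by simp
  show "\<exists>y\<in>carrier (sph_group m). y \<otimes>\<^bsub>sph_group m\<^esub> x = \<one>\<^bsub>sph_group m\<^esub>"
    by (rule bexI[of _ "qconj x"]) (use x qconj_in qmul_qconj in auto)
qed (simp_all add: qmul_in qone_in qmul_assoc)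

lemma inv_sph_group: "x \<in> spheres m \<Longrightarrow> inv\<^bsub>sph_group m\<^esub> x = qconj x"
  by (rule group.inv_equality[OF group_sph_group]) (simp_all add: qmul_qconj qconj_in)

lemma smooth_map_inv: "smooth_map (sph m) (sph m) (\<lambda>a. inv\<^bsub>sph_group m\<^esub> a)"
  unfolding smooth_map_def
proof (intro conjI)
  let ?F = "\<lambda>a. inv\<^bsub>sph_group m\<^esub> a"
  have "continuous_on (spheres m) ?F = continuous_on (spheres m) qconj"
    by (rule continuous_on_cong[OF refl inv_sph_group])
  then show "continuous_map (mtop (sph m)) (mtop (sph m)) ?F"
    using continuous_on_qconj[OF continuous_on_id] inv_sph_group qconj_in
    by (auto simp: continuous_map_in_subtopology)
  show "\<forall>(U, \<phi>)\<in>matlas (sph m). \<forall>(V, \<psi>)\<in>matlas (sph m). \<forall>i<mdim (sph m).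
      smooth_real_on (mdim (sph m)) (\<phi> ` {p \<in> U. ?F p \<in> V}) (\<lambda>x. \<psi> (?F (inv_into U \<phi> x)) i)"
  proof (clarify, unfold matlas_sph, clarify)
    fix p r i assume p: "p \<in> spheres m" and r: "r \<in> spheres m"
    let ?A = "\<lambda>x. qmul (qconj r) (qconj (qmul p (gno m x)))"
    let ?W = "{x \<in> Es m. \<forall>j<m. ?A x (ix0 j) > 0}"
    have s3: "smooth_real_on (3 * m) (Es m) (\<lambda>x. ?A x i)" for i
      by (rule smooth_qmul[OF openin_Es smooth_const[OF openin_Es] smooth_qconj[OF openin_Es smooth_qmul_gno]])
    have "continuous_on (Es m) ?A"
      by (rule continuous_on_seqI) (rule smooth_real_onD(1)[OF openin_Es s3])
    then have W: "openin (Euclidean_space (3 * m)) ?W" by (rule openin_blocks_pos)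
    have Fm: "?F (qmul p (gno m x)) = qconj (qmul p (gno m x))" for x
      by (rule inv_sph_group[OF qmul_in[OF p gno_in]])
    have FA: "?F (qmul p (gno m x)) \<in> chart_dom m r \<longleftrightarrow> (\<forall>j<m. ?A x (ix0 j) > 0)" for x
      unfolding Fm chart_dom_def using qconj_in[OF qmul_in[OF p gno_in]] by auto
    have img: "chart m p ` {z \<in> chart_dom m p. ?F z \<in> chart_dom m r} = ?W"
    proof (intro equalityI subsetI)
      fix x assume "x \<in> chart m p ` {z \<in> chart_dom m p. ?F z \<in> chart_dom m r}"
      then obtain z where z: "z \<in> chart_dom m p" "?F z \<in> chart_dom m r" "x = chart m p z" by blast
      have "x \<in> Es m" using proj_in z(3) by (simp add: chart_def)
      then show "x \<in> ?W" using FA[of x] gno_chart[OF p z(1)] z(2,3) by simp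
    next
      fix x assume x: "x \<in> ?W"
      then have xE: "x \<in> Es m" by simp
      show "x \<in> chart m p ` {z \<in> chart_dom m p. ?F z \<in> chart_dom m r}"
        by (rule image_eqI[where x="qmul p (gno m x)"]) (use x chart_gno[OF p xE] FA in auto)
    qed
    have "smooth_real_on (3 * m) ?W (\<lambda>x. ?A x i)" for i
      by (rule smooth_real_on_subset[OF _ _ s3]) auto
    then have "smooth_real_on (3 * m) ?W (\<lambda>x. proj m (?A x) i)"
      by (rule smooth_proj[OF W]) auto
    then have "smooth_real_on (3 * m) ?W (\<lambda>x. chart m r (?F (inv_into (chart_dom m p) (chart m p) x)) i)"
      by (rule smooth_real_on_cong[OF W, rotated]) (simp add: inv_chart[OF p] Fm chart_def)
    then show "smooth_real_on (mdim (sph m)) (chart m p ` {z \<in> chart_dom m p. ?F z \<in> chart_dom m r})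
        (\<lambda>x. chart m r (?F (inv_into (chart_dom m p) (chart m p) x)) i)"
      unfolding img by simp
  qed
qed

lemma lie_group_sph: "lie_group (sph_group m) (sph m)"
  unfolding lie_group_def
  using group_sph_group is_smooth_mfd_sph smooth_map_inv
  by (auto intro!: smooth_map_qmul)

text \<open>Restricted because the elements of \<open>BijGroup\<close> are extensional
  functions.\<close>

definition translation :: "nat \<Rightarrow> (nat \<Rightarrow> real) \<Rightarrow> (nat \<Rightarrow> real) \<Rightarrow> nat \<Rightarrow> real" where
  "translation m a = restrict (qmul a) (spheres m)"

lemma translation_apply: "p \<in> spheres m \<Longrightarrow> translation m a p = qmul a p"
  by (simp add: translation_def)

lemma translation_Bij:
  assumes a: "a \<in> spheres m"
  shows "translation m a \<in> Bij (spheres m)"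
proof -
  have "bij_betw (translation m a) (spheres m) (spheres m)"
    by (rule bij_betw_byWitness[where f'="qmul (qconj a)"])
      (use a qmul_in qconj_in[OF a] in \<open>auto simp: translation_apply qmul_qconj_cancel spheresD(2)\<close>)
  then show ?thesis by (simp add: Bij_def translation_def)
qed

lemma homogeneous_space_sph: "homogeneous_space (sph_group m) (sph m) (translation m) (sph m)"
  unfolding homogeneous_space_def
proof (intro conjI lie_group_sph is_smooth_mfd_sph)
  show "smooth_map (prod_mfd (sph m) (sph m)) (sph m) (\<lambda>(a, p). translation m a p)"
    by (rule smooth_map_qmul) (simp add: translation_apply)
  have hom: "translation m \<in> hom (sph_group m) (BijGroup (spheres m))"
  proof (rule homI)
    fix a b assume a: "a \<in> carrier (sph_group m)" and b: "b \<in> carrier (sph_group m)"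
    show "translation m a \<in> carrier (BijGroup (spheres m))"
      using a by (simp add: BijGroup_def translation_Bij)
    have "translation m (qmul a b) = compose (spheres m) (translation m a) (translation m b)"
      using b by (auto simp: fun_eq_iff compose_def translation_def qmul_in qmul_assoc)
    then show "translation m (a \<otimes>\<^bsub>sph_group m\<^esub> b) =
        translation m a \<otimes>\<^bsub>BijGroup (spheres m)\<^esub> translation m b"
      using a b by (simp add: BijGroup_def translation_Bij)
  qed
  have "group_action (sph_group m) (spheres m) (translation m)"
    using group_sph_group group_BijGroup hom
    by (simp add: group_action_def group_hom_def group_hom_axioms_def)
  moreover have "\<exists>g\<in>carrier (sph_group m). translation m g x = y" if x: "x \<in> spheres m" and y: "y \<in> spheres m" for x y
  proof (rule bexI[of _ "qmul y (qconj x)"])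
    show "translation m (qmul y (qconj x)) x = y"
      using qmul_qone_right[OF spheresD(2)[OF y]] by (simp add: translation_apply x qmul_assoc qmul_qconj(1)[OF x])
  qed (use x y qmul_in qconj_in in auto)
  ultimately show "transitive_action (sph_group m) (mpoints (sph m)) (translation m)"
    by (simp add: transitive_action_def transitive_action_axioms_def)
qed

section \<open>Compactness and connectedness\<close>

lemma compact_spheres: "compact (spheres m)"
proof -
  \<comment> \<open>Tychonoff's theorem for the cube of all sequences with entries between -1 and 1;
    the spheres are a closed subset of it.\<close>
  have "compactin (powertop_real UNIV) (Pi\<^sub>E UNIV (\<lambda>i. {-1..1::real}))"
    by (simp add: compactin_PiE)
  then have C: "compact (Pi\<^sub>E (UNIV :: nat set) (\<lambda>i. {-1..1::real}))"
    by (simp add: euclidean_product_topology)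
  have "spheres m = (\<Inter>j\<in>{..<m}. {q. qnorm2 q j = 1}) \<inter> (\<Inter>i\<in>{4 * m..}. {q. q i = 0})"
    by (auto simp: spheres_def)
  moreover have "closed {q. qnorm2 q j = 1}" for j
    by (intro closed_Collect_eq continuous_on_qnorm2 continuous_on_id continuous_on_const)
  moreover have "closed {q. q i = (0 :: real)}" for i :: nat
    by (intro closed_Collect_eq continuous_on_coord continuous_on_const)
  ultimately have "closed (spheres m)" by (simp add: closed_INT closed_Int)
  moreover have "spheres m \<subseteq> Pi\<^sub>E UNIV (\<lambda>i. {-1..1})"
  proof
    fix q assume q: "q \<in> spheres m"
    have sq: "\<bar>q i\<bar> \<le> 1" if "(q i)\<^sup>2 \<le> qnorm2 q j" "q i = 0 \<or> j < m" for i j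
      using that spheresD(1)[OF q, of j] abs_square_le_1[of "q i"] by auto
    have "\<bar>q i\<bar> \<le> 1" for i
    proof (rule quat_cases[of _ i])
      fix j
      have z: "q i = 0" if "i div 4 = j" "\<not> j < m" for i
        using spheresD(2)[OF q, of i] that by (cases "4 * m \<le> i") auto
      show "\<bar>q (ix0 j)\<bar> \<le> 1" by (rule sq[of _ j]) (auto simp: qnorm2_def z)
      show "\<bar>q (ix1 j)\<bar> \<le> 1" by (rule sq[of _ j]) (auto simp: qnorm2_def z)
      show "\<bar>q (ix2 j)\<bar> \<le> 1" by (rule sq[of _ j]) (auto simp: qnorm2_def z)
      show "\<bar>q (ix3 j)\<bar> \<le> 1" by (rule sq[of _ j]) (auto simp: qnorm2_def z)
    qed
    then show "q \<in> Pi\<^sub>E UNIV (\<lambda>i. {-1..1})" by (simp add: PiE_def Pi_def abs_le_iff minus_le_iff)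
  qed
  ultimately show ?thesis using compact_Int_closed[OF C, of "spheres m"] by (simp add: Int_absorb1)
qed

text \<open>Hopf coordinates on each three-sphere: two angles in orthogonal planes and a third that
  distributes the norm between the planes. They exhibit the product of spheres as a continuous image
  of a connected coordinate space.\<close>

definition hopf :: "nat \<Rightarrow> (nat \<Rightarrow> real) \<Rightarrow> nat \<Rightarrow> real" where
  "hopf m x i = (let j = i div 4 in if i < 4 * m then
     if i mod 4 = 0 then cos (x (tx0 j)) * cos (x (tx1 j))
     else if i mod 4 = 1 then sin (x (tx0 j)) * cos (x (tx1 j))
     else if i mod 4 = 2 then cos (x (tx2 j)) * sin (x (tx1 j))
     else sin (x (tx2 j)) * sin (x (tx1 j)) else 0)"

lemma hopf_simps:
  "hopf m x (ix0 j) = (if j < m then cos (x (tx0 j)) * cos (x (tx1 j)) else 0)"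
  "hopf m x (ix1 j) = (if j < m then sin (x (tx0 j)) * cos (x (tx1 j)) else 0)"
  "hopf m x (ix2 j) = (if j < m then cos (x (tx2 j)) * sin (x (tx1 j)) else 0)"
  "hopf m x (ix3 j) = (if j < m then sin (x (tx2 j)) * sin (x (tx1 j)) else 0)"
  by (simp_all add: hopf_def Let_def)

text \<open>Polar coordinates in the planes of (a, b) and (c, d); the two radii, possibly negative,
  form a unit vector and are a cosine and a sine themselves.\<close>

lemma hopf_coordinates:
  assumes "a\<^sup>2 + b\<^sup>2 + c\<^sup>2 + d\<^sup>2 = (1 :: real)"
  shows "\<exists>u v w. a = cos u * cos v \<and> b = sin u * cos v \<and> c = cos w * sin v \<and> d = sin w * sin v"
proof -
  obtain r u where r: "a = r * cos u" "b = r * sin u" using polar_Ex by blast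
  obtain s w where s: "c = s * cos w" "d = s * sin w" using polar_Ex by blast
  have "a\<^sup>2 + b\<^sup>2 = r\<^sup>2 * ((cos u)\<^sup>2 + (sin u)\<^sup>2)" "c\<^sup>2 + d\<^sup>2 = s\<^sup>2 * ((cos w)\<^sup>2 + (sin w)\<^sup>2)"
    by (simp_all only: r s power_mult_distrib distrib_left)
  then have "a\<^sup>2 + b\<^sup>2 = r\<^sup>2" "c\<^sup>2 + d\<^sup>2 = s\<^sup>2" by simp_all
  then have "r\<^sup>2 + s\<^sup>2 = 1" using assms by simp
  then obtain v where "r = cos v" "s = sin v" using sincos_total_2pi by blast
  then show ?thesis using r s by (intro exI[of _ u] exI[of _ v] exI[of _ w]) simp
qed

lemma connected_spheres: "connected (spheres m)"
proof -
  have "hopf m ` Es m = spheres m"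
  proof (intro equalityI subsetI)
    fix q assume "q \<in> hopf m ` Es m"
    then obtain x where q: "q = hopf m x" by blast
    have "qnorm2 q j = 1" if "j < m" for j
    proof -
      have "qnorm2 q j = ((cos (x (tx0 j)))\<^sup>2 + (sin (x (tx0 j)))\<^sup>2) * (cos (x (tx1 j)))\<^sup>2
          + ((cos (x (tx2 j)))\<^sup>2 + (sin (x (tx2 j)))\<^sup>2) * (sin (x (tx1 j)))\<^sup>2"
        using that by (simp only: q qnorm2_def hopf_simps if_True power_mult_distrib distrib_right add.assoc)
      then show ?thesis by simp
    qed
    then show "q \<in> spheres m" by (simp add: spheres_def) (simp add: q hopf_def)
  next
    fix q assume q: "q \<in> spheres m"
    have "\<forall>j. \<exists>u v w. j < m \<longrightarrow> q (ix0 j) = cos u * cos v \<and> q (ix1 j) = sin u * cos v \<and>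
        q (ix2 j) = cos w * sin v \<and> q (ix3 j) = sin w * sin v"
      using hopf_coordinates spheresD(1)[OF q, unfolded qnorm2_def] by blast
    then obtain u v w where uvw: "\<And>j. j < m \<Longrightarrow> q (ix0 j) = cos (u j) * cos (v j) \<and> q (ix1 j) = sin (u j) * cos (v j) \<and>
        q (ix2 j) = cos (w j) * sin (v j) \<and> q (ix3 j) = sin (w j) * sin (v j)" by metis
    define x where "x i = (if i < 3 * m then if i mod 3 = 0 then u (i div 3) else if i mod 3 = 1 then v (i div 3)
        else w (i div 3) else 0)" for i
    have x: "x (tx0 j) = u j" "x (tx1 j) = v j" "x (tx2 j) = w j" if "j < m" for j
      using that by (simp_all add: x_def)
    have "hopf m x i = q i" for i
      by (rule quat_cases[of _ i]) (auto simp: hopf_simps x uvw spheresD(2)[OF q] not_less)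
    then have "q = hopf m x" by (simp add: fun_eq_iff)
    moreover have "x \<in> Es m" by (simp add: x_def topspace_Euclidean_space)
    ultimately show "q \<in> hopf m ` Es m" by blast
  qed
  moreover have "continuous_on (Es m) (hopf m)"
  proof (rule continuous_on_seqI)
    have c1: "continuous_on T (\<lambda>x. cos (x j :: real))" for T and j :: nat
      by (rule continuous_on_cos[OF continuous_on_coord])
    have c2: "continuous_on T (\<lambda>x. sin (x j :: real))" for T and j :: nat
      by (rule continuous_on_sin[OF continuous_on_coord])
    have ci: "continuous_on T f \<Longrightarrow> continuous_on T (\<lambda>x. if b then f x else (0 :: real))"
      for T :: "(nat \<Rightarrow> real) set" and f b by (cases b) simp_all
    show "continuous_on (Es m) (\<lambda>x. hopf m x i)" for i
      by (rule quat_cases[of _ i]; unfold hopf_simps; intro ci continuous_on_mult c1 c2)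
  qed
  moreover have "connected (Es m)"
    using connected_Euclidean_space[of "3 * m"]
    by (metis Euclidean_space_top_of_set connectedin_iff_connected connectedin_subtopology connectedin_topspace
        topspace_euclidean_subtopology)
  ultimately show ?thesis using connected_continuous_image by metis
qed

subsection \<open>Left-invariant vector fields\<close>

interpretation sph: smooth_manifold "sph m" for m
  by standard (rule is_smooth_mfd_sph)

text \<open>The imaginary unit belonging to coordinate \<open>i\<close>, as a tangent vector at the
  identity.\<close>

definition eu :: "nat \<Rightarrow> nat \<Rightarrow> real" where
  "eu i l = (if l = cidx i then 1 else 0)"

lemma eu_simps:
  "eu (tx0 j) (ix0 k) = 0" "eu (tx1 j) (ix0 k) = 0" "eu (tx2 j) (ix0 k) = 0"
  "eu (tx0 j) (ix1 k) = (if k = j then 1 else 0)" "eu (tx1 j) (ix1 k) = 0" "eu (tx2 j) (ix1 k) = 0"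
  "eu (tx0 j) (ix2 k) = 0" "eu (tx1 j) (ix2 k) = (if k = j then 1 else 0)" "eu (tx2 j) (ix2 k) = 0"
  "eu (tx0 j) (ix3 k) = 0" "eu (tx1 j) (ix3 k) = 0" "eu (tx2 j) (ix3 k) = (if k = j then 1 else 0)"
  by (simp_all add: eu_def cidx_simps)

lemma tx_neq [simp]:
  "tx0 j \<noteq> tx1 k" "tx0 j \<noteq> tx2 k" "tx1 j \<noteq> tx0 k" "tx1 j \<noteq> tx2 k" "tx2 j \<noteq> tx0 k" "tx2 j \<noteq> tx1 k"
  "tx0 j = tx0 k \<longleftrightarrow> j = k" "tx1 j = tx1 k \<longleftrightarrow> j = k" "tx2 j = tx2 k \<longleftrightarrow> j = k"
  unfolding tx0_def tx1_def tx2_def by presburger+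

lemma lift1_unit:
  assumes "i < 3 * m"
  shows "lift1 m ((\<lambda>_. 0)(i := t)) l = qone m l + t * eu i l"
proof -
  have "i < 3 * m \<longrightarrow> lift1 m ((\<lambda>_. 0)(i := t)) l = qone m l + t * eu i l"
  proof (rule triple_cases[of _ i])
    show "tx0 j < 3 * m \<longrightarrow> lift1 m ((\<lambda>_. 0)(tx0 j := t)) l = qone m l + t * eu (tx0 j) l" for j
      by (rule quat_cases[of _ l]) (auto simp: lift1_simps eu_simps qone_simps)
    show "tx1 j < 3 * m \<longrightarrow> lift1 m ((\<lambda>_. 0)(tx1 j := t)) l = qone m l + t * eu (tx1 j) l" for j
      by (rule quat_cases[of _ l]) (auto simp: lift1_simps eu_simps qone_simps)
    show "tx2 j < 3 * m \<longrightarrow> lift1 m ((\<lambda>_. 0)(tx2 j := t)) l = qone m l + t * eu (tx2 j) l" for j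
      by (rule quat_cases[of _ l]) (auto simp: lift1_simps eu_simps qone_simps)
  qed
  then show ?thesis using assms by blast
qed

lemma qnorm2_lift1_unit:
  assumes "i < 3 * m" "j < m"
  shows "qnorm2 (lift1 m ((\<lambda>_. 0)(i := t))) j = 1 + (if j = i div 3 then t\<^sup>2 else 0)"
proof -
  have "i < 3 * m \<longrightarrow> qnorm2 (lift1 m ((\<lambda>_. 0)(i := t))) j = 1 + (if j = i div 3 then t\<^sup>2 else 0)"
    by (rule triple_cases[of _ i]) (use assms(2) in \<open>auto simp: qnorm2_def lift1_simps\<close>)
  then show ?thesis using assms by blast
qed

lemma gno_alt: "gno m y = (\<lambda>i. lift1 m y i / sqrt (qnorm2 (lift1 m y) (i div 4)))"
  by (rule ext) (rule gno_def)

lemma gno_0: "gno m (\<lambda>_. 0) = qone m"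
proof
  show "gno m (\<lambda>_. 0) i = qone m i" for i
    by (rule quat_cases[of _ i]) (auto simp: gno_def lift1_simps qnorm2_def qone_simps)
qed

lemma qmul_gno_0: "p \<in> spheres m \<Longrightarrow> qmul p (gno m (\<lambda>_. 0)) = p"
  unfolding gno_0 by (rule qmul_qone_right[OF spheresD(2)])

text \<open>The norm in the normalisation is the root of 1 or of 1 + t^2, so it contributes nothing
  to first order at 0.\<close>

lemma DERIV_gno_0:
  assumes i: "i < 3 * m"
  shows "((\<lambda>t. gno m ((\<lambda>_. 0)(i := t)) l) has_field_derivative eu i l) (at 0)"
proof (cases "l < 4 * m")
  case True
  then have l: "l div 4 < m" by auto
  have "gno m ((\<lambda>_. 0)(i := t)) l = (qone m l + t * eu i l) / sqrt (1 + (if l div 4 = i div 3 then t\<^sup>2 else 0))" for t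
    unfolding gno_def lift1_unit[OF i] qnorm2_lift1_unit[OF i l] ..
  then show ?thesis
    by (cases "l div 4 = i div 3") (auto intro!: derivative_eq_intros)
next
  case False
  then have "eu i l = 0" using cidx_less[OF i] by (auto simp: eu_def)
  then show ?thesis using False by (simp add: gno_zero)
qed

lemma DERIV_qmul_right:
  assumes "\<And>i. ((\<lambda>t. B t i) has_field_derivative B' i) (at s)"
  shows "((\<lambda>t. qmul a (B t) i) has_field_derivative qmul a B' i) (at s)"
  by (rule quat_cases[of _ i]; unfold qmul_simps; intro DERIV_add DERIV_diff DERIV_cmult assms)

lemma DERIV_qmul_left:
  assumes "\<And>i. ((\<lambda>t. B t i) has_field_derivative B' i) (at s)"
  shows "((\<lambda>t. qmul (B t) a i) has_field_derivative qmul B' a i) (at s)"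
  by (rule quat_cases[of _ i]; unfold qmul_simps; intro DERIV_add DERIV_diff DERIV_cmult_right assms)

lemma smooth_funs_sph_iff:
  "f \<in> smooth_funs (sph m) \<longleftrightarrow> (\<forall>p\<in>spheres m. smooth_real_on (3 * m) (Es m) (\<lambda>x. f (qmul p (gno m x))))"
proof -
  have "smooth_real_on (3 * m) (Es m) (\<lambda>x. f (inv_into (chart_dom m p) (chart m p) x)) \<longleftrightarrow>
      smooth_real_on (3 * m) (Es m) (\<lambda>x. f (qmul p (gno m x)))" if p: "p \<in> spheres m" for p
    using smooth_real_on_cong[OF openin_Es, of m "\<lambda>x. f (inv_into (chart_dom m p) (chart m p) x)" "\<lambda>x. f (qmul p (gno m x))"]
      smooth_real_on_cong[OF openin_Es, of m "\<lambda>x. f (qmul p (gno m x))" "\<lambda>x. f (inv_into (chart_dom m p) (chart m p) x)"]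
    by (auto simp: inv_chart[OF p])
  moreover have "matlas (sph m) = (\<lambda>p. (chart_dom m p, chart m p)) ` spheres m"
    by (auto simp: sph_def)
  then have "f \<in> smooth_funs (sph m) \<longleftrightarrow>
      (\<forall>p\<in>spheres m. smooth_real_on (3 * m) (chart m p ` chart_dom m p) (\<lambda>x. f (inv_into (chart_dom m p) (chart m p) x)))"
    by (simp add: smooth_funs_def)
  ultimately show ?thesis by (simp add: chart_image)
qed

lemma smooth_funs_sphD:
  "f \<in> smooth_funs (sph m) \<Longrightarrow> p \<in> spheres m \<Longrightarrow> smooth_real_on (3 * m) (Es m) (\<lambda>x. f (qmul p (gno m x)))"
  by (simp add: smooth_funs_sph_iff)

text \<open>The left-invariant field with value \<open>eu i\<close> at the identity. It
  differentiates along the coordinate line of the chart centred at the very point \<open>p\<close>;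
  the value 0 for nonsmooth \<open>f\<close> is the convention of \<open>tspace\<close>.\<close>

definition lef :: "nat \<Rightarrow> nat \<Rightarrow> (nat \<Rightarrow> real) vfield" where
  "lef m i p f = (if p \<in> spheres m \<and> f \<in> smooth_funs (sph m)
     then coord_deriv i (\<lambda>x. f (qmul p (gno m x))) (\<lambda>_. 0) else 0)"

lemma lef_eqI:
  assumes "p \<in> spheres m" "f \<in> smooth_funs (sph m)"
    "((\<lambda>t. f (qmul p (gno m ((\<lambda>_. 0)(i := t))))) has_field_derivative d) (at 0)"
  shows "lef m i p f = d"
  using coord_derivI[of "\<lambda>x. f (qmul p (gno m x))" "\<lambda>_. 0" i d] assms by (simp add: lef_def)

lemma lef_DERIV:
  assumes p: "p \<in> spheres m" and f: "f \<in> smooth_funs (sph m)" and i: "i < 3 * m"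
  shows "((\<lambda>t. f (qmul p (gno m ((\<lambda>_. 0)(i := t))))) has_field_derivative lef m i p f) (at 0)"
  using smooth_real_onD(2)[OF openin_Es smooth_funs_sphD[OF f p] i, of "\<lambda>_. 0"] p f
  by (simp add: lef_def topspace_Euclidean_space)

lemma lef_tspace:
  assumes p: "p \<in> spheres m" and i: "i < 3 * m"
  shows "lef m i p \<in> tspace (sph m) p"
proof (rule sph.tspaceI)
  fix f h :: "(nat \<Rightarrow> real) \<Rightarrow> real" and a b
  show "lef m i p f = 0" if "f \<notin> smooth_funs (sph m)" using that by (simp add: lef_def)
  assume f: "f \<in> smooth_funs (sph m)" and h: "h \<in> smooth_funs (sph m)"
  note D = lef_DERIV[OF p f i] lef_DERIV[OF p h i]
  have "(\<lambda>_. 0)(i := 0) = (\<lambda>_. 0 :: real)" by auto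
  then have p0: "qmul p (gno m ((\<lambda>_. 0)(i := 0))) = p" by (simp only: qmul_gno_0[OF p])
  show "lef m i p (\<lambda>x. a * f x + b * h x) = a * lef m i p f + b * lef m i p h"
    by (rule lef_eqI[OF p sph.smooth_funs_add[OF sph.smooth_funs_mult[OF sph.smooth_funs_const f]
            sph.smooth_funs_mult[OF sph.smooth_funs_const h]] DERIV_add[OF DERIV_cmult[OF D(1)] DERIV_cmult[OF D(2)]]])
  show "lef m i p (\<lambda>x. f x * h x) = lef m i p f * h p + f p * lef m i p h"
    using lef_eqI[OF p sph.smooth_funs_mult[OF f h] DERIV_mult[OF D]] unfolding p0 by (simp add: mult.commute)
qed

text \<open>In the chart at \<open>p\<close> the left-invariant fields have polynomial coefficients, because scaling a
  block by a positive factor does not change its central projection.\<close>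

definition lef_coeff :: "nat \<Rightarrow> nat \<Rightarrow> nat \<Rightarrow> (nat \<Rightarrow> real) \<Rightarrow> real" where
  "lef_coeff m i k x = qmul (lift1 m x) (eu i) (cidx k) - x k * qmul (lift1 m x) (eu i) (ix0 (k div 3))"

lemma lef_chart:
  assumes p: "p \<in> spheres m" and f: "f \<in> smooth_funs (sph m)" and i: "i < 3 * m" and x: "x \<in> Es m"
  shows "lef m i (qmul p (gno m x)) f =
    (\<Sum>k<3 * m. coord_deriv k (\<lambda>x. f (qmul p (gno m x))) x * lef_coeff m i k x)"
proof (rule lef_eqI[OF qmul_in[OF p gno_in] f])
  let ?F = "\<lambda>x. f (qmul p (gno m x))"
  define w where "w = qmul (lift1 m x) (eu i)"
  \<comment> \<open>Up to a positive factor in each block, the curve that defines the field is this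
    straight line, and \<open>z\<close> is its central projection.\<close>
  define r where "r t = (\<lambda>l. lift1 m x l + t * w l)" for t
  define z where "z t = proj m (r t)" for t
  let ?g = "\<lambda>t. gno m ((\<lambda>_. 0)(i := t))"
  have r_eq: "qmul (lift1 m x) (lift1 m ((\<lambda>_. 0)(i := t))) = r t" for t
  proof
    fix l
    have "lift1 m ((\<lambda>_. 0)(i := t)) = (\<lambda>l. 1 * qone m l + t * eu i l)" by (simp add: fun_eq_iff lift1_unit[OF i])
    then have "qmul (lift1 m x) (lift1 m ((\<lambda>_. 0)(i := t))) l
        = 1 * qmul (lift1 m x) (qone m) l + t * qmul (lift1 m x) (eu i) l"
      by (simp only: qmul_lin(1))
    then show "qmul (lift1 m x) (lift1 m ((\<lambda>_. 0)(i := t))) l = r t l"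
      by (simp add: r_def w_def qmul_qone_right[OF lift1_zero])
  qed
  define s where "s t j = sqrt (qnorm2 (lift1 m x) j) * sqrt (qnorm2 (lift1 m ((\<lambda>_. 0)(i := t))) j)" for t j
  have s_pos: "s t j > 0" if "j < m" for t j
    unfolding s_def by (intro mult_pos_pos sqrt_qnorm2_lift1 that)
  have prod: "qmul (gno m x) (?g t) l = r t l / s t (l div 4)" for t l
  proof -
    have "qmul (gno m x) (?g t) l = qmul (gno m x) (lift1 m ((\<lambda>_. 0)(i := t))) l
        / sqrt (qnorm2 (lift1 m ((\<lambda>_. 0)(i := t))) (l div 4))"
      unfolding gno_alt[of m "(\<lambda>_. 0)(i := t)"]
      by (rule qmul_block_scale(1)[of _ _ "\<lambda>j. sqrt (qnorm2 (lift1 m ((\<lambda>_. 0)(i := t))) j)"])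
    also have "qmul (gno m x) (lift1 m ((\<lambda>_. 0)(i := t))) l = r t l / sqrt (qnorm2 (lift1 m x) (l div 4))"
      unfolding gno_alt[of m x] r_eq[symmetric]
      by (rule qmul_block_scale(2)[of _ "\<lambda>j. sqrt (qnorm2 (lift1 m x) j)"])
    finally show ?thesis unfolding s_def divide_divide_eq_left .
  qed
  have z_prod: "proj m (qmul (gno m x) (?g t)) = z t" for t
  proof -
    have nz: "s t j \<noteq> 0" if "j < m" for j using s_pos[OF that, of t] by linarith
    have "qmul (gno m x) (?g t) = (\<lambda>l. r t l / s t (l div 4))" by (rule ext) (rule prod)
    then show ?thesis unfolding z_def by (simp only: proj_block_div[of m "s t", OF nz])
  qed
  \<comment> \<open>The curve is recovered from its projection while its real parts are positive,
    which by \<open>ev\<close> holds for all small \<open>t\<close>.\<close>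
  have gz: "qmul (gno m x) (?g t) = gno m (z t)" if "\<And>j. j < m \<Longrightarrow> r t (ix0 j) > 0" for t
  proof -
    have "qmul (gno m x) (?g t) (ix0 j) > 0" if "j < m" for j
      unfolding prod using \<open>\<And>j. j < m \<Longrightarrow> r t (ix0 j) > 0\<close>[OF that] s_pos[OF that] by simp
    from gno_proj[OF qmul_in[OF gno_in gno_in] this] show ?thesis unfolding z_prod ..
  qed
  have ev: "\<forall>\<^sub>F t in nhds 0. \<forall>j\<in>{..<m}. r t (ix0 j) > 0"
  proof (rule eventually_ball_finite)
    show "\<forall>j\<in>{..<m}. \<forall>\<^sub>F t in nhds 0. r t (ix0 j) > 0"
    proof
      fix j assume "j \<in> {..<m}"
      then have "r t (ix0 j) = 1 + t * w (ix0 j)" for t by (simp add: r_def lift1_simps)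
      moreover have "open {t. 0 < 1 + t * w (ix0 j)}"
        by (intro open_Collect_less continuous_on_add continuous_on_mult continuous_on_const continuous_on_id)
      ultimately have "open {t. 0 < r t (ix0 j)}" "0 \<in> {t. 0 < r t (ix0 j)}" by simp_all
      then show "\<forall>\<^sub>F t in nhds 0. r t (ix0 j) > 0" by (auto simp: eventually_nhds)
    qed
  qed simp
  have z0: "z 0 = x" by (simp add: z_def r_def proj_lift1[OF x])
  have zD: "((\<lambda>t. z t k) has_field_derivative lef_coeff m i k x) (at 0)" if k: "k < 3 * m" for k
  proof -
    have j: "k div 3 < m" using k by auto
    \<comment> \<open>The projected line is linear-fractional in \<open>t\<close>; the quotient rule
      at 0 gives the polynomial \<open>lef_coeff\<close>.\<close>
    have "z t k = (x k + t * w (cidx k)) / (1 + t * w (ix0 (k div 3)))" for t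
      using k j by (simp add: z_def proj_def r_def lift1_cidx lift1_simps)
    moreover have "((\<lambda>t. (x k + t * w (cidx k)) / (1 + t * w (ix0 (k div 3)))) has_field_derivative
        w (cidx k) - x k * w (ix0 (k div 3))) (at 0)"
      by (auto intro!: derivative_eq_intros)
    ultimately show ?thesis by (simp add: lef_coeff_def w_def)
  qed
  have F1: "Ck_on 1 (3 * m) (Es m) ?F"
    using smooth_funs_sphD[OF f p] smooth_real_on_iff_Ck[OF openin_Es] by blast
  have "((\<lambda>t. ?F (z t)) has_field_derivative (\<Sum>k<3 * m. coord_deriv k ?F (z 0) * lef_coeff m i k x)) (at 0)"
    by (rule has_field_derivative_along_curve[OF openin_Es F1 zD]) (simp_all add: z_def proj_in)
  moreover have "\<forall>\<^sub>F t in nhds 0. ?F (z t) = f (qmul (qmul p (gno m x)) (?g t))"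
    using ev by eventually_elim (simp add: gz qmul_assoc)
  ultimately show "((\<lambda>t. f (qmul (qmul p (gno m x)) (?g t))) has_field_derivative
      (\<Sum>k<3 * m. coord_deriv k ?F x * lef_coeff m i k x)) (at 0)"
    using DERIV_cong_ev[of 0 0 "\<lambda>t. ?F (z t)" "\<lambda>t. f (qmul (qmul p (gno m x)) (?g t))"] unfolding z0 by blast
qed

lemma lef_smooth:
  assumes f: "f \<in> smooth_funs (sph m)" and i: "i < 3 * m"
  shows "(\<lambda>p. lef m i p f) \<in> smooth_funs (sph m)"
  unfolding smooth_funs_sph_iff
proof
  fix p assume p: "p \<in> spheres m"
  have co: "smooth_real_on (3 * m) (Es m) (lef_coeff m i k)" for k
    unfolding lef_coeff_def[abs_def]
    by (intro smooth_diff[OF openin_Es] smooth_mult[OF openin_Es] smooth_qmul[OF openin_Es] smooth_lift1[OF openin_Es]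
        smooth_const[OF openin_Es] Es_coord_smooth)
  have "smooth_real_on (3 * m) (Es m) (\<lambda>x. \<Sum>k<3 * m. coord_deriv k (\<lambda>x. f (qmul p (gno m x))) x * lef_coeff m i k x)"
    by (rule smooth_sum[OF openin_Es], rule smooth_mult[OF openin_Es smooth_real_onD(3)[OF openin_Es smooth_funs_sphD[OF f p]] co]) simp
  then show "smooth_real_on (3 * m) (Es m) (\<lambda>x. lef m i (qmul p (gno m x)) f)"
    by (rule smooth_real_on_cong[OF openin_Es, rotated]) (simp add: lef_chart[OF p f i])
qed

lemma lef_vfield: "i < 3 * m \<Longrightarrow> lef m i \<in> vfields (sph m)"
  by (rule sph.vfieldsI) (simp_all add: lef_tspace lef_smooth, simp add: lef_def[abs_def])

lemma smooth_funs_qmul: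
  "(\<lambda>q. qmul a q l) \<in> smooth_funs (sph m)" "(\<lambda>q. qmul (qmul a q) b l) \<in> smooth_funs (sph m)"
  unfolding smooth_funs_sph_iff
  by (intro ballI smooth_qmul[OF openin_Es] smooth_const[OF openin_Es] smooth_qmul_gno)+

lemma smooth_funs_entry: "(\<lambda>q. q l) \<in> smooth_funs (sph m)"
  unfolding smooth_funs_sph_iff using smooth_qmul_gno by blast

lemma lef_qmul:
  assumes p: "p \<in> spheres m" and i: "i < 3 * m"
  shows "lef m i p (\<lambda>q. qmul a q l) = qmul a (qmul p (eu i)) l"
    "lef m i p (\<lambda>q. qmul (qmul a q) b l) = qmul (qmul a (qmul p (eu i))) b l"
  by (rule lef_eqI[OF p smooth_funs_qmul(1)], intro DERIV_qmul_right DERIV_gno_0[OF i])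
    (rule lef_eqI[OF p smooth_funs_qmul(2)], intro DERIV_qmul_left DERIV_qmul_right DERIV_gno_0[OF i])

subsection \<open>Tangent spaces are spanned by the left-invariant fields\<close>

lemma cidx_eq_iff: "cidx i = cidx k \<longleftrightarrow> i = k"
  by (rule triple_cases[of _ i]; rule triple_cases[of _ k]) (simp_all add: cidx_simps)

text \<open>The left Maurer-Cartan form: \<open>v\<close> applied to an imaginary entry of the
  translate of \<open>q\<close> that moves \<open>p\<close> to the identity.\<close>

definition cof :: "nat \<Rightarrow> (nat \<Rightarrow> real) \<Rightarrow> (nat \<Rightarrow> real) tvec \<Rightarrow> real" where
  "cof i p v = v (\<lambda>q. qmul (qconj p) q (cidx i))"

lemma eu_zero: "i < 3 * m \<Longrightarrow> l \<ge> 4 * m \<Longrightarrow> eu i l = 0"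
  using cidx_less[of i m] by (auto simp: eu_def)

lemma qmul_qconj_eu: "p \<in> spheres m \<Longrightarrow> k < 3 * m \<Longrightarrow> qmul (qconj p) (qmul p (eu k)) = eu k"
  by (rule qmul_qconj_cancel(1)) (auto intro: eu_zero)

lemma cof_lef:
  assumes p: "p \<in> spheres m" and k: "k < 3 * m"
  shows "cof i p (lef m k p) = (if i = k then 1 else 0)"
  unfolding cof_def lef_qmul(1)[OF p k] qmul_qconj_eu[OF p k]
  by (simp add: eu_def cidx_eq_iff)

text \<open>The threshold 1/2 lies strictly between the real part 1 at the centre and the real part
  0 at the boundary of the chart domain, so the bump vanishes near that boundary.\<close>

definition bump :: "nat \<Rightarrow> (nat \<Rightarrow> real) \<Rightarrow> (nat \<Rightarrow> real) \<Rightarrow> real" where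
  "bump m p q = (\<Prod>j<m. cutoff (qmul (qconj p) q (ix0 j) - 1 / 2))"

definition bump_ext :: "nat \<Rightarrow> (nat \<Rightarrow> real) \<Rightarrow> ((nat \<Rightarrow> real) \<Rightarrow> real) \<Rightarrow> (nat \<Rightarrow> real) \<Rightarrow> real" where
  "bump_ext m p K q = (if q \<in> chart_dom m p then bump m p q * K (chart m p q) else 0)"

lemma bump_smooth_chart:
  "smooth_real_on (3 * m) (Es m) (\<lambda>x. bump m p (qmul r (gno m x)))"
  unfolding bump_def
  by (rule smooth_prod[OF openin_Es], rule smooth_cutoff[OF openin_Es], rule smooth_diff[OF openin_Es],
      rule smooth_qmul[OF openin_Es smooth_const[OF openin_Es] smooth_qmul_gno], rule smooth_const[OF openin_Es])

lemma bump_smooth: "bump m p \<in> smooth_funs (sph m)"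
  unfolding smooth_funs_sph_iff using bump_smooth_chart by blast

lemma bump_pos: "p \<in> spheres m \<Longrightarrow> bump m p p > 0"
  unfolding bump_def by (rule prod_pos) (simp add: qmul_qconj qone_simps cutoff_pos)

lemma bump_zero: "j < m \<Longrightarrow> qmul (qconj p) q (ix0 j) \<le> 1 / 2 \<Longrightarrow> bump m p q = 0"
  unfolding bump_def by (rule prod_zero) (auto intro!: bexI[of _ j] cutoff_eq_0)

lemma bump_ext_smooth:
  assumes p: "p \<in> spheres m" and K: "smooth_real_on (3 * m) (Es m) K"
  shows "bump_ext m p K \<in> smooth_funs (sph m)"
  unfolding smooth_funs_sph_iff
proof
  fix r assume r: "r \<in> spheres m"
  let ?A = "\<lambda>x. qmul (qconj p) (qmul r (gno m x))"
  have As: "smooth_real_on (3 * m) (Es m) (\<lambda>x. ?A x i)" for i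
    by (rule smooth_qmul[OF openin_Es smooth_const[OF openin_Es] smooth_qmul_gno])
  have Ac: "continuous_on (Es m) ?A"
    by (rule continuous_on_seqI) (rule smooth_real_onD(1)[OF openin_Es As])
  have rS: "qmul r (gno m x) \<in> spheres m" for x by (rule qmul_in[OF r gno_in])
  show "smooth_real_on (3 * m) (Es m) (\<lambda>x. bump_ext m p K (qmul r (gno m x)))"
  proof (rule smooth_real_on_local[OF _ openin_Es])
    fix x assume x: "x \<in> Es m"
    show "\<exists>V. openin (Euclidean_space (3 * m)) V \<and> x \<in> V \<and>
        smooth_real_on (3 * m) V (\<lambda>x. bump_ext m p K (qmul r (gno m x)))"
    proof (cases "\<forall>j<m. ?A x (ix0 j) > 0")
      case True
      let ?W = "{x \<in> Es m. \<forall>j<m. ?A x (ix0 j) > 0}"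
      have W: "openin (Euclidean_space (3 * m)) ?W" by (rule openin_blocks_pos[OF Ac])
      have sub: "?W \<subseteq> Es m" by blast
      have "smooth_real_on (3 * m) ?W (\<lambda>x. proj m (?A x) i)" for i
        by (rule smooth_proj[OF W smooth_real_on_subset[OF sub subset_refl As]]) auto
      then have "smooth_real_on (3 * m) ?W (\<lambda>x. K (proj m (?A x)))"
        by (intro smooth_compose[OF W openin_Es proj_in K])
      then have "smooth_real_on (3 * m) ?W (\<lambda>x. bump m p (qmul r (gno m x)) * K (proj m (?A x)))"
        by (rule smooth_mult[OF W smooth_real_on_subset[OF sub subset_refl bump_smooth_chart]])
      then have "smooth_real_on (3 * m) ?W (\<lambda>x. bump_ext m p K (qmul r (gno m x)))"
        by (rule smooth_real_on_cong[OF W, rotated]) (simp add: bump_ext_def chart_dom_def rS chart_def)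
      then show ?thesis using W x True by (intro exI[of _ ?W]) simp
    next
      case False
      then obtain j where j: "j < m" "?A x (ix0 j) \<le> 0" by (auto simp: not_less)
      \<comment> \<open>Outside the chart domain some real part is at most 0; where it stays below
        1/2 the function is identically zero.\<close>
      let ?W = "Es m \<inter> (\<lambda>x. ?A x (ix0 j)) -` {..<1 / 2}"
      have "openin (top_of_set (Es m)) ?W"
        by (intro continuous_openin_preimage_gen continuous_on_seqD[OF Ac] open_lessThan)
      then have W: "openin (Euclidean_space (3 * m)) ?W" by (metis Euclidean_space_top_of_set)
      have "bump_ext m p K (qmul r (gno m x)) = 0" if "x \<in> ?W" for x
      proof -
        have "qmul (qconj p) (qmul r (gno m x)) (ix0 j) \<le> 1 / 2" using that by simp
        from bump_zero[OF j(1) this] show ?thesis by (simp add: bump_ext_def)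
      qed
      then have "smooth_real_on (3 * m) ?W (\<lambda>x. bump_ext m p K (qmul r (gno m x)))"
        by (intro smooth_real_on_cong[OF W _ smooth_const[OF W, of 0]]) simp
      then show ?thesis using W x j(2) by (intro exI[of _ ?W]) simp
    qed
  qed
qed

text \<open>Hadamard's lemma in the chart at \<open>p\<close> writes \<open>f\<close> minus its
  value at \<open>p\<close> as a sum of products of coordinates and smooth functions. Multiplying by
  the square of the bump gives each factor one copy and so makes it a global smooth function. The
  product rule keeps only \<open>v (a i) * b i p\<close>, and the positive number
  \<open>bump m p p\<close> cancels.\<close>

lemma tspace_expansion:
  assumes p: "p \<in> spheres m" and v: "v \<in> tspace (sph m) p"
  shows "v f = (\<Sum>i<3 * m. cof i p v * lef m i p f)"
proof (cases "f \<in> smooth_funs (sph m)")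
  case False
  then show ?thesis using sph.tspace_nonsmooth[OF v False] by (simp add: lef_def)
next
  case f: True
  define F where "F x = f (qmul p (gno m x))" for x
  have F: "smooth_real_on (3 * m) (Es m) F" unfolding F_def by (rule smooth_funs_sphD[OF f p])
  define G where "G i = radial_integral 0 (coord_deriv i F)" for i
  have G: "smooth_real_on (3 * m) (Es m) (G i)" if "i < 3 * m" for i
    unfolding G_def by (rule smooth_radial_integral[OF smooth_real_onD(3)[OF openin_Es F that]])
  define a where "a i = bump_ext m p (\<lambda>x. x i)" for i
  define b where "b i = bump_ext m p (G i)" for i
  let ?b = "bump m p"
  note bs = bump_smooth[of m p]
  have a: "a i \<in> smooth_funs (sph m)" for i unfolding a_def by (rule bump_ext_smooth[OF p Es_coord_smooth])
  have b: "b i \<in> smooth_funs (sph m)" if "i < 3 * m" for i unfolding b_def by (rule bump_ext_smooth[OF p G[OF that]])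
  have pM: "p \<in> mpoints (sph m)" using p by simp
  have F0: "F (\<lambda>_. 0) = f p" by (simp add: F_def qmul_gno_0[OF p])
  have z: "(\<lambda>_. 0) \<in> Es m" by (simp add: topspace_Euclidean_space)
  have chp: "chart m p p = (\<lambda>_. 0)" using chart_gno(1)[OF p z] unfolding qmul_gno_0[OF p] .
  have ap: "a i p = 0" for i by (simp add: a_def bump_ext_def chp)
  have bp: "b i p = ?b p * lef m i p f" for i
    using gno_chart_self[OF p] p f
    \<comment> \<open>At the centre the Hadamard coefficient is the partial derivative itself, hence
      the value of the left-invariant field.\<close>
    by (simp add: b_def bump_ext_def chp G_def radial_integral_0 lef_def F_def[abs_def])
  have off: "?b q = 0" if "q \<in> spheres m" "q \<notin> chart_dom m p" for q
  proof -
    from that obtain j where "j < m" "qmul (qconj p) q (ix0 j) \<le> 0" by (auto simp: chart_dom_def not_less)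
    then show ?thesis by (intro bump_zero[of j]) auto
  qed
  have had: "?b q * ?b q * (f q - f p) = (\<Sum>i<3 * m. a i q * b i q)" if q: "q \<in> spheres m" for q
  proof (cases "q \<in> chart_dom m p")
    case True
    have "chart m p q \<in> Es m" by (simp add: chart_def proj_in)
    from hadamard_expansion[OF F this]
    have "f q - f p = (\<Sum>i<3 * m. chart m p q i * G i (chart m p q))"
      unfolding F0 G_def[symmetric] F_def gno_chart[OF p True] by simp
    then show ?thesis using True
      by (simp add: a_def b_def bump_ext_def sum_distrib_left mult_ac)
  next
    case False
    then show ?thesis using off[OF q] by (simp add: a_def bump_ext_def)
  qed
  note fs = sph.smooth_funs_diff[OF f sph.smooth_funs_const[where a="f p"]]
  have lhs: "v (\<lambda>q. ?b q * ?b q * (f q - f p)) = ?b p * ?b p * v f"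
    using sph.tspace_mult[OF v sph.smooth_funs_mult[OF bs bs] fs]
      sph.tspace_diff[OF v f sph.smooth_funs_const[where a="f p"]] sph.tspace_const[OF v] by simp
  have rhs: "v (\<lambda>q. \<Sum>i<3 * m. a i q * b i q) = (\<Sum>i<3 * m. v (a i) * b i p)"
  proof -
    have "v (\<lambda>q. \<Sum>i<3 * m. a i q * b i q) = (\<Sum>i<3 * m. v (\<lambda>q. a i q * b i q))"
      by (rule sph.tspace_sum[OF v]) (use sph.smooth_funs_mult[OF a b] in auto)
    also have "\<dots> = (\<Sum>i<3 * m. v (a i) * b i p)"
    proof (rule sum.cong[OF refl])
      fix i assume "i \<in> {..<3 * m}"
      then have "i < 3 * m" by simp
      from sph.tspace_mult[OF v a b[OF this], of i] show "v (\<lambda>q. a i q * b i q) = v (a i) * b i p" by (simp add: ap)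
    qed
    finally show ?thesis .
  qed
  \<comment> \<open>Clearing the denominator avoids differentiating a quotient: \<open>?L\<close>
    times \<open>a i\<close> is the bump times the imaginary entry \<open>?l\<close>. At
    \<open>p\<close>, \<open>?L\<close> is 1 while \<open>a i\<close> and \<open>?l\<close>
    vanish.\<close>
  have va: "v (a i) = ?b p * cof i p v" if i: "i < 3 * m" for i
  proof -
    let ?L = "\<lambda>q. qmul (qconj p) q (ix0 (i div 3))" and ?l = "\<lambda>q. qmul (qconj p) q (cidx i)"
    have j: "i div 3 < m" using i by auto
    have Ls: "?L \<in> smooth_funs (sph m)" and ls: "?l \<in> smooth_funs (sph m)" by (rule smooth_funs_qmul(1))+
    have "v (\<lambda>q. ?L q * a i q) = v (\<lambda>q. ?b q * ?l q)"
    proof (rule sph.tspace_cong[OF v pM sph.smooth_funs_mult[OF Ls a]])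
      fix q assume "q \<in> mpoints (sph m)"
      then have q: "q \<in> spheres m" by simp
      show "?L q * a i q = ?b q * ?l q"
      proof (cases "q \<in> chart_dom m p")
        case True
        then have "?L q \<noteq> 0" using j by (auto simp: chart_dom_def)
        then show ?thesis using True i by (simp add: a_def bump_ext_def chart_def proj_def)
      qed (use off[OF q] in \<open>simp add: a_def bump_ext_def\<close>)
    qed
    moreover have "v (\<lambda>q. ?L q * a i q) = v (a i)"
      using sph.tspace_mult[OF v Ls a, of i] j by (simp add: ap qmul_qconj[OF p] qone_simps)
    moreover have "v (\<lambda>q. ?b q * ?l q) = ?b p * cof i p v"
    proof -
      have "qone m (cidx i) = 0" using triple_cases[of "\<lambda>i. qone m (cidx i) = 0" i] by (simp add: cidx_simps qone_simps)
      then show ?thesis using sph.tspace_mult[OF v bs ls] by (simp add: qmul_qconj[OF p] cof_def)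
    qed
    ultimately show ?thesis by simp
  qed
  have "?b p * ?b p * v f = (\<Sum>i<3 * m. v (a i) * b i p)"
  proof -
    have "v (\<lambda>q. ?b q * ?b q * (f q - f p)) = v (\<lambda>q. \<Sum>i<3 * m. a i q * b i q)"
      by (rule sph.tspace_cong[OF v pM sph.smooth_funs_mult[OF sph.smooth_funs_mult[OF bs bs] fs]]) (simp add: had)
    then show ?thesis unfolding lhs rhs .
  qed
  also have "\<dots> = (\<Sum>i<3 * m. ?b p * ?b p * (cof i p v * lef m i p f))"
    by (rule sum.cong[OF refl]) (simp add: va bp)
  also have "\<dots> = ?b p * ?b p * (\<Sum>i<3 * m. cof i p v * lef m i p f)"
    by (simp add: sum_distrib_left)
  finally show ?thesis using bump_pos[OF p] by simp
qed

definition qunit :: "nat \<Rightarrow> nat \<Rightarrow> real" where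
  "qunit k i = (if i = k then 1 else 0)"

lemma qmul_expand:
  "qmul a q l = qmul a (qunit (ix0 (l div 4))) l * q (ix0 (l div 4)) + qmul a (qunit (ix1 (l div 4))) l * q (ix1 (l div 4))
     + qmul a (qunit (ix2 (l div 4))) l * q (ix2 (l div 4)) + qmul a (qunit (ix3 (l div 4))) l * q (ix3 (l div 4))"
  by (rule quat_cases[of _ l]) (simp_all add: qmul_simps qunit_def)

lemma smooth_funs_qconj_qmul: "(\<lambda>p. qmul (qconj p) b l) \<in> smooth_funs (sph m)"
  unfolding smooth_funs_sph_iff
  by (intro ballI smooth_qmul[OF openin_Es] smooth_qconj[OF openin_Es] smooth_const[OF openin_Es] smooth_qmul_gno)

text \<open>The point \<open>p\<close> enters both as base point and inside the function being
  differentiated. Left multiplication is linear in four entries of \<open>q\<close>, so the two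
  roles separate into smooth coefficients times \<open>X\<close> applied to fixed entry
  functions.\<close>

lemma cof_smooth:
  assumes X: "X \<in> vfields (sph m)"
  shows "(\<lambda>p. cof i p (X p)) \<in> smooth_funs (sph m)"
proof -
  define l where "l = cidx i"
  define K where "K k p = qmul (qconj p) (qunit (k (l div 4))) l * X p (\<lambda>q. q (k (l div 4)))" for k p
  have Ks: "K k \<in> smooth_funs (sph m)" for k
    unfolding K_def
    by (rule sph.smooth_funs_mult[OF smooth_funs_qconj_qmul sph.vfieldsD(3)[OF X smooth_funs_entry]])
  have "(\<lambda>p. K ix0 p + K ix1 p + K ix2 p + K ix3 p) \<in> smooth_funs (sph m)"
    by (intro sph.smooth_funs_add Ks)
  then show ?thesis
  proof (rule sph.smooth_funs_cong)
    fix p assume "p \<in> mpoints (sph m)"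
    note v = sph.vfieldsD(1)[OF X this]
    have e: "(\<lambda>q. c * q k) \<in> smooth_funs (sph m)" for c k
      by (rule sph.smooth_funs_mult[OF sph.smooth_funs_const smooth_funs_entry])
    have lin: "X p (\<lambda>q. a * q i + b * q j + c * q k + d * q l) =
        a * X p (\<lambda>q. q i) + b * X p (\<lambda>q. q j) + c * X p (\<lambda>q. q k) + d * X p (\<lambda>q. q l)" for a b c d i j k l
      unfolding sph.tspace_add[OF v sph.smooth_funs_add[OF sph.smooth_funs_add[OF e e] e] e]
        sph.tspace_add[OF v sph.smooth_funs_add[OF e e] e] sph.tspace_add[OF v e e]
        sph.tspace_cmult[OF v smooth_funs_entry] ..
    have "cof i p (X p) = X p (\<lambda>q. qmul (qconj p) q l)" by (simp add: cof_def l_def)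
    also have "(\<lambda>q. qmul (qconj p) q l) = (\<lambda>q. qmul (qconj p) (qunit (ix0 (l div 4))) l * q (ix0 (l div 4))
        + qmul (qconj p) (qunit (ix1 (l div 4))) l * q (ix1 (l div 4))
        + qmul (qconj p) (qunit (ix2 (l div 4))) l * q (ix2 (l div 4))
        + qmul (qconj p) (qunit (ix3 (l div 4))) l * q (ix3 (l div 4)))"
      by (rule ext) (rule qmul_expand)
    finally show "K ix0 p + K ix1 p + K ix2 p + K ix3 p = cof i p (X p)" unfolding lin K_def by (rule sym)
  qed
qed

definition lef_bracket :: "nat \<Rightarrow> nat \<Rightarrow> nat \<Rightarrow> real" where
  "lef_bracket i j k = qmul (eu i) (eu j) (cidx k) - qmul (eu j) (eu i) (cidx k)"

lemma global_frame_lef: "global_frame (sph m) (lef m) cof lef_bracket"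
proof
  fix i assume "i < mdim (sph m)"
  then have i: "i < 3 * m" by simp
  show "lef m i \<in> vfields (sph m)" by (rule lef_vfield[OF i])
  show "tlinear (sph m) p (cof i p)" if "p \<in> mpoints (sph m)" for p
    by (simp add: tlinear_def cof_def)
  show "cof i p (lef m j p) = (if i = j then 1 else 0)" if "j < mdim (sph m)" "p \<in> mpoints (sph m)" for j p
    by (rule cof_lef) (use that in simp_all)
  show "(\<lambda>p. cof i p (X p)) \<in> smooth_funs (sph m)" if "X \<in> vfields (sph m)" for X
    by (rule cof_smooth[OF that])
  fix j p assume "j < mdim (sph m)" "p \<in> mpoints (sph m)"
  then have j: "j < 3 * m" and p: "p \<in> spheres m" and pM: "p \<in> mpoints (sph m)" by simp_all
  let ?v = "lie_bracket (lef m i) (lef m j) p"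
  have v: "?v \<in> tspace (sph m) p"
    by (rule sph.vfieldsD(1)[OF sph.lie_bracket_closed[OF lef_vfield[OF i] lef_vfield[OF j]] pM])
  \<comment> \<open>The bracket need only be evaluated on the functions that define
    \<open>cof\<close>. On these the fields act by right multiplication with units, so the
    components are those of a quaternion commutator.\<close>
  have second: "lef m a p (\<lambda>q. lef m b q (\<lambda>q. qmul (qconj p) q (cidx k))) = qmul (eu a) (eu b) (cidx k)"
    if a: "a < 3 * m" and b: "b < 3 * m" for a b k
  proof -
    let ?l = "\<lambda>q. qmul (qconj p) q (cidx k)"
    have "lef m a p (\<lambda>q. lef m b q ?l) = lef m a p (\<lambda>q. qmul (qmul (qconj p) q) (eu b) (cidx k))"
    proof (rule sph.tspace_cong[OF lef_tspace[OF p a] pM lef_smooth[OF smooth_funs_qmul(1) b]])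
      fix q assume "q \<in> mpoints (sph m)"
      then have q: "q \<in> spheres m" by simp
      show "lef m b q ?l = qmul (qmul (qconj p) q) (eu b) (cidx k)"
        unfolding lef_qmul(1)[OF q b] qmul_assoc ..
    qed
    also have "\<dots> = qmul (qmul (qconj p) (qmul p (eu a))) (eu b) (cidx k)" by (rule lef_qmul(2)[OF p a])
    also have "\<dots> = qmul (eu a) (eu b) (cidx k)" unfolding qmul_qconj_eu[OF p a] ..
    finally show ?thesis .
  qed
  have "cof k p ?v = lef_bracket i j k" for k
    unfolding cof_def lie_bracket_def second[OF i j] second[OF j i] lef_bracket_def ..
  then show "?v = (\<lambda>f. \<Sum>k<mdim (sph m). lef_bracket i j k * lef m k p f)"
    using tspace_expansion[OF p v] by (simp add: fun_eq_iff)
next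
  fix p and v :: "(nat \<Rightarrow> real) tvec" assume "p \<in> mpoints (sph m)" "v \<in> tspace (sph m) p"
  then show "v = (\<lambda>f. \<Sum>i<mdim (sph m). cof i p v * lef m i p f)"
    using tspace_expansion[of p m v] by (simp add: fun_eq_iff)
qed

text \<open>The inverse of \<open>a p\<close> times \<open>a q\<close> is the inverse of
  \<open>p\<close> times \<open>q\<close>, so the function defining \<open>cof\<close> at the
  translated point pulls back to the one at \<open>p\<close>.\<close>

lemma cof_invariant:
  assumes a: "a \<in> spheres m" and p: "p \<in> spheres m" and v: "v \<in> tspace (sph m) p"
  shows "cof i (translation m a p) (pushforward (sph m) (sph m) (translation m a) v) = cof i p v"
proof -
  let ?l = "\<lambda>q. qmul (qconj p) q (cidx i)"
  have conj: "qconj (qmul a p) = qmul (qconj p) (qconj a)"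
  proof
    show "qconj (qmul a p) i = qmul (qconj p) (qconj a) i" for i
      by (rule quat_cases[of _ i]) (simp_all add: qconj_simps qmul_simps)
  qed
  have eq: "?l q = ((\<lambda>q. qmul (qconj (qmul a p)) q (cidx i)) \<circ> translation m a) q" if "q \<in> spheres m" for q
  proof -
    have "qmul (qconj a) (qmul a q) = q" by (rule qmul_qconj_cancel(1)[OF a]) (rule spheresD(2)[OF that])
    then show ?thesis unfolding o_def translation_apply[OF that] conj qmul_assoc by simp
  qed
  have "v ?l = v ((\<lambda>q. qmul (qconj (qmul a p)) q (cidx i)) \<circ> translation m a)"
    by (rule sph.tspace_cong[OF v _ smooth_funs_qmul(1)]) (use p eq in auto)
  then show ?thesis
    using smooth_funs_qmul(1)[of "qconj (qmul a p)" "cidx i" m]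
    by (simp add: cof_def pushforward_def translation_apply[OF p])
qed

section \<open>Constant change of frame\<close>

context global_frame begin

text \<open>The new fields have constant components in the old frame, so \<open>der0\<close> removes
  the derivative terms of the bracket and only the bilinear part with \<open>c\<close> is
  left.\<close>

lemma change_of_frame:
  assumes SP: "\<And>i j. i < n \<Longrightarrow> j < n \<Longrightarrow> (\<Sum>l<n. S i l * P j l) = (if i = j then 1 else 0)"
    and PS: "\<And>k l. k < n \<Longrightarrow> l < n \<Longrightarrow> (\<Sum>i<n. S i k * P i l) = (if k = l then 1 else 0)"
    and c': "\<And>i j k. i < n \<Longrightarrow> j < n \<Longrightarrow> k < n \<Longrightarrow> bil n c (P i) (P j) k = (\<Sum>b<n. c' i j b * P b k)"
  shows "global_frame M (\<lambda>i p f. \<Sum>l<n. P i l * F l p f) (\<lambda>i p v. \<Sum>l<n. S i l * \<theta> l p v) c'"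
proof
  let ?F = "\<lambda>i p f. \<Sum>l<n. P i l * F l p f"
  have F_vf: "?F i = vf (\<lambda>p. P i)" for i by (simp add: vf_def)
  have F: "?F i \<in> vfields M" for i unfolding F_vf by (rule vf_closed) (rule smooth_funs_const)
  have coF: "co (?F i) p l = P i l" if "p \<in> mpoints M" "l < n" for i p l
    unfolding F_vf by (rule co_vf[OF that])
  fix i assume i: "i < mdim M"
  show "?F i \<in> vfields M" by (rule F)
  show "tlinear M p (\<lambda>v. \<Sum>l<n. S i l * \<theta> l p v)" if p: "p \<in> mpoints M" for p
    unfolding tlinear_def
  proof (intro ballI allI)
    fix v w a b assume v: "v \<in> tspace M p" and w: "w \<in> tspace M p"
    have "(\<Sum>l<n. S i l * \<theta> l p (\<lambda>f. a * v f + b * w f)) = (\<Sum>l<n. S i l * (a * \<theta> l p v + b * \<theta> l p w))"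
      by (rule sum.cong[OF refl]) (simp add: coframe_lin[OF _ p v w])
    then show "(\<Sum>l<n. S i l * \<theta> l p (\<lambda>f. a * v f + b * w f)) = a * (\<Sum>l<n. S i l * \<theta> l p v) + b * (\<Sum>l<n. S i l * \<theta> l p w)"
      by (simp add: algebra_simps sum.distrib sum_distrib_left)
  qed
  show "(\<Sum>l<n. S i l * \<theta> l p (?F j p)) = (if i = j then 1 else 0)" if "j < mdim M" "p \<in> mpoints M" for j p
  proof -
    have "(\<Sum>l<n. S i l * \<theta> l p (?F j p)) = (\<Sum>l<n. S i l * P j l)"
      by (rule sum.cong[OF refl]) (use coF[OF that(2), of _ j] in \<open>simp add: co_def\<close>)
    then show ?thesis using SP[OF i that(1)] by simp
  qed
  show "(\<lambda>p. \<Sum>l<n. S i l * \<theta> l p (X p)) \<in> smooth_funs M" if "X \<in> vfields M" for X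
    by (rule smooth_funs_sum) (use smooth_funs_mult[OF smooth_funs_const coframe_smooth[OF _ that]] in auto)
  fix j p assume j: "j < mdim M" and p: "p \<in> mpoints M"
  have der0: "der (?F a) p (co (?F b)) k = 0" if "k < n" for a b k
  proof -
    have "der (?F a) p (co (?F b)) k = der (?F a) p (\<lambda>q. P b) k"
      by (rule der_cong[of "?F a" p "co (?F b)" k "\<lambda>q. P b", OF F p co_smooth[OF F that] coF[OF _ that]])
    also have "\<dots> = 0" unfolding der_def by (rule tspace_const[OF vfieldsD(1)[OF F p]])
    finally show ?thesis .
  qed
  have br: "co (lie_bracket (?F i) (?F j)) p k = (\<Sum>b<n. c' i j b * P b k)" if k: "k < n" for k
  proof -
    have "bil n c (co (?F i) p) (co (?F j) p) k = bil n c (P i) (P j) k"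
      by (rule bil_cong) (rule coF[OF p], assumption)+
    then show ?thesis
      unfolding co_lie_bracket[OF F F p k] der0[OF k] using c'[OF i j k] by simp
  qed
  show "lie_bracket (?F i) (?F j) p = (\<lambda>f. \<Sum>k<mdim M. c' i j k * ?F k p f)"
  proof
    fix f
    have "lie_bracket (?F i) (?F j) p f = (\<Sum>k<n. (\<Sum>b<n. c' i j b * P b k) * F k p f)"
      unfolding vfield_apply[OF lie_bracket_closed[OF F F] p] by (rule sum.cong[OF refl]) (simp add: br)
    also have "\<dots> = (\<Sum>k<n. \<Sum>b<n. c' i j b * (P b k * F k p f))"
      by (simp add: sum_distrib_right mult.assoc)
    also have "\<dots> = (\<Sum>b<n. \<Sum>k<n. c' i j b * (P b k * F k p f))" by (rule sum.swap)
    also have "\<dots> = (\<Sum>b<n. c' i j b * ?F b p f)" by (simp add: sum_distrib_left)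
    finally show "lie_bracket (?F i) (?F j) p f = (\<Sum>k<mdim M. c' i j k * ?F k p f)" .
  qed
next
  fix p v assume p: "p \<in> mpoints M" and v: "v \<in> tspace M p"
  show "v = (\<lambda>f. \<Sum>i<mdim M. (\<Sum>l<n. S i l * \<theta> l p v) * (\<Sum>l<n. P i l * F l p f))"
  proof
    fix f
    have "(\<Sum>i<n. (\<Sum>k<n. S i k * \<theta> k p v) * (\<Sum>l<n. P i l * F l p f)) =
        (\<Sum>i<n. \<Sum>k<n. \<Sum>l<n. S i k * P i l * (\<theta> k p v * F l p f))"
      unfolding sum_product by (intro sum.cong refl) (simp only: mult_ac)
    also have "\<dots> = (\<Sum>k<n. \<Sum>i<n. \<Sum>l<n. S i k * P i l * (\<theta> k p v * F l p f))" by (rule sum.swap)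
    also have "\<dots> = (\<Sum>k<n. \<Sum>l<n. \<Sum>i<n. S i k * P i l * (\<theta> k p v * F l p f))"
      by (rule sum.cong[OF refl], rule sum.swap)
    also have "\<dots> = (\<Sum>k<n. \<Sum>l<n. (\<theta> k p v * F l p f) * (if l = k then 1 else 0))"
      by (intro sum.cong refl) (simp add: PS flip: sum_distrib_right)
    also have "\<dots> = (\<Sum>k<n. \<theta> k p v * F k p f)"
      by (rule sum.cong[OF refl], rule sum_mult_unit) simp
    also have "\<dots> = v f" using fun_cong[OF frame_expansion[OF p v], of f] by simp
    finally show "v f = (\<Sum>i<mdim M. (\<Sum>l<n. S i l * \<theta> l p v) * (\<Sum>l<n. P i l * F l p f))" by simp
  qed
qed

end

subsection \<open>The frame on a product of at least three spheres\<close>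

lemma sum_triples: "(\<Sum>l<3 * m. f l) = (\<Sum>b<m. f (tx0 b) + f (tx1 b) + (f (tx2 b) :: real))"
proof (induction m)
  case (Suc m)
  have "3 * Suc m = Suc (Suc (Suc (3 * m)))" by simp
  then have "(\<Sum>l<3 * Suc m. f l) = (\<Sum>l<3 * m. f l) + f (3 * m) + f (Suc (3 * m)) + f (Suc (Suc (3 * m)))"
    by (simp only: sum.lessThan_Suc)
  also have "\<dots> = (\<Sum>l<3 * m. f l) + (f (tx0 m) + f (tx1 m) + f (tx2 m))"
    by (simp add: tx0_def tx1_def tx2_def)
  finally show ?case using Suc by simp
qed simp

lemma mod_3_less: "(i :: nat) mod 3 < 3"
  by simp

lemma sum_residue:
  fixes a :: nat
  assumes "a < 3"
  shows "(\<Sum>l<3 * m. if l mod 3 = a then f (l div 3) else 0) = (\<Sum>b<m. f b :: real)"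
  using less_3_cases[OF assms] unfolding sum_triples by (elim disjE) simp_all

text \<open>\<open>T\<close> tensored with the identity on so(3): index \<open>i\<close> stands for
  block \<open>i div 3\<close> and direction \<open>i mod 3\<close>.\<close>

definition block_mat :: "(nat \<Rightarrow> nat \<Rightarrow> real) \<Rightarrow> nat \<Rightarrow> nat \<Rightarrow> real" where
  "block_mat T i l = (if i mod 3 = l mod 3 then T (i div 3) (l div 3) else 0)"

definition eps_mult :: "(nat \<Rightarrow> nat \<Rightarrow> nat \<Rightarrow> real) \<Rightarrow> nat \<Rightarrow> nat \<Rightarrow> nat \<Rightarrow> real" where
  "eps_mult T i j k = eps (i mod 3) (j mod 3) (k mod 3) * T (i div 3) (j div 3) (k div 3)"

lemma div_mod_3_eqI: "(i :: nat) mod 3 = j mod 3 \<Longrightarrow> i div 3 = j div 3 \<Longrightarrow> i = j"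
  by (metis div_mult_mod_eq)

lemma block_mat_rows:
  assumes "\<And>i j. i < m \<Longrightarrow> j < m \<Longrightarrow> (\<Sum>l<m. T i l * U j l) = (if i = j then 1 else 0)" "i < 3 * m" "j < 3 * m"
  shows "(\<Sum>l<3 * m. block_mat T i l * block_mat U j l) = (if i = j then 1 else 0)"
proof -
  have ij: "i div 3 < m" "j div 3 < m" using assms(2,3) by auto
  have "(\<Sum>l<3 * m. block_mat T i l * block_mat U j l) =
      (\<Sum>l<3 * m. if l mod 3 = i mod 3 then (if i mod 3 = j mod 3 then T (i div 3) (l div 3) * U (j div 3) (l div 3) else 0) else 0)"
    by (rule sum.cong[OF refl]) (auto simp: block_mat_def)
  also have "\<dots> = (\<Sum>b<m. if i mod 3 = j mod 3 then T (i div 3) b * U (j div 3) b else 0)"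
    by (rule sum_residue[OF mod_3_less])
  also have "\<dots> = (if i = j then 1 else 0)"
    using assms(1)[OF ij] div_mod_3_eqI[of i j] by (cases "i mod 3 = j mod 3") auto
  finally show ?thesis .
qed

lemma block_mat_transpose: "block_mat T i l = block_mat (\<lambda>a b. T b a) l i"
  by (simp add: block_mat_def)

text \<open>Different imaginary units of one factor anticommute, so their commutator is twice their
  product; units of different factors commute.\<close>

lemma lef_bracket_eq:
  "lef_bracket i j k = (if i div 3 = k div 3 \<and> j div 3 = k div 3 then 2 * eps (i mod 3) (j mod 3) (k mod 3) else 0)"
proof (rule triple_cases[of _ k])
  show "lef_bracket i j (tx0 k) = (if i div 3 = tx0 k div 3 \<and> j div 3 = tx0 k div 3 then 2 * eps (i mod 3) (j mod 3) (tx0 k mod 3) else 0)" for k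
    by (rule triple_cases[of _ i]; rule triple_cases[of _ j])
      (simp_all add: lef_bracket_def cidx_simps qmul_simps eu_simps eps_def)
  show "lef_bracket i j (tx1 k) = (if i div 3 = tx1 k div 3 \<and> j div 3 = tx1 k div 3 then 2 * eps (i mod 3) (j mod 3) (tx1 k mod 3) else 0)" for k
    by (rule triple_cases[of _ i]; rule triple_cases[of _ j])
      (simp_all add: lef_bracket_def cidx_simps qmul_simps eu_simps eps_def)
  show "lef_bracket i j (tx2 k) = (if i div 3 = tx2 k div 3 \<and> j div 3 = tx2 k div 3 then 2 * eps (i mod 3) (j mod 3) (tx2 k mod 3) else 0)" for k
    by (rule triple_cases[of _ i]; rule triple_cases[of _ j])
      (simp_all add: lef_bracket_def cidx_simps qmul_simps eu_simps eps_def)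
qed

lemma bil_lef_bracket:
  assumes m: "3 \<le> m" and i: "i < 3 * m" and j: "j < 3 * m" and k: "k < 3 * m"
  shows "bil (3 * m) lef_bracket (block_mat mix i) (block_mat mix j) k = (\<Sum>b<3 * m. eps_mult kap i j b * block_mat mix b k)"
proof -
  \<comment> \<open>For given \<open>k\<close> the double sum has at most one nonzero term: both
    indices lie in the block of \<open>k\<close>, with the directions of \<open>i\<close> and
    \<open>j\<close>.\<close>
  define a b where "a = 3 * (k div 3) + i mod 3" and "b = 3 * (k div 3) + j mod 3"
  have kb: "k div 3 < m" "i div 3 < m" "j div 3 < m" using i j k by auto
  have ab: "a div 3 = k div 3" "a mod 3 = i mod 3" "b div 3 = k div 3" "b mod 3 = j mod 3"
    by (simp_all add: a_def b_def)
  have less: "a < 3 * m" "b < 3 * m"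
    using kb(1) mod_3_less[of i] mod_3_less[of j] unfolding a_def b_def by linarith+
  have inner: "(\<Sum>l<3 * m. lef_bracket u l k * block_mat mix i u * block_mat mix j l) = lef_bracket u b k * block_mat mix i u * block_mat mix j b" for u
  proof (rule sum_single[OF less(2)])
    fix l assume "l \<noteq> b"
    then have "l div 3 \<noteq> k div 3 \<or> l mod 3 \<noteq> j mod 3" using div_mod_3_eqI[of l b] ab by auto
    then show "lef_bracket u l k * block_mat mix i u * block_mat mix j l = 0" by (auto simp: lef_bracket_eq block_mat_def)
  qed
  have "bil (3 * m) lef_bracket (block_mat mix i) (block_mat mix j) k = (\<Sum>u<3 * m. lef_bracket u b k * block_mat mix i u * block_mat mix j b)"
    unfolding bil_def inner ..
  also have "\<dots> = lef_bracket a b k * block_mat mix i a * block_mat mix j b"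
  proof (rule sum_single[OF less(1)])
    fix u assume "u \<noteq> a"
    then have "u div 3 \<noteq> k div 3 \<or> u mod 3 \<noteq> i mod 3" using div_mod_3_eqI[of u a] ab by auto
    then show "lef_bracket u b k * block_mat mix i u * block_mat mix j b = 0" by (auto simp: lef_bracket_eq block_mat_def)
  qed
  also have "\<dots> = eps (i mod 3) (j mod 3) (k mod 3) * (2 * mix (i div 3) (k div 3) * mix (j div 3) (k div 3))"
    by (simp add: lef_bracket_eq block_mat_def ab)
  also have "\<dots> = (\<Sum>b<m. eps (i mod 3) (j mod 3) (k mod 3) * (kap (i div 3) (j div 3) b * mix b (k div 3)))"
    by (simp add: mix_kap[OF m kb(2,3), symmetric] sum_distrib_left)
  also have "\<dots> = (\<Sum>b<3 * m. if b mod 3 = k mod 3 then eps (i mod 3) (j mod 3) (k mod 3) *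
      (kap (i div 3) (j div 3) (b div 3) * mix (b div 3) (k div 3)) else 0)"
    by (rule sum_residue[OF mod_3_less, symmetric])
  also have "\<dots> = (\<Sum>b<3 * m. eps_mult kap i j b * block_mat mix b k)"
    by (rule sum.cong[OF refl]) (auto simp: eps_mult_def block_mat_def)
  finally show ?thesis .
qed

definition fr :: "nat \<Rightarrow> nat \<Rightarrow> (nat \<Rightarrow> real) vfield" where
  "fr m i p f = (\<Sum>l<3 * m. block_mat mix i l * lef m l p f)"

definition cofr :: "nat \<Rightarrow> nat \<Rightarrow> (nat \<Rightarrow> real) \<Rightarrow> (nat \<Rightarrow> real) tvec \<Rightarrow> real" where
  "cofr m i p v = (\<Sum>l<3 * m. block_mat comix i l * cof l p v)"

lemma global_frame_fr:
  assumes m: "3 \<le> m"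
  shows "global_frame (sph m) (fr m) (cofr m) (eps_mult kap)"
proof -
  interpret L: global_frame "sph m" "lef m" cof lef_bracket by (rule global_frame_lef)
  have "global_frame (sph m) (\<lambda>i p f. \<Sum>l<L.n. block_mat mix i l * lef m l p f)
      (\<lambda>i p v. \<Sum>l<L.n. block_mat comix i l * cof l p v) (eps_mult kap)"
  proof (rule L.change_of_frame)
    fix i j assume "i < L.n" "j < L.n"
    then have ij: "i < 3 * m" "j < 3 * m" by simp_all
    show "(\<Sum>l<L.n. block_mat comix i l * block_mat mix j l) = (if i = j then 1 else 0)"
      using block_mat_rows[of m comix mix, OF comix_mix[OF m] ij] by simp
    show "(\<Sum>l<L.n. block_mat comix l i * block_mat mix l j) = (if i = j then 1 else 0)"
      using block_mat_rows[of m "\<lambda>a b. comix b a" "\<lambda>a b. mix b a", OF mix_comix[OF m] ij]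
      by (simp add: block_mat_transpose[of comix _ i] block_mat_transpose[of mix _ j])
    show "bil L.n lef_bracket (block_mat mix i) (block_mat mix j) k = (\<Sum>b<L.n. eps_mult kap i j b * block_mat mix b k)"
      if "k < L.n" for k using bil_lef_bracket[OF m ij, of k] that by simp
  qed
  then show ?thesis unfolding fr_def[abs_def] cofr_def[abs_def] by simp
qed

lemma eps_mult_antisym:
  "(\<And>i j k. T i j k = T j i k) \<Longrightarrow> eps_mult T i j k = - eps_mult T j i k"
  "(\<And>i j k. T i j k = T i k j) \<Longrightarrow> eps_mult T i j k = - eps_mult T i k j"
proof -
  show "eps_mult T i j k = - eps_mult T j i k" if "\<And>i j k. T i j k = T j i k"
    using eps_antisym(1)[of "i mod 3" "j mod 3" "k mod 3"] that[of "i div 3" "j div 3" "k div 3"]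
    by (simp add: eps_mult_def)
  show "eps_mult T i j k = - eps_mult T i k j" if "\<And>i j k. T i j k = T i k j"
    using eps_antisym(2)[of "i mod 3" "j mod 3" "k mod 3"] that[of "i div 3" "j div 3" "k div 3"]
    by (simp add: eps_mult_def)
qed

lemma eps_contraction:
  "(\<Sum>x<3 * m. eps_mult T i j x * eps_mult U x k l) =
     eps2 (i mod 3) (j mod 3) (k mod 3) (l mod 3) * (\<Sum>b<m. T (i div 3) (j div 3) b * U b (k div 3) (l div 3))"
  unfolding sum_triples sum_distrib_left
  by (rule sum.cong[OF refl]) (simp add: eps_mult_def eps2_def algebra_simps)

text \<open>The sign comes from moving the contracted direction into the first slot of the second
  \<open>eps\<close>.\<close>

lemma eps_contraction':
  "(\<Sum>x<3 * m. eps_mult T i j x * eps_mult U k x l) =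
     - eps2 (i mod 3) (j mod 3) (k mod 3) (l mod 3) * (\<Sum>b<m. T (i div 3) (j div 3) b * U (k div 3) b (l div 3))"
proof -
  have "eps_mult U k x l = - eps_mult (\<lambda>a b c. U b a c) x k l" for x
    using eps_antisym(1)[of "k mod 3" "x mod 3" "l mod 3"] by (simp add: eps_mult_def)
  then show ?thesis by (simp add: eps_contraction sum_negf)
qed

text \<open>Each term is a direction factor \<open>eps2\<close> times a block factor
  \<open>kapeta\<close>. Pair symmetry of \<open>eps2\<close> joins the six terms into three,
  \<open>kapeta_pairings\<close> gives them a common block factor, and the direction factors add up
  to zero by the Jacobi identity.\<close>

lemma closed_coefficients:
  assumes m: "3 \<le> m" and "i < 3 * m" "j < 3 * m" "k < 3 * m" "l < 3 * m"
  shows "(\<Sum>x<3 * m. eps_mult kap i j x * eps_mult eta x k l) - (\<Sum>x<3 * m. eps_mult kap i k x * eps_mult eta x j l)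
    + (\<Sum>x<3 * m. eps_mult kap i l x * eps_mult eta x j k) + (\<Sum>x<3 * m. eps_mult kap j k x * eps_mult eta x i l)
    - (\<Sum>x<3 * m. eps_mult kap j l x * eps_mult eta x i k) + (\<Sum>x<3 * m. eps_mult kap k l x * eps_mult eta x i j) = 0"
proof -
  define a b c d where "a = i mod 3" and "b = j mod 3" and "c = k mod 3" and "d = l mod 3"
  define i' j' k' l' where "i' = i div 3" and "j' = j div 3" and "k' = k div 3" and "l' = l div 3"
  have less: "i' < m" "j' < m" "k' < m" "l' < m" using assms by (auto simp: i'_def j'_def k'_def l'_def)
  define Q where "Q = kapeta m"
  note pair = kapeta_pairings[OF m less, folded Q_def]
  have jac: "eps2 a b c d - eps2 a c b d + eps2 a d b c = 0"
    by (rule eps2_jacobi) (simp_all add: a_def b_def c_def d_def)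
  have "eps2 a b c d * Q i' j' k' l' - eps2 a c b d * Q i' k' j' l' + eps2 a d b c * Q i' l' j' k'
      + eps2 b c a d * Q j' k' i' l' - eps2 b d a c * Q j' l' i' k' + eps2 c d a b * Q k' l' i' j' =
      eps2 a b c d * (Q i' j' k' l' + Q k' l' i' j') - eps2 a c b d * (Q i' k' j' l' + Q j' l' i' k')
      + eps2 a d b c * (Q i' l' j' k' + Q j' k' i' l')"
    unfolding eps2_sym[of b c a d] eps2_sym[of b d a c] eps2_sym[of c d a b] by (simp add: algebra_simps)
  also have "\<dots> = (eps2 a b c d - eps2 a c b d + eps2 a d b c) * (Q i' j' k' l' + Q k' l' i' j')"
    unfolding pair by (simp add: algebra_simps)
  also have "\<dots> = 0" unfolding jac by simp
  finally show ?thesis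
    unfolding eps_contraction a_def b_def c_def d_def i'_def j'_def k'_def l'_def Q_def kapeta_def .
qed

section \<open>Invariance of dimension\<close>

text \<open>Otherwise the image would be open in \<open>\<real>\<^sup>n\<close> by invariance of domain.\<close>

lemma Euclidean_embedding_dim_le:
  assumes U: "openin (Euclidean_space n) U" "U \<noteq> {}"
    and f: "continuous_on U f" "inj_on f U" "f ` U \<subseteq> topspace (Euclidean_space m)"
  shows "n \<le> m"
proof (rule ccontr)
  assume "\<not> n \<le> m"
  then have mn: "m < n" by simp
  have sub: "topspace (Euclidean_space m) \<subseteq> topspace (Euclidean_space n)" using mn by simp
  have "continuous_map (subtopology (Euclidean_space n) U) (Euclidean_space n) f"
  proof -
    have "f ` U \<subseteq> topspace (Euclidean_space n)" using f(3) sub by (rule subset_trans)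
    then have "f \<in> U \<rightarrow> topspace (Euclidean_space n)" by blast
    moreover have "topspace (subtopology (Euclidean_space n) U) = U" using openin_subset[OF U(1)] by auto
    ultimately show ?thesis unfolding cm_Euclidean_space_iff_continuous_on using f(1) by simp
  qed
  from invariance_of_domain_Euclidean_space[OF U(1) this f(2)]
  have op: "openin (Euclidean_space n) (f ` U)" .
  obtain u where "u \<in> U" using U(2) by blast
  then have y: "f u \<in> f ` U" by blast
  \<comment> \<open>Openness in the larger space allows coordinate \<open>m\<close> to be varied,
    but every point of the smaller space has entry 0 there.\<close>
  have "\<forall>\<^sub>F t in nhds (f u m). (f u)(m := t) \<in> f ` U" by (rule eventually_fun_upd_in[OF op y mn])
  moreover have "t = 0" if "(f u)(m := t) \<in> f ` U" for t
  proof -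
    have "(f u)(m := t) \<in> topspace (Euclidean_space m)" using that f(3) by blast
    then have "((f u)(m := t)) m = 0" unfolding topspace_Euclidean_space mem_Collect_eq by blast
    then show ?thesis by simp
  qed
  ultimately have "\<forall>\<^sub>F t in nhds (f u m). t = 0" by (rule eventually_mono)
  then obtain e where "e > 0" "\<And>t. dist t (f u m) < e \<Longrightarrow> t = 0" unfolding eventually_nhds_metric by blast
  from this(2)[of "f u m"] this(2)[of "f u m + e / 2"] this(1) show False by (simp add: dist_real_def)
qed

text \<open>Read in the chart at \<open>qone a\<close> and the chart at its image,
  \<open>\<phi>\<close> is a continuous injection from an open set of dimension \<open>3 * a\<close>
  into dimension \<open>3 * b\<close>.\<close>

lemma diffeomorphic_sph_dim_le:
  assumes "diffeomorphic (sph a) (sph b)"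
  shows "a \<le> b"
proof -
  obtain \<phi> \<psi> where \<phi>: "smooth_map (sph a) (sph b) \<phi>" and inv: "\<And>p. p \<in> spheres a \<Longrightarrow> \<psi> (\<phi> p) = p"
    using assms unfolding diffeomorphic_def by auto
  have c\<phi>: "continuous_on (spheres a) \<phi>" "\<phi> ` spheres a \<subseteq> spheres b"
    using \<phi> by (auto simp: smooth_map_def continuous_map_in_subtopology)
  define q where "q = \<phi> (qone a)"
  have q: "q \<in> spheres b" using c\<phi>(2) qone_in unfolding q_def by blast
  have gc: "continuous_on (Es a) (\<lambda>x. \<phi> (gno a x))"
    by (rule continuous_on_compose2[OF c\<phi>(1) continuous_on_gno[OF continuous_on_id]]) (use gno_in in auto)
  let ?A = "\<lambda>x. qmul (qconj q) (\<phi> (gno a x))"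
  let ?W = "{x \<in> Es a. \<forall>j<b. ?A x (ix0 j) > 0}"
  have Ac: "continuous_on (Es a) ?A" by (rule continuous_on_qmul[OF continuous_on_const gc])
  have W: "openin (Euclidean_space (3 * a)) ?W" by (rule openin_blocks_pos[OF Ac])
  have "(\<lambda>_. 0) \<in> ?W"
    by (simp add: topspace_Euclidean_space gno_0 q_def[symmetric] qmul_qconj[OF q] qone_simps)
  then have ne: "?W \<noteq> {}" by blast
  let ?f = "\<lambda>x. chart b q (\<phi> (gno a x))"
  have Wsub: "?W \<subseteq> Es a" by blast
  have "continuous_on ?W ?f"
    unfolding chart_def by (rule continuous_on_proj[OF continuous_on_subset[OF Ac Wsub]]) auto
  moreover have "inj_on ?f ?W"
  \<comment> \<open>Injectivity is witnessed by going back through the target chart,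
    \<open>\<psi>\<close> and the projection at the identity.\<close>
  proof (rule inj_on_inverseI[of _ "\<lambda>y. proj a (\<psi> (qmul q (gno b y)))"])
    fix x assume x: "x \<in> ?W"
    have "\<phi> (gno a x) \<in> chart_dom b q" using x c\<phi>(2) gno_in[of a x] by (auto simp: chart_dom_def)
    then have "qmul q (gno b (?f x)) = \<phi> (gno a x)" by (rule gno_chart[OF q])
    then show "proj a (\<psi> (qmul q (gno b (?f x)))) = x"
      using inv[OF gno_in] proj_gno[of x a] x by simp
  qed
  moreover have "?f ` ?W \<subseteq> topspace (Euclidean_space (3 * b))" by (auto simp: chart_def proj_in)
  ultimately have "3 * a \<le> 3 * b" by (rule Euclidean_embedding_dim_le[OF W ne])
  then show ?thesis by simp
qed

lemma diffeomorphic_sym: "diffeomorphic M N \<Longrightarrow> diffeomorphic N M"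
  unfolding diffeomorphic_def by blast

section \<open>The Bismut Ricci flat pair\<close>

lemma sph_brf_pair:
  assumes m: "3 \<le> m"
  shows "\<exists>g H. brf_pair (sph m) g H \<and> non_flat_pair (sph m) g H \<and> invariant_pair (sph_group m) (translation m) (sph m) g H"
proof -
  interpret fr: global_frame "sph m" "fr m" "cofr m" "eps_mult kap" by (rule global_frame_fr[OF m])
  let ?D = "fr.conn (eps_mult gam)"
  let ?g = fr.frame_metric and ?H = "fr.frame_form (eps_mult eta)"
  note eta12 = eps_mult_antisym(1)[of eta, OF kap_eta_sym(2)] and eta23 = eps_mult_antisym(2)[of eta, OF kap_eta_sym(3)]
  have bismut: "bismut_connection (sph m) ?g ?H ?D"
  proof (rule fr.bismut_connection_conn[OF eps_mult_antisym(1)[of kap, OF kap_eta_sym(1)] eta12 eta23])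
    fix i j k
    have "eps (j mod 3) (k mod 3) (i mod 3) = eps (i mod 3) (j mod 3) (k mod 3)"
      "eps (k mod 3) (i mod 3) (j mod 3) = eps (i mod 3) (j mod 3) (k mod 3)"
      using eps_cyc by metis+
    then show "eps_mult gam i j k = fr.lc_coeff i j k + eps_mult eta i j k / 2"
      unfolding fr.lc_coeff_def eps_mult_def gam_eq by (simp add: field_simps)
  qed
  \<comment> \<open>Directions and blocks separate: the \<open>eps2\<close> factors are iterated
    brackets in so(3), the sums are products of the matrices \<open>gam\<close> and the matrix of
    the product block.\<close>
  have curv: "fr.curv_coeff (eps_mult gam) i j k l =
      - eps2 (j mod 3) (k mod 3) (i mod 3) (l mod 3) * (\<Sum>b<m. gam (j div 3) (k div 3) b * gam (i div 3) b (l div 3))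
      + eps2 (i mod 3) (k mod 3) (j mod 3) (l mod 3) * (\<Sum>b<m. gam (i div 3) (k div 3) b * gam (j div 3) b (l div 3))
      - eps2 (i mod 3) (j mod 3) (k mod 3) (l mod 3) * (\<Sum>b<m. kap (i div 3) (j div 3) b * gam b (k div 3) (l div 3))" for i j k l
    unfolding fr.curv_coeff_def sph_simps eps_contraction eps_contraction' by simp
  \<comment> \<open>Each summand of the trace vanishes by itself: with equal outer indices the three
    block sums coincide, and their coefficients add up to zero by the Jacobi identity.\<close>
  have ric: "fr.curv_coeff (eps_mult gam) i j k i = 0" for i j k
  proof -
    define a b c where "a = i mod 3" and "b = j mod 3" and "c = k mod 3"
    have "eps2 a b c a - eps2 a c b a + eps2 a a b c = 0"
      by (rule eps2_jacobi) (simp_all add: a_def b_def c_def)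
    moreover have "eps2 b c a a = eps2 a a b c" by (rule eps2_sym)
    ultimately have "- eps2 b c a a + eps2 a c b a - eps2 a b c a = 0" by linarith
    moreover have "fr.curv_coeff (eps_mult gam) i j k i = (- eps2 b c a a + eps2 a c b a - eps2 a b c a)
        * (\<Sum>b<m. gam (j div 3) (k div 3) b * gam (i div 3) b (i div 3))"
      unfolding curv gam_contractions(1)[OF m, where i="i div 3" and j="j div 3" and k="k div 3"]
        gam_contractions(2)[OF m] a_def b_def c_def by (simp add: algebra_simps)
    ultimately show ?thesis by simp
  qed
  have flat: "ricci_flat (sph m) ?g ?D"
    by (rule fr.ricci_flat_conn) (simp add: ric)
  have closed: "closed_three_form (sph m) ?H"
    by (rule fr.closed_frame_form[OF eta12 eta23]) (use closed_coefficients[OF m] in simp)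
  \<comment> \<open>The defect on block 1: applying \<open>gam 0\<close> twice kills it, while the
    square of block 0 is block 2, which acts as the identity.\<close>
  have "(\<Sum>b<m. gam 0 1 b * gam 0 b 1) = 0" "(\<Sum>b<m. kap 0 0 b * gam b 1 1) = 1"
    by (subst sum_three[OF m]; simp add: gam_large; simp add: gam_def kap_def)+
  \<comment> \<open>Indices 0 and 1 are the first two directions of block 0, indices 3 and 4 those
    of block 1.\<close>
  then have "fr.curv_coeff (eps_mult gam) 0 1 3 4 \<noteq> 0"
    unfolding curv by (simp add: eps2_def eps_def)
  then have nonflat: "\<not> flat_connection (sph m) ?D"
    by (rule fr.not_flat_conn[rotated 4]) (use m qone_in in auto)
  have inv: "invariant_pair (sph_group m) (translation m) (sph m) ?g ?H"
  proof -
    \<comment> \<open>Metric and form have constant coefficients in the coframe, so invariance of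
      the coframe is enough.\<close>
    have "cofr m i (translation m a p) (pushforward (sph m) (sph m) (translation m a) v) = cofr m i p v"
      if "a \<in> spheres m" "p \<in> spheres m" "v \<in> tspace (sph m) p" for i a p v
      unfolding cofr_def cof_invariant[OF that] ..
    then show ?thesis
      by (simp add: invariant_pair_def fr.frame_metric_def fr.frame_form_def)
  qed
  have "brf_pair (sph m) ?g ?H"
    unfolding brf_pair_def using fr.riemannian_frame_metric closed bismut flat by blast
  moreover have "non_flat_pair (sph m) ?g ?H"
    unfolding non_flat_pair_def using bismut nonflat by blast
  ultimately show ?thesis using inv by blast
qed

theorem mainTheorem2:
  shows "\<exists>M :: nat \<Rightarrow> (nat \<Rightarrow> real) smooth_mfd.
    (\<forall>k. compact_space (mtop (M k)) \<and> connected_space (mtop (M k)) \<and>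
       (\<exists>(G :: (nat \<Rightarrow> real) monoid) (L :: (nat \<Rightarrow> real) smooth_mfd) act.
          homogeneous_space G L act (M k) \<and>
          (\<exists>g H. brf_pair (M k) g H \<and> non_flat_pair (M k) g H \<and>
             invariant_pair G act (M k) g H))) \<and>
    (\<forall>k l. k \<noteq> l \<longrightarrow> \<not> diffeomorphic (M k) (M l))"
proof (intro exI[of _ "\<lambda>k. sph (3 + k)"] conjI allI impI)
  fix k
  show "compact_space (mtop (sph (3 + k)))"
    by (simp add: compact_space_subtopology compact_spheres)
  show "connected_space (mtop (sph (3 + k)))"
    using connected_spheres connectedin_def connectedin_iff_connected by (metis sph_simps(1))
  show "\<exists>(G :: (nat \<Rightarrow> real) monoid) (L :: (nat \<Rightarrow> real) smooth_mfd) act.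
      homogeneous_space G L act (sph (3 + k)) \<and>
      (\<exists>g H. brf_pair (sph (3 + k)) g H \<and> non_flat_pair (sph (3 + k)) g H \<and> invariant_pair G act (sph (3 + k)) g H)"
    using homogeneous_space_sph[of "3 + k"] sph_brf_pair[of "3 + k"] by (meson le_add1)
next
  fix k l :: nat assume "k \<noteq> l"
  then show "\<not> diffeomorphic (sph (3 + k)) (sph (3 + l))"
    using diffeomorphic_sph_dim_le[of "3 + k" "3 + l"] diffeomorphic_sph_dim_le[of "3 + l" "3 + k"]
      diffeomorphic_sym[of "sph (3 + k)" "sph (3 + l)"] by force
qed

end
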